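(* For a Tychonoff $\mu$-complete $k_{\mathbb R}$-space $X$ the following conditions are equivalent: (1) $X$ is a cosmic $k_\omega$-space. (2) The free linear topological space $\mathsf{Lin}(X)$ of $X$ is a cosmic $k_\omega$-space. (3) $X$ is an $\aleph_k$-space and $\mathsf{Lin}(X)$ is a $k$-space. (4) $X$ is a $\bar\aleph_k$-space and $\mathsf{Lin}(X)$ is Ascoli. (5) $X$ is a $\bar\aleph_k$-space and $\mathsf{Lin}(X)$ contains no strong $\mathrm{Fin}^{\omega_1}$-fan. (6) $X$ is an $\aleph_k$-space and $\mathsf{Lin}(X)$ contains no $\mathrm{Fin}^{\omega_1}$-fan.
   Context: A linear topological space is a Hausdorff linear topological space over the field $\mathbb R$. The free linear topological space of $X$ is a linear topological space $\mathsf{Lin}(X)$ with a continuous map $\delta_X:X\to\mathsf{Lin}(X)$ such that for every continuous map $f:X\to Y$ to a linear topological space $Y$ there is a unique continuous linear operator $\bar f:\mathsf{Lin}(X)\to Y$ with $\bar f\circ\delta_X=f$. "Regular" includes $T_1$. A family $\mathcal N$ of subsets of a space $Y$ is a network if for each $y\in Y$ and neighborhood $O_y$ of $y$ there is $N\in\mathcal N$ with $y\in N\subset O_y$; it is a $k$-network if for each open $U\subset Y$ and compact $K\subset U$ there is a finite $\mathcal F\subset\mathcal N$ with $K\subset\bigcup\mathcal F\subset U$; it is compact-countable if each compact subset of $Y$ meets at most countably many members of $\mathcal N$. A regular space is cosmic if it has a countable network, an $\aleph_k$-space if it has a compact-countable $k$-network, and a $\bar\aleph_k$-space if it has a compact-countable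 $k$-network consisting of closed sets. $Y$ is a $k$-space if $A\subset Y$ is closed whenever $A\cap K$ is closed in $K$ for every compact $K\subset Y$. $Y$ is a $k_\omega$-space if it has a countable cover $\mathcal K$ by compact subsets such that $F\subset Y$ is closed iff $F\cap K$ is closed in $K$ for all $K\in\mathcal K$. $Y$ is a $k_{\mathbb R}$-space if every function $f:Y\to\mathbb R$ whose restriction to each compact subset of $Y$ is continuous is continuous. A Tychonoff space $Y$ is Ascoli if for each compact subset $K$ of the space $C_k(Y)$ of continuous real-valued functions on $Y$ with the compact-open topology, the evaluation map $K\times Y\to\mathbb R$ is continuous. A subset $B\subset Y$ is bounded if every locally finite family of open subsets of $Y$ each meeting $B$ is finite; $Y$ is $\mu$-complete if each closed bounded subset of $Y$ is compact. A family $(F_\alpha)_{\alpha\in\omega_1}$ of subsets of $Y$ is locally finite if each point of $Y$ has a neighborhood meeting $F_\alpha$ for only finitely many $\alpha$; it is compact-finite if each compact subset of $Y$ meets $F_\alpha$ for only finitely many $\alpha$. A set $U\subset Y$ is $\mathbb R$-open if for each $y\in U$ there is a continuous $f:Y\to[0,1]$ with $f(y)=1$ and $f(Y\setminus U)\subset\{0\}$. A $\mathrm{Fin}^{\omega_1}$-fan in $Y$ is a family $(F_\alpha)_{\alpha\in\omega_1}$ of finite (possibly empty) subsets of $Y$ that is compact-finite but not locally finite; it is strong if each $F_\alpha$ has an $\mathbb R$-open neighborhood $U_\alpha\supset F_\alpha$ such that $(U_\alpha)_{\alpha\in\omega_1}$ is compact-finite. *)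

theory Defs
  imports "HOL-Analysis.Analysis"
begin

section \<open>Linear topological spaces and the free linear topological space\<close>

text \<open>A linear topological space is carried by a linear subspace of a real vector space type, so
  that subspaces are again linear topological spaces over the same type.\<close>

definition lin_top_space :: "'v::real_vector topology \<Rightarrow> bool" where
  "lin_top_space Y \<longleftrightarrow>
     subspace (topspace Y) \<and> Hausdorff_space Y \<and>
     continuous_map (prod_topology Y Y) Y (\<lambda>(u, v). u + v) \<and>
     continuous_map (prod_topology euclideanreal Y) Y (\<lambda>(r, v). r *\<^sub>R v)"

definition continuous_linear_operator ::
  "'v::real_vector topology \<Rightarrow> 'w::real_vector topology \<Rightarrow> ('v \<Rightarrow> 'w) \<Rightarrow> bool" where
  "continuous_linear_operator L Y g \<longleftrightarrow>
     continuous_map L Y g \<and>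
     (\<forall>u\<in>topspace L. \<forall>v\<in>topspace L. g (u + v) = g u + g v) \<and>
     (\<forall>r. \<forall>v\<in>topspace L. g (r *\<^sub>R v) = r *\<^sub>R g v)"

text \<open>The defining property of the free linear topological space, for all target spaces carried by
  subspaces of the type \<open>'y\<close>. Operators are taken extensional so that uniqueness only concerns
  their values on the carrier of \<open>L\<close>.\<close>

definition free_lin_top_space_wrt ::
  "'y::real_vector itself \<Rightarrow> 'x topology \<Rightarrow> 'l::real_vector topology \<Rightarrow> ('x \<Rightarrow> 'l) \<Rightarrow> bool" where
  "free_lin_top_space_wrt _ X L \<delta> \<longleftrightarrow>
     lin_top_space L \<and> continuous_map X L \<delta> \<and>
     (\<forall>(Y :: 'y topology) f. lin_top_space Y \<and> continuous_map X Y f \<longrightarrow>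
        (\<exists>!g. g \<in> extensional (topspace L) \<and> continuous_linear_operator L Y g \<and>
              (\<forall>x\<in>topspace X. g (\<delta> x) = f x)))"

text \<open>A definition cannot quantify over all types \<open>'y\<close>. The type \<open>'l \<times> real\<close> is nontrivial and
  at least as large as \<open>'l\<close>; testing against its subspaces already yields the universal property
  for targets of every type, see \<open>free_lin_top_space_universal\<close> below.\<close>

definition free_lin_top_space :: "'x topology \<Rightarrow> 'l::real_vector topology \<Rightarrow> ('x \<Rightarrow> 'l) \<Rightarrow> bool" where
  "free_lin_top_space X L \<delta> \<longleftrightarrow> free_lin_top_space_wrt TYPE('l \<times> real) X L \<delta>"

section \<open>Separation axioms and networks\<close>

definition tychonoff_space :: "'a topology \<Rightarrow> bool" where
  "tychonoff_space Y \<longleftrightarrow> completely_regular_space Y \<and> t1_space Y"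

definition network_of :: "'a topology \<Rightarrow> 'a set set \<Rightarrow> bool" where
  "network_of Y \<N> \<longleftrightarrow>
     \<N> \<subseteq> Pow (topspace Y) \<and>
     (\<forall>y U. openin Y U \<and> y \<in> U \<longrightarrow> (\<exists>N\<in>\<N>. y \<in> N \<and> N \<subseteq> U))"

definition k_network_of :: "'a topology \<Rightarrow> 'a set set \<Rightarrow> bool" where
  "k_network_of Y \<N> \<longleftrightarrow>
     \<N> \<subseteq> Pow (topspace Y) \<and>
     (\<forall>U K. openin Y U \<and> compactin Y K \<and> K \<subseteq> U \<longrightarrow>
        (\<exists>\<F>. finite \<F> \<and> \<F> \<subseteq> \<N> \<and> K \<subseteq> \<Union>\<F> \<and> \<Union>\<F> \<subseteq> U))"

definition compact_countable_in :: "'a topology \<Rightarrow> 'a set set \<Rightarrow> bool" where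
  "compact_countable_in Y \<N> \<longleftrightarrow> (\<forall>K. compactin Y K \<longrightarrow> countable {N\<in>\<N>. N \<inter> K \<noteq> {}})"

definition cosmic_space :: "'a topology \<Rightarrow> bool" where
  "cosmic_space Y \<longleftrightarrow>
     regular_space Y \<and> t1_space Y \<and> (\<exists>\<N>. countable \<N> \<and> network_of Y \<N>)"

definition aleph_k_space :: "'a topology \<Rightarrow> bool" where
  "aleph_k_space Y \<longleftrightarrow>
     regular_space Y \<and> t1_space Y \<and> (\<exists>\<N>. k_network_of Y \<N> \<and> compact_countable_in Y \<N>)"

definition bar_aleph_k_space :: "'a topology \<Rightarrow> bool" where
  "bar_aleph_k_space Y \<longleftrightarrow>
     regular_space Y \<and> t1_space Y \<and>
     (\<exists>\<N>. k_network_of Y \<N> \<and> compact_countable_in Y \<N> \<and> (\<forall>N\<in>\<N>. closedin Y N))"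

section \<open>Spaces determined by compact sets\<close>

definition k_omega_space :: "'a topology \<Rightarrow> bool" where
  "k_omega_space Y \<longleftrightarrow>
     (\<exists>\<K>. countable \<K> \<and> (\<forall>K\<in>\<K>. compactin Y K) \<and> \<Union>\<K> = topspace Y \<and>
        (\<forall>F. F \<subseteq> topspace Y \<longrightarrow>
           (closedin Y F \<longleftrightarrow> (\<forall>K\<in>\<K>. closedin (subtopology Y K) (F \<inter> K)))))"

definition k_R_space :: "'a topology \<Rightarrow> bool" where
  "k_R_space Y \<longleftrightarrow>
     (\<forall>f :: 'a \<Rightarrow> real.
        (\<forall>K. compactin Y K \<longrightarrow> continuous_map (subtopology Y K) euclideanreal f) \<longrightarrow>
        continuous_map Y euclideanreal f)"

text \<open>A continuous function on \<open>Y\<close> is represented by its extensional version, so that the points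
  of \<open>C_k Y\<close> are exactly the continuous functions on \<open>topspace Y\<close>.\<close>

definition continuous_functions :: "'a topology \<Rightarrow> ('a \<Rightarrow> real) set" where
  "continuous_functions Y = {f \<in> extensional (topspace Y). continuous_map Y euclideanreal f}"

definition C_k :: "'a topology \<Rightarrow> ('a \<Rightarrow> real) topology" where
  "C_k Y = topology_generated_by
     {{f \<in> continuous_functions Y. f ` K \<subseteq> U} | K U. compactin Y K \<and> open U}"

definition ascoli_space :: "'a topology \<Rightarrow> bool" where
  "ascoli_space Y \<longleftrightarrow>
     tychonoff_space Y \<and>
     (\<forall>\<K>. compactin (C_k Y) \<K> \<longrightarrow>
        continuous_map (prod_topology (subtopology (C_k Y) \<K>) Y) euclideanreal (\<lambda>(f, y). f y))"

definition bounded_in :: "'a topology \<Rightarrow> 'a set \<Rightarrow> bool" where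
  "bounded_in Y B \<longleftrightarrow>
     B \<subseteq> topspace Y \<and>
     (\<forall>\<U>. locally_finite_in Y \<U> \<and> (\<forall>U\<in>\<U>. openin Y U \<and> U \<inter> B \<noteq> {}) \<longrightarrow> finite \<U>)"

definition mu_complete_space :: "'a topology \<Rightarrow> bool" where
  "mu_complete_space Y \<longleftrightarrow> (\<forall>B. closedin Y B \<and> bounded_in Y B \<longrightarrow> compactin Y B)"

section \<open>Fans\<close>

text \<open>The cardinal \<open>\<omega>\<^sub>1\<close>, as the carrier of the cardinal successor of \<open>natLeq\<close>.\<close>

definition omega1 :: "nat set set" where
  "omega1 = Field (cardSuc natLeq)"

definition omega1_locally_finite :: "'a topology \<Rightarrow> (nat set \<Rightarrow> 'a set) \<Rightarrow> bool" where
  "omega1_locally_finite Y F \<longleftrightarrow>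
     (\<forall>y\<in>topspace Y. \<exists>V. openin Y V \<and> y \<in> V \<and> finite {\<alpha>\<in>omega1. F \<alpha> \<inter> V \<noteq> {}})"

definition omega1_compact_finite :: "'a topology \<Rightarrow> (nat set \<Rightarrow> 'a set) \<Rightarrow> bool" where
  "omega1_compact_finite Y F \<longleftrightarrow>
     (\<forall>K. compactin Y K \<longrightarrow> finite {\<alpha>\<in>omega1. F \<alpha> \<inter> K \<noteq> {}})"

definition R_open_in :: "'a topology \<Rightarrow> 'a set \<Rightarrow> bool" where
  "R_open_in Y U \<longleftrightarrow>
     U \<subseteq> topspace Y \<and>
     (\<forall>y\<in>U. \<exists>f :: 'a \<Rightarrow> real. continuous_map Y (top_of_set {0..1}) f \<and> f y = 1 \<and>
        f ` (topspace Y - U) \<subseteq> {0})"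

definition fin_omega1_fan :: "'a topology \<Rightarrow> (nat set \<Rightarrow> 'a set) \<Rightarrow> bool" where
  "fin_omega1_fan Y F \<longleftrightarrow>
     (\<forall>\<alpha>\<in>omega1. finite (F \<alpha>) \<and> F \<alpha> \<subseteq> topspace Y) \<and>
     omega1_compact_finite Y F \<and> \<not> omega1_locally_finite Y F"

definition strong_fin_omega1_fan :: "'a topology \<Rightarrow> (nat set \<Rightarrow> 'a set) \<Rightarrow> bool" where
  "strong_fin_omega1_fan Y F \<longleftrightarrow>
     fin_omega1_fan Y F \<and>
     (\<exists>U. (\<forall>\<alpha>\<in>omega1. R_open_in Y (U \<alpha>) \<and> F \<alpha> \<subseteq> U \<alpha>) \<and> omega1_compact_finite Y U)"

section \<open>The universal property for targets of arbitrary type\<close>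

lemma lin_top_space_subtopology:
  assumes Z: "lin_top_space Z" and S: "subspace S" "S \<subseteq> topspace Z"
  shows "lin_top_space (subtopology Z S)"
proof -
  have t: "topspace (subtopology Z S) = S" using S by (simp add: inf_absorb2)
  have p: "continuous_map (prod_topology Z Z) Z (\<lambda>(u, v). u + v)"
    and m: "continuous_map (prod_topology euclideanreal Z) Z (\<lambda>(r, v). r *\<^sub>R v)"
    and H: "Hausdorff_space Z"
    using Z by (auto simp: lin_top_space_def)
  have "continuous_map (prod_topology (subtopology Z S) (subtopology Z S)) (subtopology Z S)
          (\<lambda>(u, v). u + v)"
  proof (rule continuous_map_into_subtopology)
    show "continuous_map (prod_topology (subtopology Z S) (subtopology Z S)) Z (\<lambda>(u, v). u + v)"
      using continuous_map_from_subtopology[OF p, of "S \<times> S"]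
      by (simp only: subtopology_Times)
  qed (use S in \<open>auto simp: subspace_def\<close>)
  moreover have "continuous_map (prod_topology euclideanreal (subtopology Z S)) (subtopology Z S)
          (\<lambda>(r, v). r *\<^sub>R v)"
  proof (rule continuous_map_into_subtopology)
    show "continuous_map (prod_topology euclideanreal (subtopology Z S)) Z (\<lambda>(r, v). r *\<^sub>R v)"
      using continuous_map_from_subtopology[OF m, of "UNIV \<times> S"]
      by (simp only: subtopology_Times subtopology_UNIV)
  qed (use S in \<open>auto simp: subspace_def\<close>)
  ultimately show ?thesis
    using S H t by (simp add: lin_top_space_def Hausdorff_space_subtopology)
qed

lemma lin_top_space_transport:
  fixes Z :: "'z::real_vector topology" and i :: "'z \<Rightarrow> 'w::real_vector"
  assumes Z: "lin_top_space Z" and i: "linear i" "inj_on i (topspace Z)"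
  obtains W j where "lin_top_space W" "linear j" "topspace W = i ` topspace Z"
    "continuous_map Z W i" "continuous_map W Z j" "\<And>z. z \<in> topspace Z \<Longrightarrow> j (i z) = z"
proof -
  have sub: "subspace (topspace Z)"
    and p: "continuous_map (prod_topology Z Z) Z (\<lambda>(u, v). u + v)"
    and m: "continuous_map (prod_topology euclideanreal Z) Z (\<lambda>(r, v). r *\<^sub>R v)"
    and H: "Hausdorff_space Z"
    using Z by (auto simp: lin_top_space_def)
  obtain j where j: "linear j" "\<And>z. z \<in> topspace Z \<Longrightarrow> j (i z) = z"
    using linear_exists_left_inverse_on[OF i(1) sub i(2)] by blast
  define W where "W = pullback_topology (i ` topspace Z) j Z"
  have t: "topspace W = i ` topspace Z"
    using j by (auto simp: W_def topspace_pullback_topology)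
  have subW: "subspace (topspace W)"
    unfolding t using i(1) sub by (rule linear_subspace_image)
  have cj: "continuous_map W Z j"
    unfolding W_def using continuous_map_pullback[of Z Z id] by (simp add: o_def)
  have ij: "i (j w) = w" if "w \<in> topspace W" for w using that j t by auto
  have into: "continuous_map T W g"
    if "continuous_map T Z (\<lambda>x. j (g x))" "g ` topspace T \<subseteq> topspace W" for T :: "'t topology" and g
    unfolding W_def by (rule continuous_map_pullback') (use that t in \<open>auto simp: o_def\<close>)
  have ci: "continuous_map Z W i"
  proof (rule into)
    show "continuous_map Z Z (\<lambda>x. j (i x))"
      by (rule continuous_map_eq[of Z Z id]) (auto simp: j)
  qed (simp add: t)
  have injj: "inj_on j (topspace W)" using ij by (rule inj_on_inverseI)
  have "Hausdorff_space W"
    by (rule Hausdorff_space_injective_preimage[OF H cj injj])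
  moreover have "continuous_map (prod_topology W W) W (\<lambda>(u, v). u + v)"
  proof (rule into)
    have "continuous_map (prod_topology W W) (prod_topology Z Z) (\<lambda>(u, v). (j u, j v))"
      using cj by (simp only: continuous_map_prod_top) simp
    from continuous_map_compose[OF this p]
    show "continuous_map (prod_topology W W) Z (\<lambda>x. j (case x of (u, v) \<Rightarrow> u + v))"
      by (simp add: o_def split_def linear_add[OF j(1)])
  qed (use subW in \<open>auto simp: subspace_def\<close>)
  moreover have "continuous_map (prod_topology euclideanreal W) W (\<lambda>(r, v). r *\<^sub>R v)"
  proof (rule into)
    have "continuous_map (prod_topology euclideanreal W) (prod_topology euclideanreal Z)
            (\<lambda>(u, v). (id u, j v))"
      using cj by (simp only: continuous_map_prod_top) simp
    from continuous_map_compose[OF this m]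
    show "continuous_map (prod_topology euclideanreal W) Z (\<lambda>x. j (case x of (r, v) \<Rightarrow> r *\<^sub>R v))"
      by (simp add: o_def split_def linear_scale[OF j(1)])
  qed (use subW in \<open>auto simp: subspace_def\<close>)
  ultimately have "lin_top_space W" using subW by (simp add: lin_top_space_def)
  then show thesis using that j t ci cj by blast
qed

lemma continuous_linear_operator_compose:
  assumes g: "continuous_linear_operator L Y g" and h: "continuous_map Y Z h" "linear h"
  shows "continuous_linear_operator L Z (\<lambda>x. h (g x))"
  using g continuous_map_compose[of L Y g Z h] h
  by (auto simp: continuous_linear_operator_def o_def linear_add linear_scale)

lemma continuous_linear_operator_restrict:
  assumes "subspace (topspace L)" "continuous_linear_operator L Y g"
  shows "continuous_linear_operator L Y (restrict g (topspace L))"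
  using assms continuous_map_eq[of L Y g "restrict g (topspace L)"]
  by (auto simp: continuous_linear_operator_def subspace_def)

lemma free_lin_top_space_unique:
  fixes L :: "'l::real_vector topology" and Y :: "('l \<times> real) topology"
  assumes F: "free_lin_top_space X L \<delta>" and Y: "lin_top_space Y"
    and g: "continuous_linear_operator L Y g" and h: "continuous_linear_operator L Y h"
    and eq: "\<And>x. x \<in> topspace X \<Longrightarrow> g (\<delta> x) = h (\<delta> x)" and v: "v \<in> topspace L"
  shows "g v = h v"
proof -
  let ?g = "restrict g (topspace L)" and ?h = "restrict h (topspace L)"
  have L: "lin_top_space L" "continuous_map X L \<delta>"
    using F by (auto simp: free_lin_top_space_def free_lin_top_space_wrt_def)
  have sub: "subspace (topspace L)" using L by (simp add: lin_top_space_def)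
  have d: "\<delta> x \<in> topspace L" if "x \<in> topspace X" for x
    using L that by (auto simp: continuous_map_def)
  have c: "continuous_map X Y (\<lambda>x. g (\<delta> x))"
    using continuous_map_compose[OF L(2), of Y g] g
    by (simp add: continuous_linear_operator_def o_def)
  have "?g \<in> extensional (topspace L) \<and> continuous_linear_operator L Y ?g \<and>
          (\<forall>x\<in>topspace X. ?g (\<delta> x) = g (\<delta> x))"
    using continuous_linear_operator_restrict[OF sub g] d by auto
  moreover have "?h \<in> extensional (topspace L) \<and> continuous_linear_operator L Y ?h \<and>
          (\<forall>x\<in>topspace X. ?h (\<delta> x) = g (\<delta> x))"
    using continuous_linear_operator_restrict[OF sub h] d eq by auto
  moreover have "\<exists>!k. k \<in> extensional (topspace L) \<and> continuous_linear_operator L Y k \<and>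
          (\<forall>x\<in>topspace X. k (\<delta> x) = g (\<delta> x))"
    using F Y c by (simp add: free_lin_top_space_def free_lin_top_space_wrt_def)
  ultimately have "?g = ?h" by blast
  then have "?g v = ?h v" by simp
  then show ?thesis using v by simp
qed

lemma free_lin_top_space_extend:
  fixes L :: "'l::real_vector topology" and Y :: "('l \<times> real) topology"
  assumes "free_lin_top_space X L \<delta>" and "lin_top_space Y" and "continuous_map X Y f"
  obtains g where "continuous_linear_operator L Y g" "\<And>x. x \<in> topspace X \<Longrightarrow> g (\<delta> x) = f x"
  using assms unfolding free_lin_top_space_def free_lin_top_space_wrt_def by metis

lemma free_lin_top_space_span:
  fixes L :: "'l::real_vector topology"
  assumes F: "free_lin_top_space X L \<delta>"
  shows "topspace L = span (\<delta> ` topspace X)"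
proof
  let ?M = "span (\<delta> ` topspace X)" and ?i = "\<lambda>v::'l. (v, 0::real)"
  have L: "lin_top_space L" "continuous_map X L \<delta>"
    using F by (auto simp: free_lin_top_space_def free_lin_top_space_wrt_def)
  have sub: "subspace (topspace L)" using L by (simp add: lin_top_space_def)
  show M: "?M \<subseteq> topspace L"
    using L sub by (intro span_minimal) (auto simp: continuous_map_def)
  let ?Z = "subtopology L ?M"
  have Z: "lin_top_space ?Z" by (rule lin_top_space_subtopology[OF L(1) subspace_span M])
  have li: "linear ?i" by (rule linearI) auto
  have inj: "inj_on ?i A" for A by (auto simp: inj_on_def)
  obtain W j where W: "lin_top_space W" "linear j" "continuous_map ?Z W ?i" "continuous_map W ?Z j"
      "\<And>z. z \<in> topspace ?Z \<Longrightarrow> j (?i z) = z"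
    using lin_top_space_transport[OF Z li inj] by metis
  obtain V k where V: "lin_top_space V" "continuous_map L V ?i"
    using lin_top_space_transport[OF L(1) li inj] by metis
  have dZ: "continuous_map X ?Z \<delta>"
    using L(2) by (intro continuous_map_into_subtopology) (auto intro: span_base)
  obtain g where g: "continuous_linear_operator L W g"
      "\<And>x. x \<in> topspace X \<Longrightarrow> g (\<delta> x) = ?i (\<delta> x)"
    using free_lin_top_space_extend[OF F W(1), of "\<lambda>x. ?i (\<delta> x)"]
      continuous_map_compose[OF dZ W(3)] by (auto simp: o_def)
  have jg: "continuous_linear_operator L ?Z (\<lambda>v. j (g v))"
    by (rule continuous_linear_operator_compose[OF g(1) W(4) W(2)])
  then have "continuous_linear_operator L L (\<lambda>v. j (g v))"
    by (auto simp: continuous_linear_operator_def intro: continuous_map_into_fulltopology)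
  then have 1: "continuous_linear_operator L V (\<lambda>v. ?i (j (g v)))"
    by (rule continuous_linear_operator_compose[OF _ V(2) li])
  have 2: "continuous_linear_operator L V ?i"
    using V(2) by (simp add: continuous_linear_operator_def)
  show "topspace L \<subseteq> ?M"
  proof
    fix v assume v: "v \<in> topspace L"
    have "?i (j (g v)) = ?i v"
    proof (rule free_lin_top_space_unique[OF F V(1) 1 2 _ v])
      fix x assume x: "x \<in> topspace X"
      then have "\<delta> x \<in> topspace ?Z" using dZ by (auto simp: continuous_map_def)
      then have "j (?i (\<delta> x)) = \<delta> x" by (rule W(5))
      then show "?i (j (g (\<delta> x))) = ?i (\<delta> x)" using g(2)[OF x] by simp
    qed
    then have "v = j (g v)" by simp
    also have "j (g v) \<in> topspace ?Z"
      using jg v by (auto simp: continuous_linear_operator_def continuous_map_def)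
    finally show "v \<in> ?M" by simp
  qed
qed

lemma tychonoff_separates_finite:
  assumes X: "tychonoff_space X" and F: "finite F" "F \<subseteq> topspace X" "x \<in> topspace X - F"
  obtains \<phi> where "continuous_map X euclideanreal \<phi>" "\<phi> x = 1" "\<And>y. y \<in> F \<Longrightarrow> \<phi> y = 0"
proof -
  have "closedin X F"
    using X F by (simp add: tychonoff_space_def t1_space_closedin_finite)
  then obtain f where f: "continuous_map X (top_of_set {0..1::real}) f" "f x = 0" "f ` F \<subseteq> {1}"
    using X F(3) unfolding tychonoff_space_def completely_regular_space_def by blast
  have "continuous_map X euclideanreal f"
    using f(1) by (auto intro: continuous_map_into_fulltopology)
  then have "continuous_map X euclideanreal (\<lambda>x. 1 - f x)"
    by (intro continuous_intros) auto
  then show thesis using that[of "\<lambda>x. 1 - f x"] f by auto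
qed

lemma free_lin_top_space_separates:
  fixes L :: "'l::real_vector topology"
  assumes X: "tychonoff_space X" and F: "free_lin_top_space X L \<delta>"
    and A: "finite A" "A \<subseteq> topspace X" "x \<in> topspace X - A"
  shows "\<delta> x \<notin> span (\<delta> ` A)"
proof
  assume a: "\<delta> x \<in> span (\<delta> ` A)"
  let ?i = "\<lambda>r::real. (0::'l, r)"
  have L: "lin_top_space L" "continuous_map X L \<delta>"
    using F by (auto simp: free_lin_top_space_def free_lin_top_space_wrt_def)
  have sub: "subspace (topspace L)" using L by (simp add: lin_top_space_def)
  obtain \<phi> where phi: "continuous_map X euclideanreal \<phi>" "\<phi> x = 1" "\<And>y. y \<in> A \<Longrightarrow> \<phi> y = 0"
    using tychonoff_separates_finite[OF X A] by blast
  have R: "lin_top_space euclideanreal"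
    unfolding lin_top_space_def
    by (auto simp: split_def simp flip: euclidean_product_topology intro!: continuous_intros)
  have li: "linear ?i" by (rule linearI) auto
  have inj: "inj_on ?i B" for B by (auto simp: inj_on_def)
  obtain W j where W: "lin_top_space W" "linear j" "continuous_map euclideanreal W ?i"
      "continuous_map W euclideanreal j" "\<And>r. j (?i r) = r"
    using lin_top_space_transport[OF R li inj] by (metis UNIV_I topspace_euclidean)
  obtain g where g: "continuous_linear_operator L W g"
      "\<And>x. x \<in> topspace X \<Longrightarrow> g (\<delta> x) = ?i (\<phi> x)"
    using free_lin_top_space_extend[OF F W(1), of "\<lambda>x. ?i (\<phi> x)"]
      continuous_map_compose[OF phi(1) W(3)] by (auto simp: o_def)
  define h where "h = (\<lambda>v. j (g v))"
  have h: "continuous_linear_operator L euclideanreal h"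
    unfolding h_def by (rule continuous_linear_operator_compose[OF g(1) W(4) W(2)])
  have hd: "h (\<delta> y) = \<phi> y" if "y \<in> topspace X" for y
    using g(2)[OF that] W(5) by (simp add: h_def)
  have h0: "h 0 = 0"
  proof -
    have "h (0 *\<^sub>R 0) = 0 *\<^sub>R h 0"
      using h subspace_0[OF sub] unfolding continuous_linear_operator_def by blast
    then show ?thesis by simp
  qed
  have "\<delta> x \<in> {v \<in> topspace L. h v = 0}"
  proof (rule subsetD[OF span_minimal a])
    show "\<delta> ` A \<subseteq> {v \<in> topspace L. h v = 0}"
      using A phi(3) hd L(2) by (auto simp: continuous_map_def)
    show "subspace {v \<in> topspace L. h v = 0}"
      using sub h h0 by (auto simp: subspace_def continuous_linear_operator_def)
  qed
  then show False using hd[of x] phi(2) A by simp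
qed

lemma free_lin_top_space_independent:
  fixes L :: "'l::real_vector topology"
  assumes X: "tychonoff_space X" and F: "free_lin_top_space X L \<delta>"
  shows "inj_on \<delta> (topspace X)" and "independent (\<delta> ` topspace X)"
proof -
  show inj: "inj_on \<delta> (topspace X)"
  proof (rule inj_onI, rule ccontr)
    fix x y assume "x \<in> topspace X" "y \<in> topspace X" "\<delta> x = \<delta> y" "x \<noteq> y"
    then show False
      using free_lin_top_space_separates[OF X F, of "{y}" x] by (simp add: span_base)
  qed
  show "independent (\<delta> ` topspace X)"
  proof
    assume "dependent (\<delta> ` topspace X)"
    then obtain x where x: "x \<in> topspace X" "\<delta> x \<in> span (\<delta> ` topspace X - {\<delta> x})"
      unfolding dependent_def by blast
    then obtain T r where T: "finite T" "T \<subseteq> \<delta> ` topspace X - {\<delta> x}" "\<delta> x = (\<Sum>a\<in>T. r a *\<^sub>R a)"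
      unfolding span_explicit by blast
    then have xT: "\<delta> x \<in> span T" by (auto intro: span_sum span_scale span_base)
    have "T \<subseteq> \<delta> ` (topspace X - {x})" using T by auto
    then obtain A where A: "A \<subseteq> topspace X - {x}" "finite A" "T = \<delta> ` A"
      using finite_subset_image[OF T(1)] by metis
    then show False using free_lin_top_space_separates[OF X F A(2), of x] xT x by auto
  qed
qed

theorem free_lin_top_space_universal:
  fixes X :: "'x topology" and L :: "'l::real_vector topology"
  assumes X: "tychonoff_space X" and F: "free_lin_top_space X L \<delta>"
  shows "free_lin_top_space_wrt TYPE('y::real_vector) X L \<delta>"
  unfolding free_lin_top_space_wrt_def
proof (intro conjI allI impI)
  show L: "lin_top_space L" "continuous_map X L \<delta>"
    using F by (auto simp: free_lin_top_space_def free_lin_top_space_wrt_def)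
  fix Y :: "'y topology" and f :: "'x \<Rightarrow> 'y"
  assume "lin_top_space Y \<and> continuous_map X Y f"
  then have Y: "lin_top_space Y" and f: "continuous_map X Y f" by auto
  have sub: "subspace (topspace L)" using L by (simp add: lin_top_space_def)
  have d: "\<delta> x \<in> topspace L" if "x \<in> topspace X" for x
    using L that by (auto simp: continuous_map_def)
  have "\<exists>g. continuous_linear_operator L Y g \<and> (\<forall>x\<in>topspace X. g (\<delta> x) = f x)"
  proof -
    let ?S = "span (f ` topspace X)"
    have S: "?S \<subseteq> topspace Y"
      using Y f by (intro span_minimal) (auto simp: lin_top_space_def continuous_map_def)
    let ?Z = "subtopology Y ?S"
    have Z: "lin_top_space ?Z" by (rule lin_top_space_subtopology[OF Y subspace_span S])
    have tZ: "topspace ?Z = ?S" using S by auto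
    obtain B where B: "B \<subseteq> f ` topspace X" "independent B" "f ` topspace X \<subseteq> span B"
      using maximal_independent_subset[of "f ` topspace X"] by metis
    have SB: "?S = span B" using B by (metis span_mono span_span subset_antisym)
    obtain s where s: "\<And>b. b \<in> B \<Longrightarrow> s b \<in> topspace X \<and> f (s b) = b"
    proof -
      have "\<forall>b\<in>B. \<exists>x. x \<in> topspace X \<and> f x = b" using B(1) by auto
      then show thesis using that by (metis bchoice)
    qed
    let ?e = "\<lambda>v::'l. (v, 0::real)"
    have le: "linear ?e" by (rule linearI) auto
    obtain p where p: "linear p" "\<And>b. b \<in> B \<Longrightarrow> p b = ?e (\<delta> (s b))"
      using linear_independent_extend[OF B(2), of "\<lambda>b. ?e (\<delta> (s b))"] by blast
    have injs: "inj_on s B" by (metis s inj_onI)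
    have injds: "inj_on (\<lambda>b. \<delta> (s b)) B"
      using free_lin_top_space_independent(1)[OF X F] injs s by (simp add: inj_on_def)
    have "independent ((\<lambda>b. \<delta> (s b)) ` B)"
      by (rule independent_mono[OF free_lin_top_space_independent(2)[OF X F]]) (use s in auto)
    then have "independent (?e ` (\<lambda>b. \<delta> (s b)) ` B)"
      by (rule linear_independent_injective_image[OF le]) (auto simp: inj_on_def)
    moreover have pB: "p ` B = ?e ` (\<lambda>b. \<delta> (s b)) ` B"
      using p(2) by (auto simp: image_iff)
    ultimately have indp: "independent (p ` B)" by simp
    have "inj_on p B" using injds p(2) by (auto simp: inj_on_def)
    then have "inj_on p (span B)"
      by (rule linear_inj_on_span_independent_image[OF p(1) indp])
    then have injp: "inj_on p (topspace ?Z)" by (simp only: tZ SB[symmetric])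
    obtain W j where W: "lin_top_space W" "linear j" "continuous_map ?Z W p" "continuous_map W ?Z j"
        "\<And>z. z \<in> topspace ?Z \<Longrightarrow> j (p z) = z"
      using lin_top_space_transport[OF Z p(1) injp] by metis
    have fZ: "continuous_map X ?Z f"
      using f by (intro continuous_map_into_subtopology) (auto intro: span_base)
    obtain g where g: "continuous_linear_operator L W g"
        "\<And>x. x \<in> topspace X \<Longrightarrow> g (\<delta> x) = p (f x)"
      using free_lin_top_space_extend[OF F W(1), of "\<lambda>x. p (f x)"]
        continuous_map_compose[OF fZ W(3)] by (auto simp: o_def)
    have "continuous_linear_operator L ?Z (\<lambda>v. j (g v))"
      by (rule continuous_linear_operator_compose[OF g(1) W(4) W(2)])
    then have "continuous_linear_operator L Y (\<lambda>v. j (g v))"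
      by (auto simp: continuous_linear_operator_def intro: continuous_map_into_fulltopology)
    moreover have "j (g (\<delta> x)) = f x" if "x \<in> topspace X" for x
    proof -
      have "f x \<in> topspace ?Z" unfolding tZ using that by (intro span_base) auto
      from W(5)[OF this] show ?thesis using g(2)[OF that] by simp
    qed
    ultimately show ?thesis by blast
  qed
  then obtain g where g: "continuous_linear_operator L Y g" "\<And>x. x \<in> topspace X \<Longrightarrow> g (\<delta> x) = f x"
    by blast
  have uniq: "h v = g v"
    if h: "continuous_linear_operator L Y h" "\<forall>x\<in>topspace X. h (\<delta> x) = f x"
      and v: "v \<in> topspace L" for h v
  proof -
    have "v \<in> span (\<delta> ` topspace X)"
      using v free_lin_top_space_span[OF F] by simp
    then have "v \<in> topspace L \<and> h v = g v"
    proof (induction rule: span_induct_alt)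
      case base
      have "k 0 = 0" if "continuous_linear_operator L Y k" for k
      proof -
        have "k (0 *\<^sub>R 0) = 0 *\<^sub>R k 0"
          using that subspace_0[OF sub] unfolding continuous_linear_operator_def by blast
        then show ?thesis by simp
      qed
      from this[OF h(1)] this[OF g(1)] show ?case using sub by (simp add: subspace_0)
    next
      case (step c u w)
      then have u: "u \<in> topspace L" "h u = g u" using d h g by auto
      then have "c *\<^sub>R u \<in> topspace L" using sub by (simp add: subspace_def)
      then show ?case
        using step u h(1) g(1) sub by (auto simp: continuous_linear_operator_def subspace_def)
    qed
    then show ?thesis by simp
  qed
  show "\<exists>!g. g \<in> extensional (topspace L) \<and> continuous_linear_operator L Y g \<and>
              (\<forall>x\<in>topspace X. g (\<delta> x) = f x)"
  proof (rule ex1I[of _ "restrict g (topspace L)"])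
    show "restrict g (topspace L) \<in> extensional (topspace L) \<and>
        continuous_linear_operator L Y (restrict g (topspace L)) \<and>
        (\<forall>x\<in>topspace X. restrict g (topspace L) (\<delta> x) = f x)"
      using continuous_linear_operator_restrict[OF sub g(1)] g(2) d by auto
  next
    fix h assume h: "h \<in> extensional (topspace L) \<and> continuous_linear_operator L Y h \<and>
        (\<forall>x\<in>topspace X. h (\<delta> x) = f x)"
    then show "h = restrict g (topspace L)"
      using uniq[of h] by (intro extensionalityI[of _ "topspace L"]) auto
  qed
qed

end

theory Submission
  imports Defs "HOL-Library.Countable_Set_Type"
begin

text \<open>If \<open>X\<close> is a cosmic \<open>k\<^sub>\<omega>\<close>-space, then \<open>Lin(X)\<close> is the inductive limit of the compact sets of
  bounded linear combinations over the members of a \<open>k\<^sub>\<omega>\<close>-sequence, because this inductive limit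
  topology is linear. Conversely, \<open>\<delta>\<close> is a closed embedding. No \<open>k\<close>-space contains a
  \<open>Fin\<close>-fan, and no Ascoli space contains a strong one: bump functions around the members of a
  strong fan converge to zero in \<open>C\<^sub>k\<close>.

  For the remaining implications, compact subsets of \<open>Lin(X)\<close> have supports in a compact subset of
  \<open>X\<close>, by \<open>\<mu>\<close>-completeness. If every neighborhood of \<open>x\<close> contains one of countably many unbounded
  sets \<open>M\<^sub>i\<close>, then suitable \<open>\<delta>(d\<^sub>i\<^sub>m) - \<delta>(x) + (1/m) \<delta>(e\<^sub>i)\<close> with \<open>d\<^sub>i\<^sub>m \<in> M\<^sub>i\<close> form a strong fan at
  \<open>0\<close>. Hence, without strong fans, the members with compact closure of a compact-countable \<open>k\<close>-network still form a
  \<open>k\<close>-network. Under chains of intersecting members this family splits into countable classes with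
  disjoint unions, and a compact set meets only finitely many of the unions. If there were
  uncountably many classes, points \<open>x\<^sub>\<alpha>\<close> in \<open>\<omega>\<^sub>1\<close> many of them would give the fan
  \<open>(\<delta>(x\<^sub>\<alpha>) + \<delta>(x\<^sub>\<beta>)) / e(\<alpha>,\<beta>)\<close>. So the network is countable, \<open>X\<close> is hemicompact, and a
  hemicompact Tychonoff \<open>k\<^sub>\<real>\<close>-space is a \<open>k\<^sub>\<omega>\<close>-space by Tietze's theorem.\<close>

section \<open>Linear topological spaces and inductive limits\<close>

text \<open>The topology of \<open>L\<close> has no usable explicit description. Its open sets are
  reached in two ways only: through continuous functionals, which the universal property supplies
  and which separate points and surround fans, and through continuity of the operations at 0, which
  is all that is known about an arbitrary neighborhood of 0. Hence every fan built here accumulates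
  at 0, and each of its vectors is detected by two functionals: a single one would leave infinitely
  many indices alive on a compact set, two of them pin down both components of the index.

  The scalars 1/e(\<alpha>,\<beta>) answer the second constraint. A neighborhood of 0 gives each
  point its own threshold beyond which its multiples are small, without any uniform bound;
  \<open>e\<close> exceeds both thresholds at infinitely many pairs, whatever the thresholds are.

  Closed networks matter for strong fans. With closed members, the union of a class and its
  complement have closed traces on each compact set, so the union is open in a
  \<open>k_R_space\<close> and can serve as a neighborhood in a strong fan; otherwise the same
  points give only a fan.\<close>

lemma continuous_map_lts_add:
  assumes "lin_top_space Y" "continuous_map T Y f" "continuous_map T Y g"
  shows "continuous_map T Y (\<lambda>x. f x + g x)"
proof -
  have "continuous_map T (prod_topology Y Y) (\<lambda>x. (f x, g x))"
    using assms by (intro continuous_map_pairedI)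
  with assms(1) show ?thesis
    unfolding lin_top_space_def by (auto dest: continuous_map_compose simp: o_def)
qed

lemma continuous_map_lts_scaleR:
  assumes "lin_top_space Y" "continuous_map T euclideanreal r" "continuous_map T Y f"
  shows "continuous_map T Y (\<lambda>x. r x *\<^sub>R f x)"
proof -
  have "continuous_map T (prod_topology euclideanreal Y) (\<lambda>x. (r x, f x))"
    using assms by (intro continuous_map_pairedI)
  with assms(1) show ?thesis
    unfolding lin_top_space_def by (auto dest: continuous_map_compose simp: o_def)
qed

lemma continuous_map_lts_diff:
  assumes "lin_top_space Y" "continuous_map T Y f" "continuous_map T Y g"
  shows "continuous_map T Y (\<lambda>x. f x - g x)"
  using continuous_map_lts_add[OF assms(1,2) continuous_map_lts_scaleR[OF assms(1) _ assms(3), of "\<lambda>_. -1"]]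
  by simp

text \<open>By continuity of (p, q) \<mapsto> a + (p - q) at (0, 0), small translates a +
  \<open>W1\<close> and c + \<open>W2\<close> with c in \<open>C\<close> cannot share a point y: the
  point a + ((y - a) - (y - c)) is c itself and would lie outside \<open>C\<close>.\<close>

lemma lin_top_space_regular:
  assumes L: "lin_top_space L" shows "regular_space L"
  unfolding regular_space_def
proof (intro allI impI, elim conjE)
  fix C a assume C: "closedin L C" and a: "a \<in> topspace L - C"
  have s: "subspace (topspace L)" using L by (simp add: lin_top_space_def)
  define O1 where "O1 = topspace L - C"
  have O1: "openin L O1" using C by (simp add: O1_def openin_diff)
  have c: "continuous_map (prod_topology L L) L (\<lambda>p. a + (fst p - snd p))"
    using a by (intro continuous_map_lts_add continuous_map_lts_diff L continuous_map_fst continuous_map_snd) auto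
  define P where "P = {p \<in> topspace (prod_topology L L). a + (fst p - snd p) \<in> O1}"
  have "openin (prod_topology L L) P"
    unfolding P_def using c O1 by (rule openin_continuous_map_preimage)
  moreover have "(0,0) \<in> P" using a s by (auto simp: subspace_0 O1_def P_def)
  ultimately have "\<exists>U V. openin L U \<and> openin L V \<and> 0 \<in> U \<and> 0 \<in> V \<and> U \<times> V \<subseteq> P"
    by (simp add: openin_prod_topology_alt)
  then obtain W1 W2 where W: "openin L W1" "openin L W2" "0 \<in> W1" "0 \<in> W2" "W1 \<times> W2 \<subseteq> P"
    by (elim exE conjE)
  have diffc: "continuous_map L L (\<lambda>y. y - c)" if "c \<in> topspace L" for c
    using that by (intro continuous_map_lts_diff L) auto
  define U where "U = {y \<in> topspace L. y - a \<in> W1}"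
  define V where "V = (\<Union>c\<in>C. {y \<in> topspace L. y - c \<in> W2})"
  have Cs: "C \<subseteq> topspace L" using C by (rule closedin_subset)
  have "openin L U" unfolding U_def
    using openin_continuous_map_preimage[OF diffc W(1)] a by blast
  moreover have "openin L V" unfolding V_def
    using openin_continuous_map_preimage[OF diffc W(2)] Cs by blast
  moreover have "a \<in> U" using a W by (auto simp: U_def)
  moreover have "C \<subseteq> V" using Cs W by (auto simp: V_def)
  moreover have "disjnt U V"
  proof (rule ccontr)
    assume "\<not> disjnt U V"
    then obtain y c where y: "y - a \<in> W1" "y - c \<in> W2" "c \<in> C"
      by (auto simp: U_def V_def disjnt_def)
    then have "(y - a, y - c) \<in> P" using W(5) by blast
    then have "a + ((y - a) - (y - c)) \<in> O1" by (simp add: P_def)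
    then show False using y by (simp add: O1_def)
  qed
  ultimately show "\<exists>U V. openin L U \<and> openin L V \<and> a \<in> U \<and> C \<subseteq> V \<and> disjnt U V" by blast
qed

lemma Hausdorff_compact_neighbourhood_chain_step:
  assumes Y: "Hausdorff_space Y" and A: "compactin Y A" and P: "compactin Y P" "P \<subseteq> A"
    and U: "openin (subtopology Y A) U" "P \<subseteq> U"
  obtains Q G where "compactin Y Q" "openin (subtopology Y A) G" "P \<subseteq> G" "G \<subseteq> Q" "Q \<subseteq> U"
proof -
  let ?S = "subtopology Y A"
  have As: "A \<subseteq> topspace Y" using A by (rule compactin_subset_topspace)
  have t: "topspace ?S = A" using As by (simp add: inf_absorb2)
  have H: "Hausdorff_space ?S" using Y by (rule Hausdorff_space_subtopology)
  have cS: "compact_space ?S" using A by (simp add: compactin_subspace)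
  have n: "normal_space ?S" using cS H by (simp add: compact_Hausdorff_or_regular_imp_normal_space)
  have cP: "closedin ?S P"
    using H P by (intro compactin_imp_closedin) (auto simp: compactin_subtopology)
  obtain G where G: "openin ?S G" "P \<subseteq> G" "?S closure_of G \<subseteq> U"
    using n[unfolded normal_space_alt] cP U by metis
  have "compactin ?S (?S closure_of G)"
    using cS by (intro closedin_compact_space) auto
  then have "compactin Y (?S closure_of G)" by (simp add: compactin_subtopology)
  moreover have "G \<subseteq> ?S closure_of G"
    using G(1) by (intro closure_of_subset) (rule openin_subset)
  ultimately show thesis using that G by metis
qed

text \<open>The sets \<open>D n\<close> interleave with the increasing sets \<open>E n\<close>, so
  both have the same union. On \<open>C m\<close> only the indices n \<ge> m are needed, and for
  these \<open>C m\<close> lies in \<open>C (N + Suc n)\<close>, so relative openness passes down to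
  \<open>C m\<close>.\<close>

lemma openin_UN_chain:
  assumes C: "incseq C" and D: "\<And>n. openin (subtopology T (C (N + Suc n))) (D n)"
    and E: "\<And>n. E n \<subseteq> D n" "\<And>n. D n \<subseteq> E (Suc n)"
  shows "openin (subtopology T (C m)) ((\<Union>n. E n) \<inter> C m)"
proof -
  have incE: "incseq E" using E by (intro incseq_SucI) blast
  have "(\<Union>n. E n) \<inter> C m = (\<Union>n\<in>{m..}. D n \<inter> C m)"
  proof (intro equalityI subsetI)
    fix x assume "x \<in> (\<Union>n. E n) \<inter> C m"
    then obtain n where "x \<in> E n" "x \<in> C m" by blast
    then have "x \<in> D (max n m)" using incseqD[OF incE, of n "max n m"] E(1) by auto
    then show "x \<in> (\<Union>n\<in>{m..}. D n \<inter> C m)" using \<open>x \<in> C m\<close> by (intro UN_I[of "max n m"]) auto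
  qed (use E(2) in blast)
  moreover have "openin (subtopology T (C m)) (D n \<inter> C m)" if "n \<in> {m..}" for n
  proof -
    obtain O' where O': "openin T O'" "D n = O' \<inter> C (N + Suc n)" using D[of n] by (auto simp: openin_subtopology)
    moreover have "C m \<subseteq> C (N + Suc n)" using that by (intro incseqD[OF C]) auto
    ultimately have "D n \<inter> C m = O' \<inter> C m" by blast
    then show ?thesis using O' by (auto simp: openin_subtopology)
  qed
  ultimately show ?thesis by (simp only:) (rule openin_Union, blast)
qed

text \<open>By Wallace's theorem a point of \<open>W\<close> lies in compact boxes \<open>K\<^sub>n \<times> J\<^sub>n \<subseteq> W\<close> whose sides are
  contained in the relative interiors of the sides of the next box; \<open>G\<close> and \<open>H\<close> are the unions of
  the sides.\<close>

lemma k_omega_box: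
  assumes Y: "Hausdorff_space Y" "\<And>n. compactin Y (A n)" "incseq A"
    and Z: "Hausdorff_space Z" "\<And>n. compactin Z (B n)" "incseq B"
    and W: "\<And>n. openin (subtopology (prod_topology Y Z) (A n \<times> B n)) (W \<inter> A n \<times> B n)"
    and p: "y \<in> \<Union>(range A)" "z \<in> \<Union>(range B)" "(y, z) \<in> W"
  obtains G H where "\<And>n. openin (subtopology Y (A n)) (G \<inter> A n)" "G \<subseteq> \<Union>(range A)" "y \<in> G"
    "\<And>n. openin (subtopology Z (B n)) (H \<inter> B n)" "H \<subseteq> \<Union>(range B)" "z \<in> H" "G \<times> H \<subseteq> W"
proof -
  obtain i j where ij: "y \<in> A i" "z \<in> B j" using p by blast
  \<comment> \<open>From \<open>N\<close> on, all \<open>A n\<close> contain y and all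
    \<open>B n\<close> contain z, so the chain can start with the box {y} \<times> {z} at this
    index.\<close>
  define N where "N = max i j"
  have yz: "y \<in> A n" "z \<in> B n" if "n \<ge> N" for n
    using ij incseqD[OF Y(3), of i n] incseqD[OF Z(3), of j n] that by (auto simp: N_def)
  define P where "P = (\<lambda>n (K,J). compactin Y K \<and> compactin Z J \<and> K \<subseteq> A (N + n) \<and> J \<subseteq> B (N + n) \<and>
      y \<in> K \<and> z \<in> J \<and> K \<times> J \<subseteq> W)"
  define R where "R = (\<lambda>n (K,J) (K',J').
      (\<exists>G. openin (subtopology Y (A (N + Suc n))) G \<and> K \<subseteq> G \<and> G \<subseteq> K') \<and>
      (\<exists>G. openin (subtopology Z (B (N + Suc n))) G \<and> J \<subseteq> G \<and> G \<subseteq> J'))"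
  have "\<exists>f. \<forall>n. P n (f n) \<and> R n (f n) (f (Suc n))"
  proof (rule dependent_nat_choice)
    have "P 0 ({y},{z})" using yz[of N] p compactin_subset_topspace[OF Y(2)] compactin_subset_topspace[OF Z(2)]
      by (auto simp: P_def)
    then show "\<exists>x. P 0 x" ..
  next
    fix x n assume "P n x"
    then obtain K J where x: "x = (K,J)" and KJ: "compactin Y K" "compactin Z J" "K \<subseteq> A (N + n)" "J \<subseteq> B (N + n)"
      "y \<in> K" "z \<in> J" "K \<times> J \<subseteq> W" by (cases x) (auto simp: P_def)
    let ?m = "N + Suc n"
    have sub: "K \<subseteq> A ?m" "J \<subseteq> B ?m"
      using KJ incseqD[OF Y(3), of "N + n" ?m] incseqD[OF Z(3), of "N + n" ?m] by auto
    \<comment> \<open>The old box is compact inside the next, larger product. Wallace's theorem puts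
      an open box U \<times> V around it there, and normality of the compact factors fits a new
      compact box in between.\<close>
    have o: "openin (prod_topology (subtopology Y (A ?m)) (subtopology Z (B ?m))) (W \<inter> A ?m \<times> B ?m)"
      using W[of ?m] by (simp add: subtopology_Times)
    obtain U V where UV: "openin (subtopology Y (A ?m)) U" "openin (subtopology Z (B ?m)) V" "K \<subseteq> U" "J \<subseteq> V"
      "U \<times> V \<subseteq> W \<inter> A ?m \<times> B ?m"
    proof (rule Wallace_theorem_prod_topology[OF _ _ o])
      show "compactin (subtopology Y (A ?m)) K" "compactin (subtopology Z (B ?m)) J"
        using KJ sub by (auto simp: compactin_subtopology)
      show "K \<times> J \<subseteq> W \<inter> A ?m \<times> B ?m" using KJ sub by blast
    qed
    obtain K' G where K': "compactin Y K'" "openin (subtopology Y (A ?m)) G" "K \<subseteq> G" "G \<subseteq> K'" "K' \<subseteq> U"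
      using Hausdorff_compact_neighbourhood_chain_step[OF Y(1) Y(2) KJ(1) sub(1) UV(1,3)] by metis
    obtain J' G' where J': "compactin Z J'" "openin (subtopology Z (B ?m)) G'" "J \<subseteq> G'" "G' \<subseteq> J'" "J' \<subseteq> V"
      using Hausdorff_compact_neighbourhood_chain_step[OF Z(1) Z(2) KJ(2) sub(2) UV(2,4)] by metis
    have "U \<subseteq> A ?m" "V \<subseteq> B ?m" using openin_subset[OF UV(1)] openin_subset[OF UV(2)] by auto
    then have "K' \<subseteq> A ?m" "J' \<subseteq> B ?m" using K'(5) J'(5) by simp_all
    moreover have "K' \<times> J' \<subseteq> U \<times> V" using K'(5) J'(5) by (rule Sigma_mono)
    moreover have "U \<times> V \<subseteq> W" using UV(5) by simp
    ultimately have "K' \<times> J' \<subseteq> W" "K' \<subseteq> A ?m" "J' \<subseteq> B ?m" by (meson order_trans)+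
    moreover have "y \<in> K'" "z \<in> J'" using K'(3,4) J'(3,4) KJ(5,6) by auto
    ultimately have "P (Suc n) (K',J')" unfolding P_def using K'(1) J'(1) by simp
    moreover have "R n x (K',J')" unfolding R_def x using K'(2-4) J'(2-4) by auto
    ultimately have "P (Suc n) (K',J') \<and> R n x (K',J')" ..
    then show "\<exists>x'. P (Suc n) x' \<and> R n x x'" by blast
  qed
  then obtain f where f: "\<And>n. P n (f n)" "\<And>n. R n (f n) (f (Suc n))" by blast
  define K where "K = (\<lambda>n. fst (f n))"
  define J where "J = (\<lambda>n. snd (f n))"
  have KJ: "K n \<subseteq> A (N + n)" "J n \<subseteq> B (N + n)" "y \<in> K n" "z \<in> J n" "K n \<times> J n \<subseteq> W" for n
    using f(1)[of n] by (auto simp: P_def K_def J_def split_def)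
  obtain G where G: "\<And>n. openin (subtopology Y (A (N + Suc n))) (G n)" "\<And>n. K n \<subseteq> G n" "\<And>n. G n \<subseteq> K (Suc n)"
    using f(2) unfolding R_def K_def split_def by metis
  obtain H where H: "\<And>n. openin (subtopology Z (B (N + Suc n))) (H n)" "\<And>n. J n \<subseteq> H n" "\<And>n. H n \<subseteq> J (Suc n)"
    using f(2) unfolding R_def J_def split_def by metis
  have prodW: "(\<Union>n. K n) \<times> (\<Union>n. J n) \<subseteq> W"
  proof clarify
    fix u v n m assume "u \<in> K n" "v \<in> J m"
    moreover have "incseq K" "incseq J" using G H by (intro incseq_SucI; blast)+
    ultimately have "u \<in> K (max n m)" "v \<in> J (max n m)"
      using incseqD[of K n "max n m"] incseqD[of J m "max n m"] by auto
    then show "(u,v) \<in> W" using KJ(5) by blast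
  qed
  show thesis
  proof (rule that[of "\<Union>n. K n" "\<Union>n. J n"])
    show "openin (subtopology Y (A n)) ((\<Union>n. K n) \<inter> A n)" for n
      by (rule openin_UN_chain[where C=A and D=G and E=K and N=N]) (use Y(3) G in auto)
    show "openin (subtopology Z (B n)) ((\<Union>n. J n) \<inter> B n)" for n
      by (rule openin_UN_chain[where C=B and D=H and E=J and N=N]) (use Z(3) H in auto)
    show "(\<Union>n. K n) \<subseteq> \<Union>(range A)" by (rule UN_least) (rule order_trans[OF KJ(1)], auto)
    show "(\<Union>n. J n) \<subseteq> \<Union>(range B)" by (rule UN_least) (rule order_trans[OF KJ(2)], auto)
  qed (use KJ(3,4) prodW in auto)
qed

section \<open>Countable networks and \<open>k\<^sub>\<omega>\<close>-sequences\<close>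

lemma tychonoff_space_imp_Hausdorff: "tychonoff_space X \<Longrightarrow> Hausdorff_space X"
  by (simp add: tychonoff_space_def completely_regular_imp_regular_space regular_t1_imp_Hausdorff_space)

lemma tychonoff_bump:
  assumes X: "tychonoff_space X" and U: "openin X U" "x \<in> U"
  obtains f where "continuous_map X euclideanreal f" "f x = 1" "\<And>y. y \<in> topspace X \<Longrightarrow> 0 \<le> f y"
    "\<And>y. y \<in> topspace X - U \<Longrightarrow> f y = 0"
proof -
  have xU: "x \<in> topspace X" using U openin_subset by blast
  have "closedin X (topspace X - U)" using U by blast
  then obtain f where f: "continuous_map X (top_of_set {0..1::real}) f" "f x = 0" "f ` (topspace X - U) \<subseteq> {1}"
    using X xU U unfolding tychonoff_space_def completely_regular_space_def by (metis Diff_iff)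
  have c: "continuous_map X euclideanreal f" using f(1) by (auto intro: continuous_map_into_fulltopology)
  have "f y \<le> 1" if "y \<in> topspace X" for y
    using f(1) that by (auto simp: continuous_map_def Pi_iff)
  moreover have "continuous_map X euclideanreal (\<lambda>x. 1 - f x)"
    using c by (intro continuous_intros) auto
  ultimately show thesis using that[of "\<lambda>x. 1 - f x"] f(2,3) by auto
qed

lemma compactin_finite_subcover:
  assumes C: "compactin Y C" and V: "\<And>i. i \<in> I \<Longrightarrow> openin Y (V i)" "C \<subseteq> \<Union>(V ` I)"
  obtains J where "finite J" "J \<subseteq> I" "C \<subseteq> \<Union>(V ` J)"
proof -
  have "\<forall>U\<in>V ` I. openin Y U" using V(1) by auto
  with C V(2) obtain \<F> where F: "finite \<F>" "\<F> \<subseteq> V ` I" "C \<subseteq> \<Union>\<F>"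
    unfolding compactin_def by (metis (no_types))
  then show thesis using finite_subset_image[OF F(1,2)] that by metis
qed

text \<open>A network at the points of \<open>S\<close>, tested against open sets of the whole
  space. Its members may stick out of \<open>S\<close>, so the notion passes to unions and images
  without forming subspaces.\<close>

definition has_countable_network :: "'a topology \<Rightarrow> 'a set \<Rightarrow> bool" where
  "has_countable_network Y S \<longleftrightarrow>
     (\<exists>\<N>. countable \<N> \<and> (\<forall>U y. openin Y U \<longrightarrow> y \<in> S \<inter> U \<longrightarrow> (\<exists>N\<in>\<N>. y \<in> N \<and> N \<subseteq> U)))"

lemma has_countable_network_topspace:
  "(\<exists>\<N>. countable \<N> \<and> network_of Y \<N>) \<longleftrightarrow> has_countable_network Y (topspace Y)"
proof
  assume "\<exists>\<N>. countable \<N> \<and> network_of Y \<N>"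
  then show "has_countable_network Y (topspace Y)"
    unfolding has_countable_network_def network_of_def by (metis IntD2)
next
  assume "has_countable_network Y (topspace Y)"
  then obtain \<N> where N: "countable \<N>"
    "\<And>U y. openin Y U \<Longrightarrow> y \<in> topspace Y \<inter> U \<Longrightarrow> \<exists>N\<in>\<N>. y \<in> N \<and> N \<subseteq> U"
    unfolding has_countable_network_def by auto
  have "network_of Y {N \<in> \<N>. N \<subseteq> topspace Y}"
    unfolding network_of_def
  proof (intro conjI allI impI, goal_cases)
    case (2 y U)
    then have U: "U \<subseteq> topspace Y" by (simp add: openin_subset)
    with N(2)[of U y] 2 obtain N where "N \<in> \<N>" "y \<in> N" "N \<subseteq> U" by auto
    then show ?case using U by (intro bexI[of _ N]) auto
  qed auto
  moreover have "countable {N \<in> \<N>. N \<subseteq> topspace Y}" using N(1) by (rule countable_subset[rotated]) auto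
  ultimately show "\<exists>\<N>. countable \<N> \<and> network_of Y \<N>" by blast
qed

lemma has_countable_network_UN:
  assumes "countable I" "\<And>i. i \<in> I \<Longrightarrow> has_countable_network Y (S i)"
  shows "has_countable_network Y (\<Union>i\<in>I. S i)"
proof -
  have "\<forall>i\<in>I. \<exists>\<N>. countable \<N> \<and> (\<forall>U y. openin Y U \<longrightarrow> y \<in> S i \<inter> U \<longrightarrow> (\<exists>N\<in>\<N>. y \<in> N \<and> N \<subseteq> U))"
    using assms(2) unfolding has_countable_network_def by blast
  then obtain N where N: "\<And>i. i \<in> I \<Longrightarrow> countable (N i)"
    "\<And>i U y. i \<in> I \<Longrightarrow> openin Y U \<Longrightarrow> y \<in> S i \<inter> U \<Longrightarrow> \<exists>M\<in>N i. y \<in> M \<and> M \<subseteq> U"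
    by (metis bchoice)
  show ?thesis unfolding has_countable_network_def
  proof (intro exI[of _ "\<Union>i\<in>I. N i"] conjI allI impI)
    show "countable (\<Union>i\<in>I. N i)" using assms(1) N(1) by (rule countable_UN)
    fix U y assume U: "openin Y U" "y \<in> (\<Union>i\<in>I. S i) \<inter> U"
    then obtain i where "i \<in> I" "y \<in> S i \<inter> U" by blast
    moreover then obtain M where "M \<in> N i" "y \<in> M" "M \<subseteq> U" using N(2)[OF _ U(1)] by metis
    ultimately show "\<exists>M\<in>\<Union>i\<in>I. N i. y \<in> M \<and> M \<subseteq> U" by auto
  qed
qed

lemma has_countable_network_image_prod:
  assumes f: "continuous_map (prod_topology Y Z) T f"
    and A: "has_countable_network Y A" "A \<subseteq> topspace Y"
    and B: "has_countable_network Z B" "B \<subseteq> topspace Z"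
  shows "has_countable_network T (f ` (A \<times> B))"
proof -
  obtain N where N: "countable N" "\<And>U y. openin Y U \<Longrightarrow> y \<in> A \<inter> U \<Longrightarrow> \<exists>M\<in>N. y \<in> M \<and> M \<subseteq> U"
    using A(1) unfolding has_countable_network_def by blast
  obtain P where P: "countable P" "\<And>U y. openin Z U \<Longrightarrow> y \<in> B \<inter> U \<Longrightarrow> \<exists>M\<in>P. y \<in> M \<and> M \<subseteq> U"
    using B(1) unfolding has_countable_network_def by blast
  show ?thesis unfolding has_countable_network_def
  proof (intro exI[of _ "(\<lambda>(M, Q). f ` (M \<times> Q)) ` (N \<times> P)"] conjI allI impI)
    show "countable ((\<lambda>(M, Q). f ` (M \<times> Q)) ` (N \<times> P))" using N(1) P(1) by blast
    fix U y assume U: "openin T U" "y \<in> f ` (A \<times> B) \<inter> U"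
    then obtain a b where ab: "a \<in> A" "b \<in> B" "y = f (a, b)" "f (a, b) \<in> U" by blast
    define V where "V = {p \<in> topspace (prod_topology Y Z). f p \<in> U}"
    have "openin (prod_topology Y Z) V"
      unfolding V_def using f U(1) by (rule openin_continuous_map_preimage)
    moreover have "(a, b) \<in> V" using ab A B by (auto simp: V_def)
    ultimately have "\<exists>G H. openin Y G \<and> openin Z H \<and> a \<in> G \<and> b \<in> H \<and> G \<times> H \<subseteq> V"
      by (simp add: openin_prod_topology_alt)
    then obtain G H where GH: "openin Y G" "openin Z H" "a \<in> G" "b \<in> H" "G \<times> H \<subseteq> V" by (elim exE conjE)
    obtain M where M: "M \<in> N" "a \<in> M" "M \<subseteq> G" using N(2)[OF GH(1)] ab GH(3) by blast
    obtain Q where Q: "Q \<in> P" "b \<in> Q" "Q \<subseteq> H" using P(2)[OF GH(2)] ab GH(4) by blast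
    have "M \<times> Q \<subseteq> V" using M(3) Q(3) GH(5) by (meson Sigma_mono order_trans)
    then have "f ` (M \<times> Q) \<subseteq> U" by (auto simp: V_def)
    moreover have "y \<in> f ` (M \<times> Q)" using ab M Q by blast
    ultimately show "\<exists>R\<in>(\<lambda>(M, Q). f ` (M \<times> Q)) ` (N \<times> P). y \<in> R \<and> R \<subseteq> U"
      using M(1) Q(1) by (intro bexI[of _ "f ` (M \<times> Q)"]) auto
  qed
qed

lemma has_countable_network_euclidean:
  "has_countable_network (euclidean :: 'a::second_countable_topology topology) S"
proof -
  obtain B :: "'a set set" where "countable B" "topological_basis B" using ex_countable_basis by blast
  then show ?thesis unfolding has_countable_network_def
    by (intro exI[of _ B]) (metis IntD2 open_openin topological_basisE)
qed

text \<open>The increasing form of a \<open>k_omega_space\<close> cover, reached by finite unions.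
  Only one implication is demanded, since traces of closed sets are always closed.\<close>

definition k_omega_sequence :: "'a topology \<Rightarrow> (nat \<Rightarrow> 'a set) \<Rightarrow> bool" where
  "k_omega_sequence Y K \<longleftrightarrow> incseq K \<and> (\<forall>n. compactin Y (K n)) \<and> \<Union>(range K) = topspace Y \<and>
     (\<forall>F. F \<subseteq> topspace Y \<longrightarrow> (\<forall>n. closedin (subtopology Y (K n)) (F \<inter> K n)) \<longrightarrow> closedin Y F)"

lemma closedin_subtopology_Int_mono:
  assumes "closedin (subtopology Y K) (F \<inter> K)" "K' \<subseteq> K"
  shows "closedin (subtopology Y K') (F \<inter> K')"
proof -
  obtain C where "closedin Y C" "F \<inter> K = C \<inter> K" using assms(1) by (auto simp: closedin_subtopology)
  moreover then have "F \<inter> K' = C \<inter> K'" using assms(2) by blast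
  ultimately show ?thesis by (auto simp: closedin_subtopology)
qed

lemma k_omega_space_iff_sequence: "k_omega_space Y \<longleftrightarrow> (\<exists>K. k_omega_sequence Y K)"
proof
  assume "k_omega_space Y"
  then obtain \<K> where K: "countable \<K>" "\<forall>K\<in>\<K>. compactin Y K" "\<Union>\<K> = topspace Y"
    "\<And>F. F \<subseteq> topspace Y \<Longrightarrow> closedin Y F \<longleftrightarrow> (\<forall>K\<in>\<K>. closedin (subtopology Y K) (F \<inter> K))"
    unfolding k_omega_space_def by blast
  \<comment> \<open>Inserting the empty set makes the family nonempty, so that it is the exact range
    of its enumeration even when \<K> is empty.\<close>
  define g where "g = from_nat_into (insert {} \<K>)"
  have g: "range g = insert {} \<K>" unfolding g_def by (rule range_from_nat_into) (use K(1) in auto)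
  define K' where "K' = (\<lambda>n. \<Union>i\<le>n. g i)"
  have "compactin Y (g i)" for i using g K(2) by (metis compactin_empty insert_iff rangeI)
  then have "compactin Y (K' n)" for n unfolding K'_def by (intro compactin_Union) auto
  moreover have "incseq K'" unfolding K'_def by (intro monoI UN_mono) auto
  moreover have "\<Union>(range K') = \<Union>(range g)" unfolding K'_def by auto
  then have "\<Union>(range K') = topspace Y" using g K(3) by simp
  moreover have "closedin Y F"
    if F: "F \<subseteq> topspace Y" "\<forall>n. closedin (subtopology Y (K' n)) (F \<inter> K' n)" for F
  proof -
    have "closedin (subtopology Y C) (F \<inter> C)" if "C \<in> \<K>" for C
    proof -
      obtain i where i: "C = g i" using g \<open>C \<in> \<K>\<close> by (metis insertCI rangeE)
      then have "C \<subseteq> K' i" by (auto simp: K'_def)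
      with F(2) show ?thesis by (blast intro: closedin_subtopology_Int_mono)
    qed
    then show ?thesis using K(4) F(1) by blast
  qed
  ultimately show "\<exists>K. k_omega_sequence Y K" unfolding k_omega_sequence_def by blast
next
  assume "\<exists>K. k_omega_sequence Y K"
  then obtain K where K: "k_omega_sequence Y K" by blast
  show "k_omega_space Y" unfolding k_omega_space_def
  proof (intro exI[of _ "range K"] conjI allI impI)
    fix F assume "F \<subseteq> topspace Y"
    then show "closedin Y F \<longleftrightarrow> (\<forall>C\<in>range K. closedin (subtopology Y C) (F \<inter> C))"
      using K unfolding k_omega_sequence_def by (auto simp: closedin_subtopology)
  qed (use K in \<open>auto simp: k_omega_sequence_def\<close>)
qed

lemma openin_subtopology_iff_complement:
  assumes "K \<subseteq> topspace Y" "U \<subseteq> topspace Y"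
  shows "openin (subtopology Y K) (U \<inter> K) \<longleftrightarrow> closedin (subtopology Y K) ((topspace Y - U) \<inter> K)"
proof -
  have t: "topspace (subtopology Y K) = K" using assms by auto
  have "K - (U \<inter> K) = (topspace Y - U) \<inter> K" using assms by blast
  moreover have "U \<inter> K \<subseteq> topspace (subtopology Y K)" using t by simp
  ultimately show ?thesis using openin_closedin[of "U \<inter> K" "subtopology Y K"] unfolding t by simp
qed

lemma k_omega_sequence_openin:
  assumes K: "k_omega_sequence Y K" and U: "U \<subseteq> topspace Y"
    "\<And>n. openin (subtopology Y (K n)) (U \<inter> K n)"
  shows "openin Y U"
proof -
  have "K n \<subseteq> topspace Y" for n
    using K compactin_subset_topspace unfolding k_omega_sequence_def by metis
  then have "closedin (subtopology Y (K n)) ((topspace Y - U) \<inter> K n)" for n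
    using U openin_subtopology_iff_complement by metis
  then have "closedin Y (topspace Y - U)" using K unfolding k_omega_sequence_def by blast
  then show ?thesis using U(1) by (simp add: openin_closedin)
qed

text \<open>Choose \<open>x n\<close> in \<open>C\<close> outside \<open>K n\<close>. Each
  \<open>K n\<close> contains only terms of index below n, so every tail of the sequence has finite
  traces and is closed. The complements of the tails cover \<open>C\<close>, but finitely many of
  them miss a late term. Working with tails avoids asking whether the terms are distinct.\<close>

lemma k_omega_sequence_compactin_subset:
  assumes K: "k_omega_sequence Y K" and Y: "t1_space Y" and C: "compactin Y C"
  obtains n where "C \<subseteq> K n"
proof (rule ccontr)
  assume "\<not> thesis"
  then have "\<forall>n. \<exists>x. x \<in> C \<and> x \<notin> K n" using that by blast
  then obtain x where x: "\<And>n. x n \<in> C" "\<And>n. x n \<notin> K n" by metis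
  have Cs: "C \<subseteq> topspace Y" using C by (rule compactin_subset_topspace)
  have mono: "K i \<subseteq> K j" if "i \<le> j" for i j
    using K that unfolding k_omega_sequence_def incseq_def by blast
  have cl: "closedin Y (x ` {m..})" for m
  proof -
    have "closedin (subtopology Y (K n)) (x ` {m..} \<inter> K n)" for n
    proof -
      have "x ` {m..} \<inter> K n \<subseteq> x ` {..<n}"
      proof (rule subsetI, elim IntE imageE)
        fix y j assume y: "y \<in> K n" "y = x j"
        then have "j < n" using x(2)[of j] mono[of n j] by (meson not_less subsetD)
        then show "y \<in> x ` {..<n}" using y by blast
      qed
      then have "finite (x ` {m..} \<inter> K n)" by (rule finite_subset) simp
      then have "closedin Y (x ` {m..} \<inter> K n)"
        using Y Cs x(1) by (auto simp: t1_space_closedin_finite)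
      then show ?thesis by (intro closedin_subset_topspace) auto
    qed
    moreover have "x ` {m..} \<subseteq> topspace Y" using Cs x(1) by blast
    ultimately show ?thesis using K unfolding k_omega_sequence_def by simp
  qed
  have "C \<subseteq> (\<Union>m. topspace Y - x ` {m..})"
  proof
    fix y assume "y \<in> C"
    then have y: "y \<in> topspace Y" using Cs by blast
    then obtain m where "y \<in> K m" using K unfolding k_omega_sequence_def by blast
    then have "y \<notin> x ` {m..}" using x(2) mono by auto
    then show "y \<in> (\<Union>m. topspace Y - x ` {m..})" using y by blast
  qed
  then obtain M where M: "finite M" "C \<subseteq> (\<Union>m\<in>M. topspace Y - x ` {m..})"
    by (rule compactin_finite_subcover[OF C, rotated]) (use cl in auto)
  define b where "b = Max (insert 0 M)"
  have "m \<le> b" if "m \<in> M" for m using M(1) that by (simp add: b_def)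
  then have "x b \<notin> (\<Union>m\<in>M. topspace Y - x ` {m..})" by auto
  then show False using M(2) x(1) by blast
qed

lemma k_omega_space_imp_k_space: "k_omega_space Y \<Longrightarrow> k_space Y"
  unfolding k_omega_space_iff_sequence k_omega_sequence_def k_space by (metis inf_commute)

text \<open>For x in C and y in \<open>K n - U\<close>, some members of the network around x and y
  have disjoint open neighborhoods. By compactness of \<open>K n - U\<close> finitely many such
  pairs suffice, and removing their \<open>q\<close> sides from \<open>K n\<close> leaves a closed
  set inside U that contains a relative neighborhood of x in \<open>K n\<close>. There are countably
  many such sets, and finitely many of them cover C.\<close>

lemma cosmic_k_omega_imp_countable_closed_k_network:
  assumes c: "cosmic_space Y" and K: "k_omega_sequence Y K"
  obtains \<M> where "countable \<M>" "k_network_of Y \<M>" "\<And>M. M \<in> \<M> \<Longrightarrow> closedin Y M"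
proof -
  have H: "Hausdorff_space Y" and t1: "t1_space Y"
    using c by (auto simp: cosmic_space_def regular_t1_imp_Hausdorff_space)
  obtain \<N> where N: "countable \<N>" "network_of Y \<N>" using c by (auto simp: cosmic_space_def)
  have Kc: "compactin Y (K n)" for n using K by (auto simp: k_omega_sequence_def)
  define Sep where "Sep = (\<lambda>A B p. openin Y (fst p) \<and> openin Y (snd p) \<and> A \<subseteq> fst p \<and> B \<subseteq> snd p \<and> disjnt (fst p) (snd p))"
  \<comment> \<open>One separation is fixed for each pair of network members, so the countably many
    pairs contribute only countably many open sets.\<close>
  define s where "s = (\<lambda>A B. SOME p. Sep A B p)"
  have s: "Sep A B (s A B)" if "\<exists>p. Sep A B p" for A B unfolding s_def using that by (rule someI_ex)
  define E where "E = {(A, B) \<in> \<N> \<times> \<N>. \<exists>p. Sep A B p}"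
  define q where "q = (\<lambda>(A, B). snd (s A B))"
  define p where "p = (\<lambda>(A, B). fst (s A B))"
  have pq: "openin Y (p e)" "openin Y (q e)" "fst e \<subseteq> p e" "snd e \<subseteq> q e" "disjnt (p e) (q e)" if "e \<in> E" for e
  proof -
    obtain A B where e: "e = (A, B)" by (cases e)
    with that have "Sep A B (s A B)" by (intro s) (auto simp: E_def)
    then show "openin Y (p e)" "openin Y (q e)" "fst e \<subseteq> p e" "snd e \<subseteq> q e" "disjnt (p e) (q e)"
      unfolding e p_def q_def Sep_def by auto
  qed
  have "countable E" by (rule countable_subset[of _ "\<N> \<times> \<N>"]) (use N(1) in \<open>auto simp: E_def\<close>)
  define \<M> where "\<M> = (\<lambda>(n, F). K n - \<Union>(q ` F)) ` (UNIV \<times> {F. finite F \<and> F \<subseteq> E})"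
  have "countable \<M>" unfolding \<M>_def
    using \<open>countable E\<close> by (intro countable_image countable_SIGMA countable_Collect_finite_subset) auto
  moreover have clo: "closedin Y M" if "M \<in> \<M>" for M
  proof -
    obtain n F where M: "M = K n - \<Union>(q ` F)" "F \<subseteq> E" using \<open>M \<in> \<M>\<close> by (auto simp: \<M>_def)
    have "openin Y (\<Union>(q ` F))" using M(2) pq(2) by blast
    then show ?thesis unfolding M(1) using compactin_imp_closedin[OF H Kc] by (intro closedin_diff)
  qed
  moreover have "k_network_of Y \<M>" unfolding k_network_of_def
  proof (intro conjI allI impI)
    show "\<M> \<subseteq> Pow (topspace Y)" using clo closedin_subset by blast
    fix U C assume "openin Y U \<and> compactin Y C \<and> C \<subseteq> U"
    then have U: "openin Y U" and C: "compactin Y C" "C \<subseteq> U" by auto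
    obtain n where n: "C \<subseteq> K n" using k_omega_sequence_compactin_subset[OF K t1 C(1)] by blast
    have "\<exists>G P. openin Y G \<and> x \<in> G \<and> P \<in> \<M> \<and> G \<inter> K n \<subseteq> P \<and> P \<subseteq> U" if x: "x \<in> C" for x
    proof -
      have xY: "x \<in> topspace Y" using x C compactin_subset_topspace by blast
      have D: "compactin Y (K n - U)"
        by (rule closed_compactin[OF Kc[of n]])
           (use compactin_imp_closedin[OF H Kc[of n]] U in \<open>auto intro: closedin_diff\<close>)
      have "K n - U \<subseteq> \<Union>(q ` {e \<in> E. x \<in> fst e})"
      proof
        fix y assume y: "y \<in> K n - U"
        then have "y \<in> topspace Y" "x \<noteq> y" using D compactin_subset_topspace x C(2) by blast+
        then obtain O1 O2 where O: "openin Y O1" "openin Y O2" "x \<in> O1" "y \<in> O2" "disjnt O1 O2"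
          using H xY unfolding Hausdorff_space_def by metis
        obtain A where A: "A \<in> \<N>" "x \<in> A" "A \<subseteq> O1" using N(2) O(1,3) unfolding network_of_def by metis
        obtain B where B: "B \<in> \<N>" "y \<in> B" "B \<subseteq> O2" using N(2) O(2,4) unfolding network_of_def by metis
        have "Sep A B (O1, O2)" unfolding Sep_def using O A B by simp
        then have e: "(A, B) \<in> E" using A B unfolding E_def by auto
        then have "y \<in> q (A, B)" using pq(4)[OF e] B by auto
        then show "y \<in> \<Union>(q ` {e \<in> E. x \<in> fst e})" using e A by auto
      qed
      then obtain F where F: "finite F" "F \<subseteq> {e \<in> E. x \<in> fst e}" "K n - U \<subseteq> \<Union>(q ` F)"
        by (rule compactin_finite_subcover[OF D, rotated]) (use pq(2) in auto)
      define G where "G = topspace Y \<inter> \<Inter>(p ` F)"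
      define P where "P = K n - \<Union>(q ` F)"
      have "openin Y G"
      proof (cases "F = {}")
        case False
        then have "openin Y (\<Inter>(p ` F))" using F pq(1) by (intro openin_Inter) auto
        then show ?thesis unfolding G_def by blast
      qed (simp add: G_def)
      moreover have "x \<in> G" unfolding G_def using xY F(2) pq(3) by auto
      moreover have "P \<in> \<M>" unfolding P_def \<M>_def using F by auto
      moreover have "G \<inter> K n \<subseteq> P"
      proof
        fix z assume z: "z \<in> G \<inter> K n"
        have "z \<notin> q e" if "e \<in> F" for e
        proof -
          have "z \<in> p e" using z that by (auto simp: G_def)
          then show ?thesis using pq(5)[of e] F(2) that by (auto simp: disjnt_iff)
        qed
        then show "z \<in> P" using z by (auto simp: P_def)
      qed
      moreover have "P \<subseteq> U" unfolding P_def using F(3) by blast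
      ultimately show ?thesis by blast
    qed
    then obtain G P where GP: "\<And>x. x \<in> C \<Longrightarrow> openin Y (G x)" "\<And>x. x \<in> C \<Longrightarrow> x \<in> G x"
      "\<And>x. x \<in> C \<Longrightarrow> P x \<in> \<M>" "\<And>x. x \<in> C \<Longrightarrow> G x \<inter> K n \<subseteq> P x" "\<And>x. x \<in> C \<Longrightarrow> P x \<subseteq> U"
      by metis
    have "C \<subseteq> \<Union>(G ` C)" using GP(2) by blast
    then obtain D where D: "finite D" "D \<subseteq> C" "C \<subseteq> \<Union>(G ` D)"
      by (rule compactin_finite_subcover[OF C(1), rotated]) (use GP(1) in auto)
    have "C \<subseteq> \<Union>(P ` D)"
    proof
      fix z assume z: "z \<in> C"
      then obtain d where "d \<in> D" "z \<in> G d" using D(3) by blast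
      then show "z \<in> \<Union>(P ` D)" using GP(4)[of d] D(2) z n by blast
    qed
    moreover have "finite (P ` D)" "P ` D \<subseteq> \<M>" "\<Union>(P ` D) \<subseteq> U" using D GP(3,5) by blast+
    ultimately show "\<exists>\<F>. finite \<F> \<and> \<F> \<subseteq> \<M> \<and> C \<subseteq> \<Union>\<F> \<and> \<Union>\<F> \<subseteq> U" by blast
  qed
  ultimately show thesis using that by blast
qed

lemma cosmic_k_omega_imp_bar_aleph_k:
  assumes "cosmic_space Y" "k_omega_space Y" shows "bar_aleph_k_space Y"
proof -
  obtain K where "k_omega_sequence Y K" using assms(2) k_omega_space_iff_sequence by blast
  then obtain \<M> where M: "countable \<M>" "k_network_of Y \<M>" "\<And>M. M \<in> \<M> \<Longrightarrow> closedin Y M"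
    using cosmic_k_omega_imp_countable_closed_k_network[OF assms(1)] by blast
  have "countable {N \<in> \<M>. N \<inter> C \<noteq> {}}" for C by (rule countable_subset[OF _ M(1)]) auto
  then show ?thesis using M assms(1) unfolding bar_aleph_k_space_def cosmic_space_def compact_countable_in_def by blast
qed

lemma bar_aleph_k_imp_aleph_k: "bar_aleph_k_space Y \<Longrightarrow> aleph_k_space Y"
  unfolding bar_aleph_k_space_def aleph_k_space_def by blast

section \<open>Fans in \<open>k\<close>-spaces and Ascoli spaces\<close>

lemma regular_space_closed_neighbourhood:
  assumes "regular_space Y" "openin Y W" "x \<in> W"
  obtains G C where "openin Y G" "closedin Y C" "x \<in> G" "G \<subseteq> C" "C \<subseteq> W"
proof -
  have "\<forall>W x. openin Y W \<and> x \<in> W \<longrightarrow> (\<exists>G C. openin Y G \<and> closedin Y C \<and> x \<in> G \<and> G \<subseteq> C \<and> C \<subseteq> W)"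
    using assms(1) unfolding neighbourhood_base_of_closedin[symmetric] neighbourhood_base_of by simp
  then have "\<exists>G C. openin Y G \<and> closedin Y C \<and> x \<in> G \<and> G \<subseteq> C \<and> C \<subseteq> W" using assms(2,3) by simp
  then show thesis using that by (elim exE conjE)
qed

text \<open>Let \<open>C\<close> be the union of those \<open>F \<alpha>\<close> that miss y. Its
  traces on compact sets are finite, so \<open>C\<close> is closed. Its complement is a neighborhood
  of y that meets only those \<open>F \<alpha>\<close> containing y, and there are finitely many
  since {y} is compact.\<close>

lemma k_space_no_fin_fan:
  assumes k: "k_space Y" and H: "Hausdorff_space Y" shows "\<not> fin_omega1_fan Y F"
proof
  assume fan: "fin_omega1_fan Y F"
  have fin: "finite (F \<alpha>)" "F \<alpha> \<subseteq> topspace Y" if "\<alpha> \<in> omega1" for \<alpha>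
    using fan that by (auto simp: fin_omega1_fan_def)
  have cf: "finite {\<alpha>\<in>omega1. F \<alpha> \<inter> K \<noteq> {}}" if "compactin Y K" for K
    using fan that by (auto simp: fin_omega1_fan_def omega1_compact_finite_def)
  have "\<exists>V. openin Y V \<and> y \<in> V \<and> finite {\<alpha>\<in>omega1. F \<alpha> \<inter> V \<noteq> {}}" if y: "y \<in> topspace Y" for y
  proof -
    define A where "A = {\<alpha>\<in>omega1. y \<notin> F \<alpha>}"
    define C where "C = (\<Union>\<alpha>\<in>A. F \<alpha>)"
    have Cs: "C \<subseteq> topspace Y" using fin(2) by (auto simp: C_def A_def)
    have "closedin (subtopology Y K) (K \<inter> C)" if K: "compactin Y K" for K
    proof -
      have "K \<inter> C \<subseteq> (\<Union>\<alpha>\<in>{\<alpha>\<in>omega1. F \<alpha> \<inter> K \<noteq> {}}. F \<alpha>)" by (auto simp: C_def A_def)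
      then have "finite (K \<inter> C)" by (rule finite_subset) (use cf[OF K] fin(1) in auto)
      then have "closedin Y (K \<inter> C)"
        using H Cs by (meson Hausdorff_imp_t1_space inf.coboundedI2 t1_space_closedin_finite)
      then show ?thesis by (intro closedin_subset_topspace) auto
    qed
    then have "closedin Y C" using k Cs unfolding k_space by blast
    then have "openin Y (topspace Y - C)" by blast
    moreover have "y \<in> topspace Y - C" using y by (auto simp: C_def A_def)
    moreover have "{\<alpha>\<in>omega1. F \<alpha> \<inter> (topspace Y - C) \<noteq> {}} \<subseteq> {\<alpha>\<in>omega1. F \<alpha> \<inter> {y} \<noteq> {}}"
      by (auto simp: C_def A_def)
    then have "finite {\<alpha>\<in>omega1. F \<alpha> \<inter> (topspace Y - C) \<noteq> {}}"
      by (rule finite_subset) (use cf[of "{y}"] y in auto)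
    ultimately show ?thesis by (intro exI[of _ "topspace Y - C"]) simp
  qed
  then show False using fan unfolding fin_omega1_fan_def omega1_locally_finite_def by blast
qed

lemma topspace_C_k: "topspace (C_k Y) = continuous_functions Y"
proof -
  have "continuous_functions Y = {f \<in> continuous_functions Y. f ` {} \<subseteq> UNIV}" by auto
  moreover have "compactin Y {}" "open (UNIV :: real set)" by auto
  ultimately have "continuous_functions Y \<in> {{f \<in> continuous_functions Y. f ` K \<subseteq> U} | K U. compactin Y K \<and> open U}"
    by (intro CollectI exI[of _ "{}"] exI[of _ UNIV] conjI) auto
  then show ?thesis unfolding C_k_def topology_generated_by_topspace by blast
qed

lemma openin_C_k_basis:
  "compactin Y K \<Longrightarrow> open U \<Longrightarrow> openin (C_k Y) {f \<in> continuous_functions Y. f ` K \<subseteq> U}"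
  unfolding C_k_def by (rule topology_generated_by_Basis) (simp, metis)

text \<open>Convergence along the cofinite subsets of \<open>I\<close>. On a compact set all but
  finitely many \<open>h \<alpha>\<close> coincide with \<open>z\<close>, so they lie in every
  subbasic neighborhood of \<open>z\<close>; the induction follows the generation of the
  topology.\<close>

lemma C_k_convergence:
  assumes z: "z \<in> continuous_functions Y" and h: "\<And>\<alpha>. \<alpha> \<in> I \<Longrightarrow> h \<alpha> \<in> continuous_functions Y"
    and cf: "\<And>K. compactin Y K \<Longrightarrow> finite {\<alpha>\<in>I. \<exists>y\<in>K. h \<alpha> y \<noteq> z y}"
    and W: "openin (C_k Y) W" "z \<in> W"
  shows "finite {\<alpha>\<in>I. h \<alpha> \<notin> W}"
proof -
  have "generate_topology_on {{f \<in> continuous_functions Y. f ` K \<subseteq> U} | K U. compactin Y K \<and> open U} W"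
    using W(1) unfolding C_k_def openin_topology_generated_by_iff .
  then have "z \<in> W \<longrightarrow> finite {\<alpha>\<in>I. h \<alpha> \<notin> W}"
  proof induction
    case (Int a b)
    have "{\<alpha>\<in>I. h \<alpha> \<notin> a \<inter> b} = {\<alpha>\<in>I. h \<alpha> \<notin> a} \<union> {\<alpha>\<in>I. h \<alpha> \<notin> b}" by auto
    then show ?case using Int by auto
  next
    case (UN K)
    show ?case
    proof
      assume "z \<in> \<Union>K"
      then obtain k where k: "k \<in> K" "z \<in> k" by blast
      have "{\<alpha>\<in>I. h \<alpha> \<notin> \<Union>K} \<subseteq> {\<alpha>\<in>I. h \<alpha> \<notin> k}" using k by auto
      then show "finite {\<alpha>\<in>I. h \<alpha> \<notin> \<Union>K}" using UN.IH[OF k(1)] k(2) finite_subset by blast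
    qed
  next
    case (Basis s)
    then obtain K U where s: "s = {f \<in> continuous_functions Y. f ` K \<subseteq> U}" "compactin Y K" by blast
    show ?case
    proof
      assume zs: "z \<in> s"
      have "{\<alpha>\<in>I. h \<alpha> \<notin> s} \<subseteq> {\<alpha>\<in>I. \<exists>y\<in>K. h \<alpha> y \<noteq> z y}"
      proof clarify
        fix \<alpha> assume a: "\<alpha> \<in> I" "h \<alpha> \<notin> s"
        then obtain y where y: "y \<in> K" "h \<alpha> y \<notin> U" using h[OF a(1)] unfolding s by auto
        then have "z y \<in> U" using zs unfolding s by auto
        with y show "\<exists>y\<in>K. h \<alpha> y \<noteq> z y" by metis
      qed
      then show "finite {\<alpha>\<in>I. h \<alpha> \<notin> s}" using cf[OF s(2)] finite_subset by blast
    qed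
  qed auto
  then show ?thesis using W(2) by simp
qed

text \<open>The bump functions together with their limit \<open>z\<close> form a compact set, so
  evaluation is continuous at (\<open>z\<close>, y). A neighborhood V of y and a neighborhood of
  \<open>z\<close> therefore keep the values below 1, whereas \<open>h \<alpha>\<close> is at least
  1 on \<open>F \<alpha>\<close>. So V meets \<open>F \<alpha>\<close> only for the finitely many
  \<alpha> with \<open>h \<alpha>\<close> outside the neighborhood of \<open>z\<close>.\<close>

lemma ascoli_no_strong_fin_fan:
  assumes A: "ascoli_space Y" shows "\<not> strong_fin_omega1_fan Y F"
proof
  assume fan: "strong_fin_omega1_fan Y F"
  obtain U where U: "\<And>\<alpha>. \<alpha> \<in> omega1 \<Longrightarrow> R_open_in Y (U \<alpha>)" "\<And>\<alpha>. \<alpha> \<in> omega1 \<Longrightarrow> F \<alpha> \<subseteq> U \<alpha>"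
    and cf: "omega1_compact_finite Y U"
    using fan unfolding strong_fin_omega1_fan_def by metis
  have fin: "finite (F \<alpha>)" "F \<alpha> \<subseteq> topspace Y" if "\<alpha> \<in> omega1" for \<alpha>
    using fan that by (auto simp: fin_omega1_fan_def strong_fin_omega1_fan_def)
  have "\<exists>f\<in>continuous_functions Y. (\<forall>x\<in>F \<alpha>. 1 \<le> f x) \<and> (\<forall>x\<in>topspace Y - U \<alpha>. f x = 0)"
    if a: "\<alpha> \<in> omega1" for \<alpha>
  proof -
    have "\<forall>y\<in>F \<alpha>. \<exists>f :: 'a \<Rightarrow> real. continuous_map Y (top_of_set {0..1}) f \<and> f y = 1 \<and> f ` (topspace Y - U \<alpha>) \<subseteq> {0}"
      using U[OF a] unfolding R_open_in_def by blast
    then obtain f :: "'a \<Rightarrow> 'a \<Rightarrow> real" where f: "\<And>y. y \<in> F \<alpha> \<Longrightarrow> continuous_map Y (top_of_set {0..1}) (f y)"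
      "\<And>y. y \<in> F \<alpha> \<Longrightarrow> f y y = 1" "\<And>y. y \<in> F \<alpha> \<Longrightarrow> f y ` (topspace Y - U \<alpha>) \<subseteq> {0}"
      by metis
    \<comment> \<open>A sum of nonnegative bumps, one per point of the finite set
      \<open>F \<alpha>\<close>, is at least 1 on all of it and still vanishes off
      \<open>U \<alpha>\<close>; a value above 1 does no harm.\<close>
    define g where "g = restrict (\<lambda>x. \<Sum>y\<in>F \<alpha>. f y x) (topspace Y)"
    have cy: "continuous_map Y euclideanreal (f y)" if "y \<in> F \<alpha>" for y
      using f(1)[OF that] by (auto intro: continuous_map_into_fulltopology)
    have pos: "0 \<le> f y x" if "y \<in> F \<alpha>" "x \<in> topspace Y" for x y
      using f(1)[OF that(1)] that(2) by (auto simp: continuous_map_def Pi_iff)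
    have "continuous_map Y euclideanreal (\<lambda>x. \<Sum>y\<in>F \<alpha>. f y x)"
      using fin(1)[OF a] cy by (rule continuous_map_sum)
    then have "continuous_map Y euclideanreal g"
      by (rule continuous_map_eq) (simp add: g_def)
    then have "g \<in> continuous_functions Y" by (simp add: continuous_functions_def g_def)
    moreover have "1 \<le> g x" if x: "x \<in> F \<alpha>" for x
    proof -
      have xY: "x \<in> topspace Y" using fin(2)[OF a] x by blast
      have "f x x \<le> (\<Sum>y\<in>F \<alpha>. f y x)" using fin(1)[OF a] x pos xY by (intro member_le_sum) auto
      then show ?thesis using f(2)[OF x] xY by (simp add: g_def)
    qed
    moreover have "g x = 0" if "x \<in> topspace Y - U \<alpha>" for x
      using that f(3) by (auto simp: g_def intro!: sum.neutral)
    ultimately show ?thesis by blast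
  qed
  then obtain h where h: "\<And>\<alpha>. \<alpha> \<in> omega1 \<Longrightarrow> h \<alpha> \<in> continuous_functions Y"
    "\<And>\<alpha> x. \<alpha> \<in> omega1 \<Longrightarrow> x \<in> F \<alpha> \<Longrightarrow> 1 \<le> h \<alpha> x"
    "\<And>\<alpha> x. \<alpha> \<in> omega1 \<Longrightarrow> x \<in> topspace Y - U \<alpha> \<Longrightarrow> h \<alpha> x = 0" by metis
  define z where "z = restrict (\<lambda>_. 0::real) (topspace Y)"
  have "continuous_map Y euclideanreal z"
    by (rule continuous_map_eq[of _ _ "\<lambda>_. 0"]) (simp_all add: z_def)
  then have z: "z \<in> continuous_functions Y" by (simp add: continuous_functions_def z_def)
  have conv: "finite {\<alpha>\<in>omega1. h \<alpha> \<notin> W}" if W: "openin (C_k Y) W" "z \<in> W" for W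
  proof (rule C_k_convergence[OF z h(1) _ W])
    fix K assume K: "compactin Y K"
    have "{\<alpha>\<in>omega1. \<exists>y\<in>K. h \<alpha> y \<noteq> z y} \<subseteq> {\<alpha>\<in>omega1. U \<alpha> \<inter> K \<noteq> {}}"
    proof clarify
      fix \<alpha> y assume a: "\<alpha> \<in> omega1" "y \<in> K" "h \<alpha> y \<noteq> z y" "U \<alpha> \<inter> K = {}"
      then have "y \<in> topspace Y - U \<alpha>" using compactin_subset_topspace[OF K] by blast
      then show False using h(3)[OF a(1)] a(3) by (simp add: z_def)
    qed
    then show "finite {\<alpha>\<in>omega1. \<exists>y\<in>K. h \<alpha> y \<noteq> z y}"
      using cf K unfolding omega1_compact_finite_def by (metis (no_types, lifting) finite_subset)
  qed
  define \<K> where "\<K> = insert z (h ` omega1)"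
  have Ks: "\<K> \<subseteq> topspace (C_k Y)" using z h(1) by (auto simp: \<K>_def topspace_C_k)
  have "compactin (C_k Y) \<K>"
    unfolding compactin_def
  proof (intro conjI allI impI Ks)
    fix \<U> assume U: "(\<forall>U\<in>\<U>. openin (C_k Y) U) \<and> \<K> \<subseteq> \<Union>\<U>"
    then obtain W where W: "W \<in> \<U>" "z \<in> W" by (auto simp: \<K>_def)
    have fW: "finite {\<alpha>\<in>omega1. h \<alpha> \<notin> W}" using conv U W by blast
    have "\<forall>\<alpha>\<in>{\<alpha>\<in>omega1. h \<alpha> \<notin> W}. \<exists>V\<in>\<U>. h \<alpha> \<in> V" using U by (auto simp: \<K>_def)
    then obtain V where V: "\<And>\<alpha>. \<alpha> \<in> {\<alpha>\<in>omega1. h \<alpha> \<notin> W} \<Longrightarrow> V \<alpha> \<in> \<U> \<and> h \<alpha> \<in> V \<alpha>" by metis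
    show "\<exists>\<F>. finite \<F> \<and> \<F> \<subseteq> \<U> \<and> \<K> \<subseteq> \<Union>\<F>"
      by (rule exI[of _ "insert W (V ` {\<alpha>\<in>omega1. h \<alpha> \<notin> W})"]) (use fW V W in \<open>auto simp: \<K>_def\<close>)
  qed
  then have ev: "continuous_map (prod_topology (subtopology (C_k Y) \<K>) Y) euclideanreal (\<lambda>(f, y). f y)"
    using A by (auto simp: ascoli_space_def)
  have "omega1_locally_finite Y F" unfolding omega1_locally_finite_def
  proof
    fix y assume y: "y \<in> topspace Y"
    define P where "P = {p \<in> topspace (prod_topology (subtopology (C_k Y) \<K>) Y). (\<lambda>(f, y). f y) p \<in> {..<1}}"
    have "openin (prod_topology (subtopology (C_k Y) \<K>) Y) P"
      unfolding P_def using ev by (rule openin_continuous_map_preimage) simp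
    moreover have "(z, y) \<in> P" using y Ks by (auto simp: P_def \<K>_def z_def)
    ultimately have "\<exists>W V. openin (subtopology (C_k Y) \<K>) W \<and> openin Y V \<and> z \<in> W \<and> y \<in> V \<and> W \<times> V \<subseteq> P"
      by (simp add: openin_prod_topology_alt)
    then obtain W V where W: "openin (subtopology (C_k Y) \<K>) W" "z \<in> W" and V: "openin Y V" "y \<in> V"
      and WV: "W \<times> V \<subseteq> P" by (elim exE conjE)
    obtain W' where W': "openin (C_k Y) W'" "W = W' \<inter> \<K>" using W(1) by (auto simp: openin_subtopology)
    have "{\<alpha>\<in>omega1. F \<alpha> \<inter> V \<noteq> {}} \<subseteq> {\<alpha>\<in>omega1. h \<alpha> \<notin> W'}"
    proof clarify
      fix \<alpha> assume a: "\<alpha> \<in> omega1" "F \<alpha> \<inter> V \<noteq> {}" "h \<alpha> \<in> W'"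
      then obtain x where x: "x \<in> F \<alpha>" "x \<in> V" by blast
      then have "(h \<alpha>, x) \<in> P" using WV W'(2) a by (auto simp: \<K>_def)
      then show False using h(2)[OF a(1) x(1)] by (simp add: P_def)
    qed
    then have "finite {\<alpha>\<in>omega1. F \<alpha> \<inter> V \<noteq> {}}"
      using conv[OF W'(1)] W(2) W'(2) finite_subset by blast
    then show "\<exists>V. openin Y V \<and> y \<in> V \<and> finite {\<alpha>\<in>omega1. F \<alpha> \<inter> V \<noteq> {}}"
      using V by (intro exI[of _ V]) simp
  qed
  then show False using fan by (simp add: strong_fin_omega1_fan_def fin_omega1_fan_def)
qed

section \<open>Joint continuity of evaluation: \<open>k\<close>-spaces are Ascoli\<close>

lemma Hausdorff_C_k: "Hausdorff_space (C_k Y)"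
  unfolding Hausdorff_space_def topspace_C_k
proof (intro allI impI, elim conjE)
  fix f g assume fg: "f \<in> continuous_functions Y" "g \<in> continuous_functions Y" "f \<noteq> g"
  then have "\<exists>y\<in>topspace Y. f y \<noteq> g y"
    unfolding continuous_functions_def using extensionalityI by blast
  then obtain y where y: "y \<in> topspace Y" "f y \<noteq> g y" by blast
  obtain A B where AB: "open A" "open B" "f y \<in> A" "g y \<in> B" "A \<inter> B = {}"
    using hausdorff[OF y(2)] by blast
  let ?S = "\<lambda>A. {f \<in> continuous_functions Y. f ` {y} \<subseteq> A}"
  have "openin (C_k Y) (?S A)" "openin (C_k Y) (?S B)" using y(1) AB by (intro openin_C_k_basis; simp)+
  moreover have "f \<in> ?S A" "g \<in> ?S B" "disjnt (?S A) (?S B)" using fg AB by (auto simp: disjnt_def)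
  ultimately show "\<exists>U V. openin (C_k Y) U \<and> openin (C_k Y) V \<and> f \<in> U \<and> g \<in> V \<and> disjnt U V" by blast
qed

text \<open>Regularity of the compact set gives y a compact neighborhood \<open>Q\<close> in
  \<open>C\<close> with f(\<open>Q\<close>) inside the open set \<open>T\<close>. The functions
  mapping \<open>Q\<close> into \<open>T\<close> form a subbasic neighborhood of f.\<close>

lemma continuous_map_eval_C_k_compact:
  assumes H: "Hausdorff_space Y" and C: "compactin Y C"
  shows "continuous_map (prod_topology (C_k Y) (subtopology Y C)) euclideanreal (\<lambda>(f, y). f y)"
  unfolding continuous_map_def
proof (intro conjI allI impI)
  let ?S = "subtopology Y C"
  fix T :: "real set" assume T: "openin euclideanreal T"
  let ?P = "{p \<in> topspace (prod_topology (C_k Y) ?S). (case p of (f, y) \<Rightarrow> f y) \<in> T}"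
  have tS: "topspace ?S = C" using compactin_subset_topspace[OF C] by auto
  have reg: "regular_space ?S"
    using C H by (simp add: Hausdorff_space_subtopology compactin_subspace compact_Hausdorff_imp_regular_space)
  show "openin (prod_topology (C_k Y) ?S) ?P"
    unfolding openin_prod_topology_alt
  proof (intro allI impI)
    fix f y assume "(f, y) \<in> ?P"
    then have f: "f \<in> continuous_functions Y" and y: "y \<in> C" "f y \<in> T"
      using tS by (auto simp: topspace_C_k)
    have "continuous_map ?S euclideanreal f"
      using f by (auto simp: continuous_functions_def intro: continuous_map_from_subtopology)
    then have "openin ?S {c \<in> topspace ?S. f c \<in> T}" using T by (rule openin_continuous_map_preimage)
    moreover have "y \<in> {c \<in> topspace ?S. f c \<in> T}" using y tS by simp
    ultimately obtain G Q where G: "openin ?S G" "closedin ?S Q" "y \<in> G" "G \<subseteq> Q" "Q \<subseteq> {c \<in> topspace ?S. f c \<in> T}"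
      by (rule regular_space_closed_neighbourhood[OF reg])
    have "compactin ?S Q" using G(2) C by (intro closedin_compact_space) (simp_all add: compactin_subspace)
    then have Q: "compactin Y Q" by (simp add: compactin_subtopology)
    have "openin (C_k Y) {f \<in> continuous_functions Y. f ` Q \<subseteq> T}"
      by (rule openin_C_k_basis[OF Q]) (use T in simp)
    moreover have "f \<in> {f \<in> continuous_functions Y. f ` Q \<subseteq> T}" using f G(5) by auto
    moreover have "{f \<in> continuous_functions Y. f ` Q \<subseteq> T} \<times> G \<subseteq> ?P"
      using G(4,5) by (auto simp: topspace_C_k)
    ultimately show "\<exists>U V. openin (C_k Y) U \<and> openin ?S V \<and> f \<in> U \<and> y \<in> V \<and> U \<times> V \<subseteq> ?P"
      using G(1,3) by (intro exI[of _ "{f \<in> continuous_functions Y. f ` Q \<subseteq> T}"] exI[of _ G]) simp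
  qed
qed auto

text \<open>The product of a compact Hausdorff space with a \<open>k\<close>-space is a
  \<open>k\<close>-space, so continuity is tested on compact subsets \<open>Q\<close> of the
  product. The projection of \<open>Q\<close> to \<open>Y\<close> is compact, where evaluation is
  already known to be continuous.\<close>

lemma k_space_imp_ascoli:
  assumes k: "k_space Y" and T: "tychonoff_space Y" shows "ascoli_space Y"
  unfolding ascoli_space_def
proof (intro conjI allI impI T)
  fix \<K> assume K: "compactin (C_k Y) \<K>"
  have H: "Hausdorff_space Y" using T by (rule tychonoff_space_imp_Hausdorff)
  let ?Z = "subtopology (C_k Y) \<K>"
  have "compact_space ?Z" using K by (simp add: compactin_subspace)
  moreover have "Hausdorff_space ?Z" using Hausdorff_C_k by (rule Hausdorff_space_subtopology)
  ultimately have "k_space (prod_topology ?Z Y)"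
    using k by (intro k_space_prod_topology_left compact_imp_locally_compact_space) auto
  then show "continuous_map (prod_topology ?Z Y) euclideanreal (\<lambda>(f, y). f y)"
  proof (rule continuous_map_from_k_space)
    fix Q assume Q: "compactin (prod_topology ?Z Y) Q"
    have "compactin Y (snd ` Q)" using Q by (rule image_compactin) (rule continuous_map_snd)
    then have "continuous_map (prod_topology (C_k Y) (subtopology Y (snd ` Q))) euclideanreal (\<lambda>(f, y). f y)"
      by (rule continuous_map_eval_C_k_compact[OF H])
    then have "continuous_map (subtopology (prod_topology (C_k Y) Y) (UNIV \<times> snd ` Q)) euclideanreal (\<lambda>(f, y). f y)"
      by (simp add: subtopology_Times)
    moreover have "subtopology (prod_topology ?Z Y) Q = subtopology (prod_topology (C_k Y) Y) Q"
    proof -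
      have "Q \<subseteq> \<K> \<times> UNIV" using compactin_subset_topspace[OF Q] by auto
      then have "\<K> \<times> UNIV \<inter> Q = Q" by blast
      then show ?thesis
        using subtopology_Times[of "C_k Y" Y \<K> UNIV] by (metis subtopology_UNIV subtopology_subtopology)
    qed
    moreover have "Q \<subseteq> UNIV \<times> snd ` Q" by force
    ultimately show "continuous_map (subtopology (prod_topology ?Z Y) Q) euclideanreal (\<lambda>(f, y). f y)"
      by (metis continuous_map_from_subtopology_mono)
  qed
qed

section \<open>Pairs of countable ordinals, bounded sets and hemicompactness\<close>

lemma uncountable_omega1_embedding:
  assumes "uncountable S"
  obtains e where "inj_on e omega1" "e ` omega1 \<subseteq> S"
proof -
  have "\<not> (card_of S, natLeq) \<in> ordLeq" using assms by (simp add: countable_card_le_natLeq)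
  then have "(natLeq, card_of S) \<in> ordLess"
    by (simp add: not_ordLeq_iff_ordLess natLeq_Well_order card_of_Well_order)
  then have "(cardSuc natLeq, card_of S) \<in> ordLeq"
    by (simp add: cardSuc_ordLess_ordLeq natLeq_Card_order card_of_Card_order)
  then have "(card_of omega1, card_of S) \<in> ordLeq"
    unfolding omega1_def
    using card_of_Field_ordIso[OF cardSuc_Card_order[OF natLeq_Card_order]] ordIso_ordLeq_trans by blast
  then show thesis using that by (auto simp flip: card_of_ordLeq)
qed

lemma uncountable_omega1: "uncountable omega1"
proof
  assume "countable omega1"
  then have "(card_of omega1, natLeq) \<in> ordLeq" by (simp add: countable_card_le_natLeq)
  then have "(cardSuc natLeq, natLeq) \<in> ordLeq"
    unfolding omega1_def
    using ordIso_symmetric[OF card_of_Field_ordIso[OF cardSuc_Card_order[OF natLeq_Card_order]]] ordIso_ordLeq_trans by blast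
  then show False
    using cardSuc_greater[OF natLeq_Card_order] not_ordLess_ordLeq by blast
qed

lemma omega1_Times_embedding:
  obtains h where "inj_on h (omega1 \<times> omega1)" "h ` (omega1 \<times> omega1) \<subseteq> omega1"
proof -
  have "infinite omega1" using uncountable_omega1 countable_finite by blast
  then have "(card_of (omega1 \<times> omega1), card_of omega1) \<in> ordLeq"
    using card_of_Times_same_infinite ordIso_imp_ordLeq by blast
  then show thesis using that by (auto simp flip: card_of_ordLeq)
qed

text \<open>Lets a countable family be read as a fan indexed by \<open>omega1\<close>, with the
  empty set at all remaining indices.\<close>

lemma nat_omega1_embedding:
  obtains h :: "'a::countable \<Rightarrow> nat set" where "inj h" "range h \<subseteq> omega1"
proof -
  have "infinite omega1" using uncountable_omega1 countable_finite by blast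
  then obtain g :: "nat \<Rightarrow> nat set" where g: "inj g" "range g \<subseteq> omega1"
    using infinite_countable_subset by blast
  show thesis
    by (rule that[of "g \<circ> to_nat"]) (use g in \<open>auto intro: inj_compose\<close>)
qed

text \<open>The function \<open>e\<close> comes from injections of the initial segments of \<open>\<omega>\<^sub>1\<close> into the natural numbers.\<close>

lemma omega1_pairs_unbounded:
  obtains P :: "(nat set \<times> nat set) set" and e :: "nat set \<Rightarrow> nat set \<Rightarrow> nat"
  where "P \<subseteq> omega1 \<times> omega1"
    "\<And>f :: nat set \<Rightarrow> nat. infinite {(\<alpha>, \<beta>) \<in> P. f \<alpha> \<le> e \<alpha> \<beta> \<and> f \<beta> \<le> e \<alpha> \<beta>}"
proof -
  let ?r = "cardSuc natLeq"
  have co: "Card_order ?r" by (rule cardSuc_Card_order[OF natLeq_Card_order])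
  have wo: "Well_order ?r" using co by (simp add: card_order_on_well_order_on)
  have seg: "countable (underS ?r \<beta>)" if "\<beta> \<in> omega1" for \<beta>
  proof -
    have "(card_of (underS ?r \<beta>), ?r) \<in> ordLess" using card_of_underS[OF co] that unfolding omega1_def by blast
    then show ?thesis
      by (simp add: cardSuc_ordLeq_ordLess natLeq_Card_order card_of_Card_order countable_card_le_natLeq)
  qed
  have tot: "\<alpha> \<in> underS ?r \<beta> \<or> \<beta> \<in> underS ?r \<alpha> \<or> \<alpha> = \<beta>" if "\<alpha> \<in> omega1" "\<beta> \<in> omega1" for \<alpha> \<beta>
    using wo that unfolding omega1_def underS_def well_order_on_def linear_order_on_def total_on_def by auto
  \<comment> \<open>The initial segment below \<beta> is countable, so for fixed \<beta> this is
    injective in the predecessors \<alpha> of \<beta>.\<close>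
  define e where "e = (\<lambda>\<alpha> \<beta>. to_nat_on (underS ?r \<beta>) \<alpha>)"
  define P where "P = {(\<alpha>, \<beta>) \<in> omega1 \<times> omega1. \<alpha> \<in> underS ?r \<beta>}"
  show thesis
  proof (rule that[of P e])
    show "P \<subseteq> omega1 \<times> omega1" by (auto simp: P_def)
  next
    fix f :: "nat set \<Rightarrow> nat"
    have "\<exists>n. uncountable {\<alpha>\<in>omega1. f \<alpha> = n}"
    proof (rule ccontr)
      assume "\<not> ?thesis"
      then have "countable (\<Union>n. {\<alpha>\<in>omega1. f \<alpha> = n})" by (intro countable_UN) auto
      moreover have "(\<Union>n. {\<alpha>\<in>omega1. f \<alpha> = n}) = omega1" by auto
      ultimately show False using uncountable_omega1 by simp
    qed
    then obtain n where n: "uncountable {\<alpha>\<in>omega1. f \<alpha> = n}" (is "uncountable ?A") ..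
    then have "infinite ?A" using countable_finite by blast
    \<comment> \<open>\<open>f\<close> is constantly n on the uncountable set \<open>?A\<close>. A
      countable set \<open>B\<close> in it lies below some further \<beta> in \<open>?A\<close>, and
      injectivity leaves only finitely many \<alpha> in \<open>B\<close> with
      \<open>e \<alpha> \<beta>\<close> below n = \<open>f \<alpha>\<close> =
      \<open>f \<beta>\<close>.\<close>
    then obtain B where B: "B \<subseteq> ?A" "infinite B" "countable B" using infinite_countable_subset' by blast
    have "countable (B \<union> (\<Union>\<alpha>\<in>B. underS ?r \<alpha>))" using B seg by (intro countable_Un countable_UN) auto
    then have "\<not> ?A \<subseteq> B \<union> (\<Union>\<alpha>\<in>B. underS ?r \<alpha>)" using n countable_subset by blast
    then obtain \<beta> where b: "\<beta> \<in> ?A" "\<beta> \<notin> B" "\<And>\<alpha>. \<alpha> \<in> B \<Longrightarrow> \<beta> \<notin> underS ?r \<alpha>" by auto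
    have Bs: "B \<subseteq> underS ?r \<beta>"
    proof
      fix \<alpha> assume a: "\<alpha> \<in> B"
      then have "\<alpha> \<in> omega1" "\<beta> \<in> omega1" using B(1) b(1) by auto
      then show "\<alpha> \<in> underS ?r \<beta>" using tot[of \<alpha> \<beta>] b(2,3) a by auto
    qed
    have "inj_on (\<lambda>\<alpha>. e \<alpha> \<beta>) B"
      unfolding e_def using inj_on_to_nat_on[OF seg] b(1) Bs by (auto intro: inj_on_subset)
    then have "finite {\<alpha>\<in>B. e \<alpha> \<beta> \<in> {..<n}}"
      by (intro finite_inverse_image_gen) auto
    then have "infinite (B - {\<alpha>\<in>B. e \<alpha> \<beta> \<in> {..<n}})" using B(2) by simp
    then have inf: "infinite ((\<lambda>\<alpha>. (\<alpha>, \<beta>)) ` (B - {\<alpha>\<in>B. e \<alpha> \<beta> \<in> {..<n}}))"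
      by (subst finite_image_iff) (auto simp: inj_on_def)
    have "(\<lambda>\<alpha>. (\<alpha>, \<beta>)) ` (B - {\<alpha>\<in>B. e \<alpha> \<beta> \<in> {..<n}}) \<subseteq> {(\<alpha>, \<beta>) \<in> P. f \<alpha> \<le> e \<alpha> \<beta> \<and> f \<beta> \<le> e \<alpha> \<beta>}"
    proof (rule image_subsetI)
      fix \<alpha> assume a: "\<alpha> \<in> B - {\<alpha>\<in>B. e \<alpha> \<beta> \<in> {..<n}}"
      then have "\<alpha> \<in> underS ?r \<beta>" "\<alpha> \<in> ?A" using Bs B(1) by blast+
      with a b(1) show "(\<alpha>, \<beta>) \<in> {(\<alpha>, \<beta>) \<in> P. f \<alpha> \<le> e \<alpha> \<beta> \<and> f \<beta> \<le> e \<alpha> \<beta>}" by (auto simp: P_def)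
    qed
    with inf show "infinite {(\<alpha>, \<beta>) \<in> P. f \<alpha> \<le> e \<alpha> \<beta> \<and> f \<beta> \<le> e \<alpha> \<beta>}" using finite_subset by blast
  qed
qed

section \<open>Locally finite families and bounded sets\<close>

lemma compactin_meets_finite:
  assumes lf: "\<And>y. y \<in> topspace Y \<Longrightarrow> \<exists>V. openin Y V \<and> y \<in> V \<and> finite {i\<in>I. W i \<inter> V \<noteq> {}}"
    and K: "compactin Y K"
  shows "finite {i\<in>I. W i \<inter> K \<noteq> {}}"
proof -
  have "\<forall>y\<in>topspace Y. \<exists>V. openin Y V \<and> y \<in> V \<and> finite {i\<in>I. W i \<inter> V \<noteq> {}}" using lf by simp
  then obtain V where V: "\<forall>y\<in>topspace Y. openin Y (V y) \<and> y \<in> V y \<and> finite {i\<in>I. W i \<inter> V y \<noteq> {}}"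
    by (rule bchoice[THEN exE])
  have Ks: "K \<subseteq> topspace Y" using K by (rule compactin_subset_topspace)
  then have "K \<subseteq> \<Union>(V ` K)" using V by blast
  then obtain J where J: "finite J" "J \<subseteq> K" "K \<subseteq> \<Union>(V ` J)"
    by (rule compactin_finite_subcover[OF K, rotated]) (use V Ks in auto)
  have "{i\<in>I. W i \<inter> K \<noteq> {}} \<subseteq> (\<Union>y\<in>J. {i\<in>I. W i \<inter> V y \<noteq> {}})"
  proof
    fix i assume "i \<in> {i\<in>I. W i \<inter> K \<noteq> {}}"
    then obtain y where y: "i \<in> I" "y \<in> W i" "y \<in> K" by auto
    then obtain j where "j \<in> J" "y \<in> V j" using J(3) by blast
    with y show "i \<in> (\<Union>y\<in>J. {i\<in>I. W i \<inter> V y \<noteq> {}})" by (intro UN_I[of j]) auto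
  qed
  moreover have "finite (\<Union>y\<in>J. {i\<in>I. W i \<inter> V y \<noteq> {}})" using J V Ks by blast
  ultimately show ?thesis by (rule finite_subset)
qed

lemma bounded_in_closure_of:
  assumes "bounded_in Y B" shows "bounded_in Y (Y closure_of B)"
  unfolding bounded_in_def
proof (intro conjI allI impI)
  show "Y closure_of B \<subseteq> topspace Y" by (rule closure_of_subset_topspace)
  fix \<U> assume "locally_finite_in Y \<U> \<and> (\<forall>U\<in>\<U>. openin Y U \<and> U \<inter> Y closure_of B \<noteq> {})"
  then show "finite \<U>" using assms openin_Int_closure_of_eq_empty unfolding bounded_in_def by metis
qed

lemma mu_complete_compactin_closure:
  assumes "mu_complete_space Y" "bounded_in Y B" shows "compactin Y (Y closure_of B)"
  using assms bounded_in_closure_of closedin_closure_of unfolding mu_complete_space_def by blast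

text \<open>A locally finite family has only finitely many members containing a point of the finite
  set \<open>A\<close>; these are discarded. The rest is enumerated injectively, which turns local
  finiteness of a set of sets into local finiteness of an indexed sequence.\<close>

lemma unbounded_locally_finite_sequence:
  assumes M: "M \<subseteq> topspace Y" "\<not> bounded_in Y M" and A: "finite A"
  obtains d W where "\<And>m::nat. openin Y (W m)" "\<And>m. d m \<in> W m" "\<And>m. d m \<in> M" "\<And>m. W m \<inter> A = {}"
    "\<And>y. y \<in> topspace Y \<Longrightarrow> \<exists>V. openin Y V \<and> y \<in> V \<and> finite {m. W m \<inter> V \<noteq> {}}"
proof -
  obtain \<U> where U: "locally_finite_in Y \<U>" "\<And>U. U \<in> \<U> \<Longrightarrow> openin Y U" "\<And>U. U \<in> \<U> \<Longrightarrow> U \<inter> M \<noteq> {}" "infinite \<U>"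
    using M unfolding bounded_in_def by blast
  have "finite {U\<in>\<U>. a \<in> U}" for a
  proof (cases "a \<in> topspace Y")
    case True
    then obtain V where "openin Y V" "a \<in> V" "finite {U\<in>\<U>. U \<inter> V \<noteq> {}}"
      using U(1) unfolding locally_finite_in_def by metis
    moreover have "{U\<in>\<U>. a \<in> U} \<subseteq> {U\<in>\<U>. U \<inter> V \<noteq> {}}" using \<open>a \<in> V\<close> by auto
    ultimately show ?thesis using finite_subset by blast
  next
    case False
    then have "{U\<in>\<U>. a \<in> U} = {}" using U(2) openin_subset by blast
    then show ?thesis by (metis finite.emptyI)
  qed
  then have "finite (\<Union>a\<in>A. {U\<in>\<U>. a \<in> U})" using A by blast
  then have "infinite (\<U> - (\<Union>a\<in>A. {U\<in>\<U>. a \<in> U}))" using U(4) by simp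
  then obtain W :: "nat \<Rightarrow> 'a set" where W: "inj W" "range W \<subseteq> \<U> - (\<Union>a\<in>A. {U\<in>\<U>. a \<in> U})"
    using infinite_countable_subset by blast
  have WU: "W m \<in> \<U>" for m using W(2) by blast
  have "\<forall>m. \<exists>x. x \<in> W m \<inter> M" using U(3)[OF WU] by blast
  then obtain d where d: "\<And>m. d m \<in> W m \<inter> M" by metis
  show thesis
  proof (rule that[of W d])
    show "openin Y (W m)" for m using U(2)[OF WU] .
    show "d m \<in> W m" "d m \<in> M" for m using d[of m] by auto
    show "W m \<inter> A = {}" for m using W(2) WU[of m] by blast
    fix y assume "y \<in> topspace Y"
    then obtain V where V: "openin Y V" "y \<in> V" "finite {U\<in>\<U>. U \<inter> V \<noteq> {}}"
      using U(1) unfolding locally_finite_in_def by metis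
    have "{m. W m \<inter> V \<noteq> {}} = W -` {U\<in>\<U>. U \<inter> V \<noteq> {}}" using WU by auto
    then have "finite {m. W m \<inter> V \<noteq> {}}" using finite_vimageI[OF V(3) W(1)] by simp
    then show "\<exists>V. openin Y V \<and> y \<in> V \<and> finite {m. W m \<inter> V \<noteq> {}}" using V by blast
  qed
qed

text \<open>A point x outside F is separated by a function with value 0 at x and 1 on F, built along
  the exhaustion: Tietze extends it from \<open>C n\<close> together with the trace of F on
  \<open>C (Suc n)\<close> to all of \<open>C (Suc n)\<close>. Each compact set lies in some stage,
  so the glued function is continuous on compact sets and hence continuous.\<close>

lemma hemicompact_k_R_imp_k_omega:
  assumes X: "tychonoff_space X" and kR: "k_R_space X"
    and K: "\<And>n::nat. compactin X (K n)" "incseq K" and hemi: "\<And>C. compactin X C \<Longrightarrow> \<exists>n. C \<subseteq> K n"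
  shows "k_omega_sequence X K"
  unfolding k_omega_sequence_def
proof (intro conjI allI impI K)
  have H: "Hausdorff_space X" using X by (rule tychonoff_space_imp_Hausdorff)
  have Kcl: "closedin X (K n)" for n using compactin_imp_closedin[OF H K(1)] .
  have Ks: "K n \<subseteq> topspace X" for n using K(1) compactin_subset_topspace by blast
  show "\<Union>(range K) = topspace X"
  proof
    show "topspace X \<subseteq> \<Union>(range K)"
    proof
      fix x assume "x \<in> topspace X"
      then obtain n where "{x} \<subseteq> K n" using hemi[of "{x}"] by auto
      then show "x \<in> \<Union>(range K)" by auto
    qed
  qed (use Ks in blast)
  fix F assume F: "F \<subseteq> topspace X" "\<forall>n. closedin (subtopology X (K n)) (F \<inter> K n)"
  have Fcl: "closedin X (F \<inter> K n)" for n using F(2) Kcl closedin_trans_full by blast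
  have "\<exists>T. openin X T \<and> x \<in> T \<and> T \<subseteq> topspace X - F" if x: "x \<in> topspace X - F" for x
  proof -
    obtain N where N: "x \<in> K N" using hemi[of "{x}"] x by auto
    \<comment> \<open>Shifting by \<open>N\<close> puts x into every stage, so each extension keeps
      the value 0 at x.\<close>
    define C where "C = (\<lambda>n. K (N + n))"
    have Cmono: "C n \<subseteq> C m" if "n \<le> m" for n m using incseqD[OF K(2), of "N + n" "N + m"] that by (simp add: C_def)
    have Ccl: "closedin X (C n)" "closedin X (F \<inter> C n)" for n using Kcl Fcl by (auto simp: C_def)
    define P where "P = (\<lambda>n (f :: 'a \<Rightarrow> real). continuous_map (subtopology X (C n)) euclideanreal f \<and>
        (\<forall>y\<in>F \<inter> C n. f y = 1) \<and> f x = 0)"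
    have "\<exists>f. \<forall>n. P n (f n) \<and> (\<forall>y\<in>C n. f (Suc n) y = f n y)"
    proof (rule dependent_nat_choice)
      have "x \<in> topspace X - F \<inter> C 0" using x by auto
      then obtain f where f: "continuous_map X (top_of_set {0..1::real}) f" "f x = 0" "f ` (F \<inter> C 0) \<subseteq> {1}"
        using X Ccl(2)[of 0] unfolding tychonoff_space_def completely_regular_space_def by metis
      have "continuous_map X euclideanreal f" using f(1) by (auto intro: continuous_map_into_fulltopology)
      then have "P 0 f" using f by (auto simp: P_def continuous_map_from_subtopology)
      then show "\<exists>f. P 0 f" by (rule exI[of _ f])
    next
      fix f n assume "P n f"
      then have f: "continuous_map (subtopology X (C n)) euclideanreal f" "\<And>y. y \<in> F \<inter> C n \<Longrightarrow> f y = 1" "f x = 0"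
        by (auto simp: P_def)
      let ?Y = "subtopology X (C (Suc n))"
      let ?S = "C n \<union> (F \<inter> C (Suc n))"
      define h where "h = (\<lambda>y. if y \<in> C n then f y else 1)"
      have sub: "?S \<subseteq> C (Suc n)" using Cmono[of n "Suc n"] by auto
      have "continuous_map (subtopology X ?S) euclideanreal h"
      proof (rule pasting_lemma_closed[of "{True, False}" _ "\<lambda>b. if b then C n else F \<inter> C (Suc n)" _ "\<lambda>b. if b then f else (\<lambda>_. 1)"])
        show "closedin (subtopology X ?S) (if b then C n else F \<inter> C (Suc n))" for b
          using Ccl by (auto intro!: closedin_subset_topspace)
        show "continuous_map (subtopology (subtopology X ?S) (if b then C n else F \<inter> C (Suc n))) euclideanreal (if b then f else (\<lambda>_. 1))" for b
        proof (cases b)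
          case True
          have "?S \<inter> C n = C n" by blast
          then show ?thesis using f(1) True by (simp add: subtopology_subtopology)
        qed simp
        show "(if i then f else (\<lambda>_. 1)) y = (if j then f else (\<lambda>_. 1)) y"
          if "y \<in> topspace (subtopology X ?S) \<inter> (if i then C n else F \<inter> C (Suc n)) \<inter> (if j then C n else F \<inter> C (Suc n))" for i j y
          using that f(2) by (cases i; cases j) auto
        show "\<exists>j. j \<in> {True, False} \<and> y \<in> (if j then C n else F \<inter> C (Suc n)) \<and> h y = (if j then f else (\<lambda>_. 1)) y"
          if "y \<in> topspace (subtopology X ?S)" for y
          using that by (cases "y \<in> C n") (auto simp: h_def)
      qed simp
      then have "continuous_map (subtopology ?Y ?S) euclideanreal h"
        using sub by (simp add: subtopology_subtopology inf_absorb2)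
      moreover have "normal_space ?Y"
      proof -
        have "compact_space ?Y" using K(1) by (simp add: C_def compactin_subspace)
        then show ?thesis using H by (simp add: Hausdorff_space_subtopology compact_Hausdorff_or_regular_imp_normal_space)
      qed
      moreover have "closedin ?Y ?S" using Ccl sub by (intro closedin_subset_topspace closedin_Un) auto
      ultimately obtain g where g: "continuous_map ?Y euclideanreal g" "\<And>y. y \<in> ?S \<Longrightarrow> g y = h y"
        using Tietze_extension_realinterval[of ?Y ?S UNIV h] by auto
      have xC: "x \<in> C n" using N Cmono[of 0 n] by (auto simp: C_def)
      have "P (Suc n) g" unfolding P_def
      proof (intro conjI ballI g(1))
        fix y assume "y \<in> F \<inter> C (Suc n)"
        then show "g y = 1" using g(2)[of y] f(2)[of y] by (auto simp: h_def)
      next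
        show "g x = 0" using g(2)[of x] xC f(3) by (auto simp: h_def)
      qed
      moreover have "\<forall>y\<in>C n. g y = f y" using g(2) by (auto simp: h_def)
      ultimately show "\<exists>g. P (Suc n) g \<and> (\<forall>y\<in>C n. g y = f y)" by blast
    qed
    then obtain f where f: "\<And>n. P n (f n)" "\<And>n y. y \<in> C n \<Longrightarrow> f (Suc n) y = f n y" by metis
    have f_stable: "f (n + k) y = f n y" if "y \<in> C n" for n k y
    proof (induction k)
      case (Suc k)
      have "y \<in> C (n + k)" using Cmono[of n "n + k"] that by auto
      then show ?case using f(2)[of y "n + k"] Suc by simp
    qed simp
    define g where "g = (\<lambda>y. f (LEAST n. y \<in> C n) y)"
    have g: "g y = f n y" if "y \<in> C n" for n y
    proof -
      have "y \<in> C (LEAST n. y \<in> C n)" using that by (rule LeastI)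
      moreover have "(LEAST n. y \<in> C n) \<le> n" using that by (rule Least_le)
      ultimately show ?thesis using f_stable[of y "LEAST n. y \<in> C n" "n - (LEAST n. y \<in> C n)"] by (simp add: g_def)
    qed
    have "continuous_map X euclideanreal g"
    proof -
      have "continuous_map (subtopology X D) euclideanreal g" if D: "compactin X D" for D
      proof -
        obtain n where "D \<subseteq> K n" using hemi[OF D] by blast
        then have Dn: "D \<subseteq> C n" using incseqD[OF K(2), of n "N + n"] by (auto simp: C_def)
        have "continuous_map (subtopology X D) euclideanreal (f n)"
          using f(1)[of n] Dn unfolding P_def by (metis continuous_map_from_subtopology_mono)
        then show ?thesis by (rule continuous_map_eq) (use g Dn in auto)
      qed
      then show ?thesis using kR unfolding k_R_space_def by blast
    qed
    then have "openin X {y \<in> topspace X. g y \<in> {..<1}}" by (rule openin_continuous_map_preimage) simp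
    moreover have "g x = 0" using g[of x 0] N f(1)[of 0] by (auto simp: C_def P_def)
    moreover have "g y = 1" if "y \<in> F" for y
    proof -
      have "y \<in> topspace X" using F(1) that by blast
      then obtain n where "{y} \<subseteq> K n" using hemi[of "{y}"] by auto
      then have "y \<in> C n" using incseqD[OF K(2), of n "N + n"] by (auto simp: C_def)
      then show ?thesis using g f(1)[of n] that by (auto simp: P_def)
    qed
    ultimately show ?thesis
      using x by (intro exI[of _ "{y \<in> topspace X. g y \<in> {..<1}}"]) auto
  qed
  then have "openin X (topspace X - F)" by (subst openin_subopen) blast
  then show "closedin X F" using F(1) by (simp add: closedin_def)
qed

section \<open>Supports and continuous functionals on the free linear topological space\<close>

lemma lts_halve:
  assumes L: "lin_top_space L" and V: "openin L V" "0 \<in> V"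
  obtains W where "openin L W" "0 \<in> W" "\<And>u v. u \<in> W \<Longrightarrow> v \<in> W \<Longrightarrow> u + v \<in> V"
proof -
  define P where "P = {p \<in> topspace (prod_topology L L). (\<lambda>(u, v). u + v) p \<in> V}"
  have "openin (prod_topology L L) P"
    unfolding P_def using L V(1) by (intro openin_continuous_map_preimage) (auto simp: lin_top_space_def)
  moreover have "(0, 0) \<in> P" using L V(2) by (auto simp: P_def lin_top_space_def subspace_0)
  ultimately have "\<exists>U W. openin L U \<and> openin L W \<and> 0 \<in> U \<and> 0 \<in> W \<and> U \<times> W \<subseteq> P"
    by (simp add: openin_prod_topology_alt)
  then obtain U W where W: "openin L U" "openin L W" "0 \<in> U" "0 \<in> W" "U \<times> W \<subseteq> P"
    by (elim exE conjE)
  show thesis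
  proof (rule that[of "U \<inter> W"])
    fix u v assume "u \<in> U \<inter> W" "v \<in> U \<inter> W"
    then have "(u, v) \<in> P" using W(5) by blast
    then show "u + v \<in> V" by (simp add: P_def)
  qed (use W in auto)
qed

lemma lts_small_multiple:
  assumes L: "lin_top_space L" and W: "openin L W" "0 \<in> W" and w: "w \<in> topspace L"
  shows "\<exists>N. \<forall>n\<ge>N. inverse (real (Suc n)) *\<^sub>R w \<in> W"
proof -
  have "continuous_map euclideanreal L (\<lambda>t. t *\<^sub>R w)"
    using w by (intro continuous_map_lts_scaleR L) auto
  then have "openin euclideanreal {t \<in> topspace euclideanreal. t *\<^sub>R w \<in> W}"
    using W(1) by (rule openin_continuous_map_preimage)
  then have "open {t. t *\<^sub>R w \<in> W}" by simp
  moreover have "0 \<in> {t. t *\<^sub>R w \<in> W}" using W(2) by simp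
  ultimately have "\<forall>\<^sub>F n in sequentially. inverse (real (Suc n)) \<in> {t. t *\<^sub>R w \<in> W}"
    using LIMSEQ_inverse_real_of_nat by (rule_tac topological_tendstoD)
  then show ?thesis by (simp add: eventually_sequentially)
qed

lemma R_open_in_nonzero:
  assumes "continuous_map Y euclideanreal \<phi>"
  shows "R_open_in Y {w \<in> topspace Y. \<phi> w \<noteq> 0}"
  unfolding R_open_in_def
proof (intro conjI ballI)
  fix y assume y: "y \<in> {w \<in> topspace Y. \<phi> w \<noteq> 0}"
  have "continuous_map euclideanreal (top_of_set {0..1}) (\<lambda>t. min 1 (\<bar>t\<bar> / \<bar>\<phi> y\<bar>))"
    using y by (auto simp: continuous_map_in_subtopology intro!: continuous_intros)
  with assms have "continuous_map Y (top_of_set {0..1}) (\<lambda>w. min 1 (\<bar>\<phi> w\<bar> / \<bar>\<phi> y\<bar>))"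
    by (auto dest: continuous_map_compose simp: o_def)
  then show "\<exists>f. continuous_map Y (top_of_set {0..1}) f \<and> f y = (1::real) \<and>
      f ` (topspace Y - {w \<in> topspace Y. \<phi> w \<noteq> 0}) \<subseteq> {0}"
    using y by (intro exI[of _ "\<lambda>w. min 1 (\<bar>\<phi> w\<bar> / \<bar>\<phi> y\<bar>)"]) auto
qed auto

text \<open>Forward substitution for a lower triangular infinite system. The right-hand side
  \<open>real k\<close> is chosen because it is unbounded in k.\<close>

fun triangular_solution :: "(nat \<Rightarrow> nat \<Rightarrow> real) \<Rightarrow> nat \<Rightarrow> real" where
  "triangular_solution a k = (real k - (\<Sum>n<k. triangular_solution a n * a k n)) / a k k"

declare triangular_solution.simps [simp del]

lemma triangular_solution:
  assumes "a k k \<noteq> 0"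
  shows "(\<Sum>n\<le>k. triangular_solution a n * a k n) = real k"
proof -
  have "(\<Sum>n\<le>k. triangular_solution a n * a k n) =
      (\<Sum>n<k. triangular_solution a n * a k n) + triangular_solution a k * a k k"
    by (simp add: lessThan_Suc_atMost[symmetric])
  also have "triangular_solution a k * a k k = real k - (\<Sum>n<k. triangular_solution a n * a k n)"
    using assms by (subst triangular_solution.simps) simp
  finally show ?thesis by simp
qed

text \<open>The indices n with y in \<open>U n\<close> form a finite set that varies with y. On
  \<open>V y\<close> the sum equals the fixed finite sum over those n for which \<open>U n\<close>
  meets \<open>V y\<close>, the additional terms being zero.\<close>

lemma continuous_map_locally_finite_sum:
  fixes g :: "nat \<Rightarrow> 'a \<Rightarrow> real"
  assumes lf: "\<And>y. y \<in> topspace Y \<Longrightarrow> \<exists>V. openin Y V \<and> y \<in> V \<and> finite {n. U n \<inter> V \<noteq> {}}"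
    and g: "\<And>n. continuous_map Y euclideanreal (g n)" "\<And>n y. y \<in> topspace Y - U n \<Longrightarrow> g n y = 0"
  shows "continuous_map Y euclideanreal (\<lambda>y. \<Sum>n | y \<in> U n. g n y)"
proof -
  have "\<forall>y\<in>topspace Y. \<exists>V. openin Y V \<and> y \<in> V \<and> finite {n. U n \<inter> V \<noteq> {}}" using lf by simp
  then obtain V where V: "\<forall>y\<in>topspace Y. openin Y (V y) \<and> y \<in> V y \<and> finite {n. U n \<inter> V y \<noteq> {}}"
    by (rule bchoice[THEN exE])
  have eq: "(\<Sum>n | x \<in> U n. g n x) = (\<Sum>n | U n \<inter> V y \<noteq> {}. g n x)"
    if "y \<in> topspace Y" "x \<in> topspace Y" "x \<in> V y" for x y
    using V that g(2) by (intro sum.mono_neutral_left) auto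
  show ?thesis
  proof (rule pasting_lemma[of "topspace Y" _ V _ "\<lambda>y x. \<Sum>n | U n \<inter> V y \<noteq> {}. g n x"])
    show "continuous_map (subtopology Y (V i)) euclideanreal (\<lambda>x. \<Sum>n | U n \<inter> V i \<noteq> {}. g n x)"
      if "i \<in> topspace Y" for i
      using V that g(1) by (intro continuous_map_from_subtopology continuous_map_sum) auto
    show "(\<Sum>n | U n \<inter> V i \<noteq> {}. g n x) = (\<Sum>n | U n \<inter> V j \<noteq> {}. g n x)"
      if "i \<in> topspace Y" "j \<in> topspace Y" "x \<in> topspace Y \<inter> V i \<inter> V j" for i j x
      using eq[of i x] eq[of j x] that by simp
    show "\<exists>j. j \<in> topspace Y \<and> x \<in> V j \<and> (\<Sum>n | x \<in> U n. g n x) = (\<Sum>n | U n \<inter> V j \<noteq> {}. g n x)"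
      if "x \<in> topspace Y" for x
      using V that eq[of x x] by (intro exI[of _ x]) auto
  qed (use V in auto)
qed

locale free_lts =
  fixes X :: "'x topology" and L :: "'l::real_vector topology" and \<delta> :: "'x \<Rightarrow> 'l"
  assumes tychonoff: "tychonoff_space X" and free: "free_lin_top_space X L \<delta>"
begin

definition coef :: "'l \<Rightarrow> 'x \<Rightarrow> real" where
  "coef w x = representation (\<delta> ` topspace X) w (\<delta> x)"

definition supp :: "'l \<Rightarrow> 'x set" where
  "supp w = {x \<in> topspace X. coef w x \<noteq> 0}"

text \<open>The functional on \<open>L\<close> that extends \<open>f\<close>, written in coordinates
  with respect to the basis \<delta>(X), so that its dependence on the values of \<open>f\<close> on
  the support is visible.\<close>

definition pairing :: "('x \<Rightarrow> real) \<Rightarrow> 'l \<Rightarrow> real" where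
  "pairing f w = (\<Sum>x\<in>supp w. coef w x * f x)"

lemma lts: "lin_top_space L" and continuous_delta: "continuous_map X L \<delta>"
  using free by (auto simp: free_lin_top_space_def free_lin_top_space_wrt_def)

lemma subspace_L: "subspace (topspace L)" using lts by (simp add: lin_top_space_def)

lemma delta_in: "x \<in> topspace X \<Longrightarrow> \<delta> x \<in> topspace L"
  using continuous_delta by (auto simp: continuous_map_def)

lemma supp_subset: "supp w \<subseteq> topspace X" by (auto simp: supp_def)

lemma supp_image: "{b. representation (\<delta> ` topspace X) w b \<noteq> 0} = \<delta> ` supp w"
  using representation_ne_zero[of "\<delta> ` topspace X" w] by (auto simp: supp_def coef_def)

lemma inj_delta_supp: "inj_on \<delta> (supp w)"
  using free_lin_top_space_independent(1)[OF tychonoff free] supp_subset by (rule inj_on_subset)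

lemma finite_supp: "finite (supp w)"
  using finite_representation[of "\<delta> ` topspace X" w] inj_delta_supp
  unfolding supp_image by (simp add: finite_image_iff)

lemma expansion:
  assumes "w \<in> topspace L"
  shows "w = (\<Sum>x\<in>supp w. coef w x *\<^sub>R \<delta> x)"
proof -
  have "w \<in> span (\<delta> ` topspace X)" using assms free_lin_top_space_span[OF free] by simp
  then have "(\<Sum>b\<in>\<delta> ` supp w. representation (\<delta> ` topspace X) w b *\<^sub>R b) = w"
    using sum_nonzero_representation_eq[OF free_lin_top_space_independent(2)[OF tychonoff free]]
    by (simp add: supp_image)
  then show ?thesis by (simp add: sum.reindex[OF inj_delta_supp] coef_def)
qed

text \<open>Coordinates say nothing about the topology. Continuity comes from the universal property
  with target the real line: its operator is linear with values f(x) at \<delta>(x), hence agrees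
  with the coordinate formula on the span.\<close>

lemma pairing_operator:
  assumes f: "continuous_map X euclideanreal f"
  shows "continuous_linear_operator L euclideanreal (pairing f)" and "\<And>x. x \<in> topspace X \<Longrightarrow> pairing f (\<delta> x) = f x"
proof -
  have R: "lin_top_space euclideanreal"
    unfolding lin_top_space_def
    by (auto simp: split_def simp flip: euclidean_product_topology intro!: continuous_intros)
  have "free_lin_top_space_wrt TYPE(real) X L \<delta>" by (rule free_lin_top_space_universal[OF tychonoff free])
  then obtain g where g: "continuous_linear_operator L euclideanreal g" "\<And>x. x \<in> topspace X \<Longrightarrow> g (\<delta> x) = f x"
    using R f unfolding free_lin_top_space_wrt_def by metis
  have "(\<Sum>x\<in>S. c x *\<^sub>R \<delta> x) \<in> topspace L \<and> g (\<Sum>x\<in>S. c x *\<^sub>R \<delta> x) = (\<Sum>x\<in>S. c x * f x)"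
    if "finite S" "S \<subseteq> topspace X" for S c
    using that
  proof (induction S)
    case empty
    have "g (0 *\<^sub>R 0) = 0 *\<^sub>R g 0"
      using g(1) subspace_0[OF subspace_L] unfolding continuous_linear_operator_def by blast
    then show ?case by (simp add: subspace_0[OF subspace_L])
  next
    case (insert x S)
    then have "c x *\<^sub>R \<delta> x \<in> topspace L" "g (c x *\<^sub>R \<delta> x) = c x * f x"
      using g delta_in[of x] subspace_L by (auto simp: continuous_linear_operator_def subspace_def)
    then show ?case
      using insert g(1) subspace_L by (auto simp: continuous_linear_operator_def subspace_def)
  qed
  then have eq: "g w = pairing f w" if "w \<in> topspace L" for w
    using expansion[OF that] finite_supp supp_subset unfolding pairing_def by metis
  have "continuous_map L euclideanreal (pairing f)"
    by (rule continuous_map_eq[of _ _ g]) (use g eq in \<open>auto simp: continuous_linear_operator_def\<close>)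
  then show "continuous_linear_operator L euclideanreal (pairing f)"
    using g(1) eq subspace_L by (auto simp: continuous_linear_operator_def subspace_def)
  show "pairing f (\<delta> x) = f x" if "x \<in> topspace X" for x
    using g(2)[OF that] eq[OF delta_in[OF that]] by simp
qed

lemma continuous_pairing: "continuous_map X euclideanreal f \<Longrightarrow> continuous_map L euclideanreal (pairing f)"
  using pairing_operator(1) by (simp add: continuous_linear_operator_def)

lemma pairing_add:
  "continuous_map X euclideanreal f \<Longrightarrow> u \<in> topspace L \<Longrightarrow> v \<in> topspace L \<Longrightarrow>
    pairing f (u + v) = pairing f u + pairing f v"
  using pairing_operator(1) by (simp add: continuous_linear_operator_def)

lemma pairing_diff:
  assumes "continuous_map X euclideanreal f" "u \<in> topspace L" "v \<in> topspace L"
  shows "pairing f (u - v) = pairing f u - pairing f v"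
  using pairing_add[OF assms(1) subspace_diff[OF subspace_L assms(2,3)] assms(3)] by simp

lemma pairing_scale:
  "continuous_map X euclideanreal f \<Longrightarrow> v \<in> topspace L \<Longrightarrow> pairing f (r *\<^sub>R v) = r * pairing f v"
  using pairing_operator(1) by (simp add: continuous_linear_operator_def)

lemma pairing_nonzero: "pairing f w \<noteq> 0 \<Longrightarrow> \<exists>x\<in>supp w. f x \<noteq> 0"
  unfolding pairing_def by (rule ccontr) simp

lemma pairing_nonzero_meets:
  assumes "pairing f w \<noteq> 0" "\<And>x. x \<in> topspace X - A \<Longrightarrow> f x = 0" shows "supp w \<inter> A \<noteq> {}"
  using pairing_nonzero[OF assms(1)] assms(2) supp_subset by blast

text \<open>Otherwise a locally finite sequence of open sets meets the supports of elements \<open>w\<^sub>k\<close> of \<open>C\<close>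
  in a lower triangular pattern, and a locally finite sum of bump functions gives a continuous
  functional with the value \<open>k\<close> at \<open>w\<^sub>k\<close>, which is unbounded on \<open>C\<close>.\<close>

lemma bounded_support:
  assumes C: "compactin L C" shows "bounded_in X (\<Union>w\<in>C. supp w)"
proof (rule ccontr)
  assume nb: "\<not> ?thesis"
  have "(\<Union>w\<in>C. supp w) \<subseteq> topspace X" using supp_subset by blast
  with nb have "\<exists>\<U>. (locally_finite_in X \<U> \<and> (\<forall>U\<in>\<U>. openin X U \<and> U \<inter> (\<Union>w\<in>C. supp w) \<noteq> {})) \<and> infinite \<U>"
    unfolding bounded_in_def by simp
  then obtain \<U> where U: "locally_finite_in X \<U>" "\<And>U. U \<in> \<U> \<Longrightarrow> openin X U"
    "\<And>U. U \<in> \<U> \<Longrightarrow> U \<inter> (\<Union>w\<in>C. supp w) \<noteq> {}" "infinite \<U>"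
    by (elim exE conjE) simp
  have Hd: "Hausdorff_space X" using tychonoff by (rule tychonoff_space_imp_Hausdorff)
  have pf: "finite {U\<in>\<U>. a \<in> U}" if a: "a \<in> topspace X" for a
  proof -
    obtain V where V: "openin X V" "a \<in> V" "finite {U\<in>\<U>. U \<inter> V \<noteq> {}}"
      using U(1) a unfolding locally_finite_in_def by metis
    have "{U\<in>\<U>. a \<in> U} \<subseteq> {U\<in>\<U>. U \<inter> V \<noteq> {}}" using V(2) by auto
    then show ?thesis using V(3) finite_subset by blast
  qed
  \<comment> \<open>The finite set \<open>S\<close> collects all supports met so far. Only finitely
    many members of the family touch it, so the next open set can be taken disjoint from it; this
    produces the triangular pattern.\<close>
  define P where "P = (\<lambda>(n::nat) (S, U, w). finite S \<and> S \<subseteq> topspace X \<and> U \<in> \<U> \<and> w \<in> C \<and> supp w \<inter> U \<noteq> {} \<and> supp w \<subseteq> S)"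
  define Q where "Q = (\<lambda>(n::nat) (S :: 'x set, U :: 'x set, w :: 'l) (S', U', w' :: 'l). S \<subseteq> S' \<and> U' \<inter> S = {})"
  have next_ex: "\<exists>s. P m s \<and> (\<forall>U w. Q n (S, U, w) s)" if S: "finite S" "S \<subseteq> topspace X" for S m n
  proof -
    have "finite (\<Union>a\<in>S. {U\<in>\<U>. a \<in> U})" using S pf by blast
    then have "\<U> - (\<Union>a\<in>S. {U\<in>\<U>. a \<in> U}) \<noteq> {}" using U(4) by (metis finite_Diff2 finite.emptyI)
    then obtain U' where U': "U' \<in> \<U>" "U' \<inter> S = {}" by blast
    then obtain w' where w': "w' \<in> C" "supp w' \<inter> U' \<noteq> {}" using U(3) by blast
    have "P m (S \<union> supp w', U', w')" using S U' w' finite_supp supp_subset by (auto simp: P_def)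
    moreover have "Q n (S, U, w) (S \<union> supp w', U', w')" for U w using U' by (auto simp: Q_def)
    ultimately show ?thesis by blast
  qed
  have "\<exists>s. \<forall>n. P n (s n) \<and> Q n (s n) (s (Suc n))"
  proof (rule dependent_nat_choice)
    show "\<exists>s. P 0 s" using next_ex[of "{}"] by blast
    fix s n assume "P n s"
    then obtain S U w where "s = (S, U, w)" "finite S" "S \<subseteq> topspace X" by (cases s) (auto simp: P_def)
    then show "\<exists>s'. P (Suc n) s' \<and> Q n s s'" using next_ex[of S "Suc n" n] by blast
  qed
  then obtain s where s: "\<And>n. P n (s n)" "\<And>n. Q n (s n) (s (Suc n))" by blast
  define S where "S = (\<lambda>n. fst (s n))"
  define U' where "U' = (\<lambda>n. fst (snd (s n)))"
  define w where "w = (\<lambda>n. snd (snd (s n)))"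
  have P: "U' n \<in> \<U>" "w n \<in> C" "supp (w n) \<inter> U' n \<noteq> {}" "supp (w n) \<subseteq> S n" for n
    using s(1)[of n] by (auto simp: P_def S_def U'_def w_def split_def)
  have Q: "S n \<subseteq> S (Suc n)" "U' (Suc n) \<inter> S n = {}" for n
    using s(2)[of n] by (auto simp: Q_def S_def U'_def w_def split_def)
  have tri: "U' n \<inter> supp (w k) = {}" if "k < n" for n k
  proof -
    obtain m where m: "n = Suc m" "k \<le> m" using \<open>k < n\<close> by (metis Suc_le_mono less_eq_Suc_le Suc_le_D)
    have "S k \<subseteq> S m" using Q(1) m(2) by (rule lift_Suc_mono_le)
    then show ?thesis using P(4)[of k] Q(2)[of m] m(1) by blast
  qed
  have "inj U'"
  proof (rule linorder_injI)
    fix k n :: nat assume "k < n"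
    then show "U' k \<noteq> U' n" using tri[of k n] P(3)[of k] by auto
  qed
  have lf: "\<exists>V. openin X V \<and> y \<in> V \<and> finite {n. U' n \<inter> V \<noteq> {}}" if y: "y \<in> topspace X" for y
  proof -
    obtain V where V: "openin X V" "y \<in> V" "finite {U\<in>\<U>. U \<inter> V \<noteq> {}}"
      using U(1) y unfolding locally_finite_in_def by metis
    have "{n. U' n \<inter> V \<noteq> {}} = U' -` {U\<in>\<U>. U \<inter> V \<noteq> {}}" using P(1) by auto
    then have "finite {n. U' n \<inter> V \<noteq> {}}" using finite_vimageI[OF V(3) \<open>inj U'\<close>] by simp
    then show ?thesis using V by blast
  qed
  \<comment> \<open>The bump also vanishes on the other points of the support of \<open>w n\<close>,
    so the diagonal entry is a single nonzero coefficient and cannot cancel.\<close>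
  have "\<forall>n. \<exists>x g. x \<in> supp (w n) \<and> continuous_map X euclideanreal g \<and> g x = 1 \<and>
      (\<forall>y\<in>topspace X - U' n. g y = 0) \<and> (\<forall>y\<in>supp (w n) - {x}. g y = (0::real))"
  proof
    fix n
    obtain x where x: "x \<in> supp (w n)" "x \<in> U' n" using P(3) by blast
    have "closedin X (supp (w n) - {x})"
      using finite_supp supp_subset Hd by (intro closedin_Hausdorff_finite) auto
    then have "openin X (U' n - (supp (w n) - {x}))" using U(2)[OF P(1)] by blast
    moreover have "x \<in> U' n - (supp (w n) - {x})" using x by auto
    ultimately obtain g where g: "continuous_map X euclideanreal g" "g x = 1"
      "\<And>y. y \<in> topspace X - (U' n - (supp (w n) - {x})) \<Longrightarrow> g y = 0"
      using tychonoff_bump[OF tychonoff] by metis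
    have "g y = 0" if "y \<in> topspace X - U' n \<or> y \<in> supp (w n) - {x}" for y
      using g(3)[of y] that supp_subset by blast
    then show "\<exists>x g. x \<in> supp (w n) \<and> continuous_map X euclideanreal g \<and> g x = 1 \<and>
      (\<forall>y\<in>topspace X - U' n. g y = 0) \<and> (\<forall>y\<in>supp (w n) - {x}. g y = (0::real))"
      using x(1) g(1,2) by (intro exI[of _ x] exI[of _ g]) simp
  qed
  then obtain x g where g: "\<And>n. x n \<in> supp (w n)" "\<And>n. continuous_map X euclideanreal (g n)"
    "\<And>n. g n (x n) = (1::real)" "\<And>n y. y \<in> topspace X - U' n \<Longrightarrow> g n y = 0"
    "\<And>n y. y \<in> supp (w n) - {x n} \<Longrightarrow> g n y = 0"
    by metis
  define a where "a = (\<lambda>k n. pairing (g n) (w k))"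
  have diag: "a k k \<noteq> 0" for k
  proof -
    have "pairing (g k) (w k) = (\<Sum>y\<in>{x k}. coef (w k) y * g k y)"
      unfolding pairing_def using finite_supp g(1,5) by (intro sum.mono_neutral_right) auto
    also have "\<dots> = coef (w k) (x k)" using g(3) by simp
    also have "\<dots> \<noteq> 0" using g(1)[of k] by (simp add: supp_def)
    finally show ?thesis by (simp add: a_def)
  qed
  define c where "c = triangular_solution a"
  define h where "h = (\<lambda>y. \<Sum>n | y \<in> U' n. c n * g n y)"
  have "continuous_map X euclideanreal h"
    unfolding h_def
  proof (rule continuous_map_locally_finite_sum[OF lf])
    show "continuous_map X euclideanreal (\<lambda>y. c n * g n y)" for n
      using g(2) by (intro continuous_intros)
  qed (use g(4) in auto)
  then have "continuous_map L euclideanreal (pairing h)" by (rule continuous_pairing)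
  then have "compactin euclideanreal (pairing h ` C)" using C by (rule_tac image_compactin)
  then have "bounded (pairing h ` C)" by (simp add: compact_imp_bounded)
  then obtain B where B: "\<And>w. w \<in> C \<Longrightarrow> \<bar>pairing h w\<bar> \<le> B" by (auto simp: bounded_iff)
  have "pairing h (w k) = real k" for k
  proof -
    have "h y = (\<Sum>n\<le>k. c n * g n y)" if y: "y \<in> supp (w k)" for y
      unfolding h_def
    proof (rule sum.mono_neutral_left)
      show "{n. y \<in> U' n} \<subseteq> {..k}" using tri[of k] y by (force simp: not_le[symmetric])
      show "\<forall>n\<in>{..k} - {n. y \<in> U' n}. c n * g n y = 0" using g(4) y supp_subset by auto
    qed simp
    then have "pairing h (w k) = (\<Sum>y\<in>supp (w k). coef (w k) y * (\<Sum>n\<le>k. c n * g n y))"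
      unfolding pairing_def by (intro sum.cong) auto
    also have "\<dots> = (\<Sum>n\<le>k. c n * a k n)"
      unfolding a_def pairing_def sum_distrib_left by (subst sum.swap) (simp add: mult_ac)
    also have "\<dots> = real k" unfolding c_def by (rule triangular_solution[OF diag])
    finally show ?thesis .
  qed
  then have "real k \<le> B" for k using B[OF P(2)[of k]] by simp
  then show False by (meson not_le reals_Archimedean2)
qed

lemma compact_support:
  assumes mu: "mu_complete_space X" and C: "compactin L C"
  obtains K where "compactin X K" "\<And>w. w \<in> C \<Longrightarrow> supp w \<subseteq> K"
proof (rule that)
  show "compactin X (X closure_of (\<Union>w\<in>C. supp w))"
    using mu bounded_support[OF C] by (rule mu_complete_compactin_closure)
  have "(\<Union>w\<in>C. supp w) \<subseteq> X closure_of (\<Union>w\<in>C. supp w)"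
    using supp_subset by (intro closure_of_subset) blast
  then show "w \<in> C \<Longrightarrow> supp w \<subseteq> X closure_of (\<Union>w\<in>C. supp w)" for w by blast
qed

subsection \<open>Fans at zero\<close>

text \<open>A compact \<open>C\<close> in \<open>L\<close> has all its supports in a compact
  \<open>K\<close>. An element of \<open>H i\<close> in \<open>C\<close> forces \<open>K\<close> to
  meet both \<open>A i\<close> and \<open>B i\<close>, which happens for finitely many i. Two sets
  are used because in the applications neither condition alone is finite. The injection
  \<open>h\<close> moves the index set into \<open>omega1\<close>.\<close>

lemma hitting_compact_finite:
  assumes mu: "mu_complete_space X" and h: "inj_on h I" "h ` I \<subseteq> omega1"
    and cf: "\<And>K. compactin X K \<Longrightarrow> finite {i\<in>I. A i \<inter> K \<noteq> {} \<and> B i \<inter> K \<noteq> {}}"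
    and H: "\<And>i w. i \<in> I \<Longrightarrow> w \<in> H i \<Longrightarrow> supp w \<inter> A i \<noteq> {} \<and> supp w \<inter> B i \<noteq> {}"
  shows "omega1_compact_finite L (\<lambda>\<alpha>. if \<alpha> \<in> h ` I then H (inv_into I h \<alpha>) else {})"
  unfolding omega1_compact_finite_def
proof (intro allI impI)
  fix C assume "compactin L C"
  then obtain K where K: "compactin X K" "\<And>w. w \<in> C \<Longrightarrow> supp w \<subseteq> K" using compact_support[OF mu] by blast
  have "{\<alpha>\<in>omega1. (if \<alpha> \<in> h ` I then H (inv_into I h \<alpha>) else {}) \<inter> C \<noteq> {}} \<subseteq>
      h ` {i\<in>I. A i \<inter> K \<noteq> {} \<and> B i \<inter> K \<noteq> {}}"
  proof
    fix \<alpha> assume a: "\<alpha> \<in> {\<alpha>\<in>omega1. (if \<alpha> \<in> h ` I then H (inv_into I h \<alpha>) else {}) \<inter> C \<noteq> {}}"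
    then obtain i where i: "i \<in> I" "\<alpha> = h i" by (auto split: if_splits)
    then have "H i \<inter> C \<noteq> {}" using a h(1) by auto
    then obtain w where w: "w \<in> H i" "w \<in> C" by blast
    have "A i \<inter> K \<noteq> {} \<and> B i \<inter> K \<noteq> {}" using H[OF i(1) w(1)] K(2)[OF w(2)] by blast
    then show "\<alpha> \<in> h ` {i\<in>I. A i \<inter> K \<noteq> {} \<and> B i \<inter> K \<noteq> {}}" using i by blast
  qed
  then show "finite {\<alpha>\<in>omega1. (if \<alpha> \<in> h ` I then H (inv_into I h \<alpha>) else {}) \<inter> C \<noteq> {}}"
    by (rule finite_subset) (use cf[OF K(1)] in simp)
qed

lemma fin_fan_at_zero:
  assumes mu: "mu_complete_space X" and h: "inj_on h I" "h ` I \<subseteq> omega1"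
    and cf: "\<And>K. compactin X K \<Longrightarrow> finite {i\<in>I. A i \<inter> K \<noteq> {} \<and> B i \<inter> K \<noteq> {}}"
    and v: "\<And>i. i \<in> I \<Longrightarrow> v i \<in> topspace L"
      "\<And>i. i \<in> I \<Longrightarrow> supp (v i) \<inter> A i \<noteq> {}" "\<And>i. i \<in> I \<Longrightarrow> supp (v i) \<inter> B i \<noteq> {}"
    and nl: "\<And>V. openin L V \<Longrightarrow> 0 \<in> V \<Longrightarrow> infinite {i\<in>I. v i \<in> V}"
  shows "fin_omega1_fan L (\<lambda>\<alpha>. if \<alpha> \<in> h ` I then {v (inv_into I h \<alpha>)} else {})"
  unfolding fin_omega1_fan_def
proof (intro conjI ballI)
  show "omega1_compact_finite L (\<lambda>\<alpha>. if \<alpha> \<in> h ` I then {v (inv_into I h \<alpha>)} else {})"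
    using hitting_compact_finite[OF mu h cf, of "\<lambda>i. {v i}"] v(2,3) by simp
  show "\<not> omega1_locally_finite L (\<lambda>\<alpha>. if \<alpha> \<in> h ` I then {v (inv_into I h \<alpha>)} else {})"
    (is "\<not> omega1_locally_finite L ?F")
  proof
    assume "omega1_locally_finite L ?F"
    then obtain V where V: "openin L V" "0 \<in> V" "finite {\<alpha>\<in>omega1. ?F \<alpha> \<inter> V \<noteq> {}}"
      using subspace_0[OF subspace_L] unfolding omega1_locally_finite_def by blast
    have "h ` {i\<in>I. v i \<in> V} \<subseteq> {\<alpha>\<in>omega1. ?F \<alpha> \<inter> V \<noteq> {}}"
      using h by auto
    then have "finite (h ` {i\<in>I. v i \<in> V})" using V(3) finite_subset by blast
    moreover have "inj_on h {i\<in>I. v i \<in> V}" using h(1) by (rule inj_on_subset) auto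
    ultimately have "finite {i\<in>I. v i \<in> V}" by (simp add: finite_image_iff)
    then show False using nl[OF V(1,2)] by simp
  qed
next
  fix \<alpha>
  show "(if \<alpha> \<in> h ` I then {v (inv_into I h \<alpha>)} else {}) \<subseteq> topspace L"
    using v(1) by (auto simp: inv_into_into)
qed simp

text \<open>The neighborhoods are the sets where the product of the functionals of
  \<open>f i\<close> and \<open>g i\<close> is nonzero. They are \<real>-open as cozero sets, and
  nonvanishing of both factors makes the support meet \<open>A i\<close> and
  \<open>B i\<close>.\<close>

lemma strong_fin_fan_at_zero:
  assumes mu: "mu_complete_space X" and h: "inj_on h I" "h ` I \<subseteq> omega1"
    and cf: "\<And>K. compactin X K \<Longrightarrow> finite {i\<in>I. A i \<inter> K \<noteq> {} \<and> B i \<inter> K \<noteq> {}}"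
    and v: "\<And>i. i \<in> I \<Longrightarrow> v i \<in> topspace L"
    and f: "\<And>i. i \<in> I \<Longrightarrow> continuous_map X euclideanreal (f i)" "\<And>i x. i \<in> I \<Longrightarrow> x \<in> topspace X - A i \<Longrightarrow> f i x = 0"
      "\<And>i. i \<in> I \<Longrightarrow> pairing (f i) (v i) \<noteq> 0"
    and g: "\<And>i. i \<in> I \<Longrightarrow> continuous_map X euclideanreal (g i)" "\<And>i x. i \<in> I \<Longrightarrow> x \<in> topspace X - B i \<Longrightarrow> g i x = 0"
      "\<And>i. i \<in> I \<Longrightarrow> pairing (g i) (v i) \<noteq> 0"
    and nl: "\<And>V. openin L V \<Longrightarrow> 0 \<in> V \<Longrightarrow> infinite {i\<in>I. v i \<in> V}"
  shows "strong_fin_omega1_fan L (\<lambda>\<alpha>. if \<alpha> \<in> h ` I then {v (inv_into I h \<alpha>)} else {})"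
  unfolding strong_fin_omega1_fan_def
proof (intro conjI)
  define H where "H = (\<lambda>i. {w \<in> topspace L. pairing (f i) w * pairing (g i) w \<noteq> 0})"
  have H: "supp w \<inter> A i \<noteq> {} \<and> supp w \<inter> B i \<noteq> {}" if "i \<in> I" "w \<in> H i" for i w
  proof -
    have "pairing (f i) w \<noteq> 0" "pairing (g i) w \<noteq> 0" using that(2) by (auto simp: H_def)
    then show ?thesis using f(2) g(2) that(1) pairing_nonzero_meets by metis
  qed
  have vH: "v i \<in> H i" if "i \<in> I" for i using v f(3) g(3) that by (simp add: H_def)
  show "fin_omega1_fan L (\<lambda>\<alpha>. if \<alpha> \<in> h ` I then {v (inv_into I h \<alpha>)} else {})"
    by (rule fin_fan_at_zero[OF mu h cf v _ _ nl]) (use H vH in blast)+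
  define U where "U = (\<lambda>\<alpha>. if \<alpha> \<in> h ` I then H (inv_into I h \<alpha>) else {})"
  have Ro: "R_open_in L (H i)" if "i \<in> I" for i
    unfolding H_def using f(1) g(1) that
    by (intro R_open_in_nonzero continuous_map_real_mult continuous_pairing) auto
  have "R_open_in L (U \<alpha>) \<and> (if \<alpha> \<in> h ` I then {v (inv_into I h \<alpha>)} else {}) \<subseteq> U \<alpha>" for \<alpha>
  proof (cases "\<alpha> \<in> h ` I")
    case True
    then have "inv_into I h \<alpha> \<in> I" by (rule inv_into_into)
    then show ?thesis using Ro vH True by (simp add: U_def)
  qed (simp add: U_def R_open_in_def)
  moreover have "omega1_compact_finite L U"
    unfolding U_def by (rule hitting_compact_finite[OF mu h cf H])
  ultimately show "\<exists>U. (\<forall>\<alpha>\<in>omega1. R_open_in L (U \<alpha>) \<and>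
      (if \<alpha> \<in> h ` I then {v (inv_into I h \<alpha>)} else {}) \<subseteq> U \<alpha>) \<and> omega1_compact_finite L U"
    by (intro exI[of _ U]) simp
qed

lemma uncountable_compact_finite_fan:
  assumes mu: "mu_complete_space X"
    and x: "\<And>\<alpha>. \<alpha> \<in> omega1 \<Longrightarrow> x \<alpha> \<in> topspace X \<inter> G \<alpha>" and G: "omega1_compact_finite X G"
  shows "\<exists>F. fin_omega1_fan L F"
    and "(\<And>\<alpha>. \<alpha> \<in> omega1 \<Longrightarrow> openin X (G \<alpha>)) \<Longrightarrow> \<exists>F. strong_fin_omega1_fan L F"
proof -
  obtain P :: "(nat set \<times> nat set) set" and e :: "nat set \<Rightarrow> nat set \<Rightarrow> nat" where P: "P \<subseteq> omega1 \<times> omega1"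
    "\<And>f :: nat set \<Rightarrow> nat. infinite {(\<alpha>, \<beta>) \<in> P. f \<alpha> \<le> e \<alpha> \<beta> \<and> f \<beta> \<le> e \<alpha> \<beta>}"
    by (rule omega1_pairs_unbounded) (rule that)
  obtain h where "inj_on h (omega1 \<times> omega1)" "h ` (omega1 \<times> omega1) \<subseteq> omega1" by (rule omega1_Times_embedding)
  then have h: "inj_on h P" "h ` P \<subseteq> omega1" using P(1) inj_on_subset by blast+
  \<comment> \<open>A sum and not a difference: the points for the two indices may coincide, and
    positive coefficients cannot cancel. \<open>Suc\<close> keeps the denominator nonzero.\<close>
  define v where "v = (\<lambda>p. inverse (real (Suc (e (fst p) (snd p)))) *\<^sub>R \<delta> (x (fst p)) +
      inverse (real (Suc (e (fst p) (snd p)))) *\<^sub>R \<delta> (x (snd p)))"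
  have xP: "x (fst p) \<in> topspace X" "x (snd p) \<in> topspace X" "x (fst p) \<in> G (fst p)" "x (snd p) \<in> G (snd p)"
    "fst p \<in> omega1" "snd p \<in> omega1" if "p \<in> P" for p
    using P(1) x that by auto
  have scl: "r *\<^sub>R \<delta> (x (fst p)) \<in> topspace L" "r *\<^sub>R \<delta> (x (snd p)) \<in> topspace L" if "p \<in> P" for p r
    using subspace_L delta_in xP[OF that] by (auto intro: subspace_scale)
  have vL: "v p \<in> topspace L" if "p \<in> P" for p
    unfolding v_def using scl[OF that] subspace_L by (intro subspace_add) auto
  have pair_v: "pairing f (v p) = inverse (real (Suc (e (fst p) (snd p)))) * (f (x (fst p)) + f (x (snd p)))"
    if "continuous_map X euclideanreal f" "p \<in> P" for f p
    using that scl xP[OF that(2)] delta_in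
    by (simp add: v_def pairing_add pairing_scale pairing_operator(2) distrib_left)
  have pos: "pairing f (v p) \<noteq> 0"
    if f: "continuous_map X euclideanreal f" "\<And>y. y \<in> topspace X \<Longrightarrow> 0 \<le> f y"
      and p: "p \<in> P" and y: "y \<in> {x (fst p), x (snd p)}" "f y = 1" for f p y
  proof -
    have "0 < f (x (fst p)) + f (x (snd p))"
      using y f(2) xP[OF p] by (auto intro: add_pos_nonneg add_nonneg_pos)
    then show ?thesis using pair_v[OF f(1) p] by simp
  qed
  have in_supp: "y \<in> supp (v p)" if p: "p \<in> P" and y: "y \<in> {x (fst p), x (snd p)}" for p y
  proof (rule ccontr)
    \<comment> \<open>A nonnegative bump at y that vanishes on the finite support would pair to zero
      with \<open>v p\<close>, against \<open>pos\<close>.\<close>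
    assume n: "y \<notin> supp (v p)"
    have yX: "y \<in> topspace X" using xP[OF p] y by auto
    have "closedin X (supp (v p))"
      using tychonoff_space_imp_Hausdorff[OF tychonoff] finite_supp supp_subset
      by (intro closedin_Hausdorff_finite)
    then have "openin X (topspace X - supp (v p))" by blast
    moreover have "y \<in> topspace X - supp (v p)" using n yX by simp
    ultimately obtain f where f: "continuous_map X euclideanreal f" "f y = 1"
      "\<And>z. z \<in> topspace X \<Longrightarrow> 0 \<le> f z" "\<And>z. z \<in> topspace X - (topspace X - supp (v p)) \<Longrightarrow> f z = 0"
      using tychonoff_bump[OF tychonoff] by metis
    have "pairing f (v p) \<noteq> 0" using pos[OF f(1,3) p y f(2)] .
    then obtain z where "z \<in> supp (v p)" "f z \<noteq> 0" using pairing_nonzero by blast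
    then show False using f(4) supp_subset by blast
  qed
  have cf: "finite {p\<in>P. G (fst p) \<inter> K \<noteq> {} \<and> G (snd p) \<inter> K \<noteq> {}}" if K: "compactin X K" for K
  proof -
    have fin: "finite {\<alpha>\<in>omega1. G \<alpha> \<inter> K \<noteq> {}}" (is "finite ?Z") using G K by (simp add: omega1_compact_finite_def)
    have "{p\<in>P. G (fst p) \<inter> K \<noteq> {} \<and> G (snd p) \<inter> K \<noteq> {}} \<subseteq> ?Z \<times> ?Z"
    proof
      fix p assume p: "p \<in> {p\<in>P. G (fst p) \<inter> K \<noteq> {} \<and> G (snd p) \<inter> K \<noteq> {}}"
      then show "p \<in> ?Z \<times> ?Z" using xP[of p] by (simp add: mem_Times_iff)
    qed
    then show ?thesis using finite_subset fin by blast
  qed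
  have nl: "infinite {p\<in>P. v p \<in> V}" if V: "openin L V" "0 \<in> V" for V
  proof -
    obtain W where W: "openin L W" "0 \<in> W" "\<And>u v. u \<in> W \<Longrightarrow> v \<in> W \<Longrightarrow> u + v \<in> V"
      using lts_halve[OF lts V] by blast
    have "\<forall>\<alpha>\<in>omega1. \<exists>N. \<forall>n\<ge>N. inverse (real (Suc n)) *\<^sub>R \<delta> (x \<alpha>) \<in> W"
    proof
      fix \<alpha> assume "\<alpha> \<in> omega1"
      then have "\<delta> (x \<alpha>) \<in> topspace L" using x delta_in by blast
      then show "\<exists>N. \<forall>n\<ge>N. inverse (real (Suc n)) *\<^sub>R \<delta> (x \<alpha>) \<in> W" by (rule lts_small_multiple[OF lts W(1,2)])
    qed
    \<comment> \<open>The thresholds depend on \<alpha> without any bound. The property of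
      \<open>e\<close>, applied to this function \<open>N\<close>, yields infinitely many pairs for
      which both summands lie in \<open>W\<close>.\<close>
    then obtain N where N: "\<forall>\<alpha>\<in>omega1. \<forall>n\<ge>N \<alpha>. inverse (real (Suc n)) *\<^sub>R \<delta> (x \<alpha>) \<in> W"
      by (rule bchoice[THEN exE])
    have "{(\<alpha>, \<beta>) \<in> P. N \<alpha> \<le> e \<alpha> \<beta> \<and> N \<beta> \<le> e \<alpha> \<beta>} \<subseteq> {p\<in>P. v p \<in> V}"
    proof
      fix p assume "p \<in> {(\<alpha>, \<beta>) \<in> P. N \<alpha> \<le> e \<alpha> \<beta> \<and> N \<beta> \<le> e \<alpha> \<beta>}"
      then have p: "p \<in> P" "N (fst p) \<le> e (fst p) (snd p)" "N (snd p) \<le> e (fst p) (snd p)" by auto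
      then have "v p \<in> V" unfolding v_def using N xP(5,6)[OF p(1)] by (intro W(3)) auto
      then show "p \<in> {p\<in>P. v p \<in> V}" using p(1) by simp
    qed
    then show ?thesis using P(2)[of N] finite_subset by blast
  qed
  have "fin_omega1_fan L (\<lambda>\<alpha>. if \<alpha> \<in> h ` P then {v (inv_into P h \<alpha>)} else {})"
  proof (rule fin_fan_at_zero[OF mu h cf vL])
    show "supp (v p) \<inter> G (fst p) \<noteq> {}" "supp (v p) \<inter> G (snd p) \<noteq> {}" if "p \<in> P" for p
      using in_supp[OF that] xP(3,4)[OF that] by blast+
  qed (use nl in auto)
  then show "\<exists>F. fin_omega1_fan L F" by blast
  show "\<exists>F. strong_fin_omega1_fan L F" if G: "\<And>\<alpha>. \<alpha> \<in> omega1 \<Longrightarrow> openin X (G \<alpha>)"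
  proof -
    have "\<exists>f. continuous_map X euclideanreal f \<and> f (x \<alpha>) = 1 \<and> (\<forall>y\<in>topspace X. 0 \<le> f y) \<and>
        (\<forall>y\<in>topspace X - G \<alpha>. f y = 0)" if a: "\<alpha> \<in> omega1" for \<alpha>
    proof -
      have "x \<alpha> \<in> G \<alpha>" using x[OF a] by simp
      with G[OF a] obtain f where "continuous_map X euclideanreal f" "f (x \<alpha>) = 1"
        "\<And>y. y \<in> topspace X \<Longrightarrow> 0 \<le> f y" "\<And>y. y \<in> topspace X - G \<alpha> \<Longrightarrow> f y = 0"
        by (rule tychonoff_bump[OF tychonoff]) (rule that)
      then show ?thesis by (intro exI[of _ f]) simp
    qed
    then have "\<forall>\<alpha>\<in>omega1. \<exists>f. continuous_map X euclideanreal f \<and> f (x \<alpha>) = 1 \<and> (\<forall>y\<in>topspace X. 0 \<le> f y) \<and>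
        (\<forall>y\<in>topspace X - G \<alpha>. f y = 0)" by blast
    then obtain f where f: "\<forall>\<alpha>\<in>omega1. continuous_map X euclideanreal (f \<alpha>) \<and> f \<alpha> (x \<alpha>) = 1 \<and> (\<forall>y\<in>topspace X. 0 \<le> f \<alpha> y) \<and>
        (\<forall>y\<in>topspace X - G \<alpha>. f \<alpha> y = 0)" by (rule bchoice[THEN exE])
    have "strong_fin_omega1_fan L (\<lambda>\<alpha>. if \<alpha> \<in> h ` P then {v (inv_into P h \<alpha>)} else {})"
    proof (rule strong_fin_fan_at_zero[OF mu h cf vL, where f="\<lambda>p. f (fst p)" and g="\<lambda>p. f (snd p)"])
      show "pairing (f (fst p)) (v p) \<noteq> 0" if "p \<in> P" for p
        using f xP[OF that] by (intro pos[OF _ _ that, of _ "x (fst p)"]) auto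
      show "pairing (f (snd p)) (v p) \<noteq> 0" if "p \<in> P" for p
        using f xP[OF that] by (intro pos[OF _ _ that, of _ "x (snd p)"]) auto
    qed (use f nl xP in auto)
    then show ?thesis by blast
  qed
qed

text \<open>The index is a pair (i, m). A compact set meets \<open>E i\<close> for finitely many i,
  and for each of them \<open>W i m\<close> for finitely many m. Near 0 the vectors nevertheless
  accumulate: a neighborhood of x on which \<delta>(y) - \<delta>(x) is small contains some
  \<open>M i\<close>, so all \<open>d i m\<close> are admissible for this i, and the correction term
  tends to 0 as m grows.\<close>

lemma unbounded_sets_fan:
  fixes M :: "nat \<Rightarrow> 'x set"
  assumes mu: "mu_complete_space X" and x: "x \<in> topspace X"
    and M: "\<And>i. M i \<subseteq> topspace X" "\<And>i. \<not> bounded_in X (M i)"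
    and net: "\<And>V. openin X V \<Longrightarrow> x \<in> V \<Longrightarrow> \<exists>i. M i \<subseteq> V"
  shows "\<exists>F. strong_fin_omega1_fan L F"
proof -
  \<comment> \<open>\<open>M 0\<close> is used as some unbounded set: it supplies the auxiliary
    points \<open>d0 i\<close>, whose neighborhoods \<open>E i\<close> mark the first component of
    the index.\<close>
  obtain d0 E where E: "\<And>i::nat. openin X (E i)" "\<And>i. d0 i \<in> E i" "\<And>i. d0 i \<in> M 0" "\<And>i. E i \<inter> {x} = {}"
    "\<And>y. y \<in> topspace X \<Longrightarrow> \<exists>V. openin X V \<and> y \<in> V \<and> finite {i. E i \<inter> V \<noteq> {}}"
    by (rule unbounded_locally_finite_sequence[OF M(1)[of 0] M(2)[of 0] finite.insertI[OF finite.emptyI, of x]]) (rule that)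
  have d0X: "d0 i \<in> topspace X" for i using E(1,2) openin_subset by blast
  have "\<forall>i. \<exists>(d :: nat \<Rightarrow> 'x) W. (\<forall>m. openin X (W m)) \<and> (\<forall>m. d m \<in> W m) \<and> (\<forall>m. d m \<in> M i) \<and> (\<forall>m. W m \<inter> {x, d0 i} = {}) \<and>
      (\<forall>y\<in>topspace X. \<exists>V. openin X V \<and> y \<in> V \<and> finite {m. W m \<inter> V \<noteq> {}})"
  proof
    fix i
    have "finite {x, d0 i}" by simp
    then obtain d :: "nat \<Rightarrow> 'x" and W where "\<And>m. openin X (W m)" "\<And>m. d m \<in> W m" "\<And>m. d m \<in> M i" "\<And>m. W m \<inter> {x, d0 i} = {}"
      "\<And>y. y \<in> topspace X \<Longrightarrow> \<exists>V. openin X V \<and> y \<in> V \<and> finite {m. W m \<inter> V \<noteq> {}}"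
      by (rule unbounded_locally_finite_sequence[OF M(1)[of i] M(2)[of i]]) (rule that)
    then show "\<exists>(d :: nat \<Rightarrow> 'x) W. (\<forall>m. openin X (W m)) \<and> (\<forall>m. d m \<in> W m) \<and> (\<forall>m. d m \<in> M i) \<and> (\<forall>m. W m \<inter> {x, d0 i} = {}) \<and>
      (\<forall>y\<in>topspace X. \<exists>V. openin X V \<and> y \<in> V \<and> finite {m. W m \<inter> V \<noteq> {}})"
      by (intro exI[of _ d] exI[of _ W]) simp
  qed
  then obtain d W where dW: "\<forall>i. (\<forall>m::nat. openin X (W i m)) \<and> (\<forall>m. d i m \<in> W i m) \<and> (\<forall>m. d i m \<in> M i) \<and> (\<forall>m. W i m \<inter> {x, d0 i} = {}) \<and>
      (\<forall>y\<in>topspace X. \<exists>V. openin X V \<and> y \<in> V \<and> finite {m. W i m \<inter> V \<noteq> {}})"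
    by metis
  have dX: "d i m \<in> topspace X" for i m using dW M(1) by blast
  have "\<exists>f. continuous_map X euclideanreal f \<and> f y = 1 \<and> (\<forall>z\<in>topspace X. 0 \<le> f z) \<and> (\<forall>z\<in>topspace X - U. f z = 0)"
    if "openin X U" "y \<in> U" for U y
    by (rule tychonoff_bump[OF tychonoff that]) auto
  note bump = this
  have "\<forall>i. \<exists>f. continuous_map X euclideanreal f \<and> f (d0 i) = 1 \<and> (\<forall>z\<in>topspace X. 0 \<le> f z) \<and> (\<forall>z\<in>topspace X - E i. f z = 0)"
    using bump E(1,2) by simp
  then obtain g where g: "\<And>i. continuous_map X euclideanreal (g i)" "\<And>i. g i (d0 i) = 1"
    "\<And>i z. z \<in> topspace X \<Longrightarrow> 0 \<le> g i z" "\<And>i z. z \<in> topspace X - E i \<Longrightarrow> g i z = 0" by metis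
  have "\<forall>p. \<exists>f. continuous_map X euclideanreal f \<and> f (d (fst p) (snd p)) = 1 \<and> (\<forall>z\<in>topspace X. 0 \<le> f z) \<and>
      (\<forall>z\<in>topspace X - W (fst p) (snd p). f z = 0)"
    using bump dW by simp
  then obtain f where f: "\<And>p. continuous_map X euclideanreal (f p)" "\<And>p. f p (d (fst p) (snd p)) = 1"
    "\<And>p z. z \<in> topspace X - W (fst p) (snd p) \<Longrightarrow> f p z = 0" by metis
  define v where "v = (\<lambda>p. (\<delta> (d (fst p) (snd p)) - \<delta> x) + inverse (real (Suc (snd p))) *\<^sub>R \<delta> (d0 (fst p)))"
  have memb: "\<delta> (d i m) - \<delta> x \<in> topspace L" "r *\<^sub>R \<delta> (d0 i) \<in> topspace L" for i m r
    using subspace_L delta_in[OF dX] delta_in[OF x] delta_in[OF d0X] by (auto intro: subspace_diff subspace_scale)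
  have vL: "v p \<in> topspace L" for p unfolding v_def using memb subspace_L by (intro subspace_add) auto
  have pair_v: "pairing k (v p) = (k (d (fst p) (snd p)) - k x) + inverse (real (Suc (snd p))) * k (d0 (fst p))"
    if k: "continuous_map X euclideanreal k" for k p
  proof -
    have "pairing k (\<delta> (d i m) - \<delta> x) = k (d i m) - k x" for i m
      using k x dX delta_in by (simp add: pairing_diff pairing_operator(2))
    then show ?thesis
      using k memb d0X delta_in by (simp add: v_def pairing_add pairing_scale pairing_operator(2))
  qed
  obtain h :: "nat \<times> nat \<Rightarrow> nat set" where h: "inj h" "range h \<subseteq> omega1" by (rule nat_omega1_embedding)
  have "strong_fin_omega1_fan L (\<lambda>\<alpha>. if \<alpha> \<in> range h then {v (inv h \<alpha>)} else {})"
  proof (rule strong_fin_fan_at_zero[OF mu h, where f=f and g="\<lambda>p. g (fst p)"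
        and A="\<lambda>p. W (fst p) (snd p)" and B="\<lambda>p. E (fst p)"])
    fix K assume K: "compactin X K"
    have fE: "finite {i\<in>UNIV. E i \<inter> K \<noteq> {}}" by (rule compactin_meets_finite[OF _ K]) (use E(5) in simp)
    have fW: "finite {m\<in>UNIV. W i m \<inter> K \<noteq> {}}" for i by (rule compactin_meets_finite[OF _ K]) (use dW in simp)
    have "{p \<in> UNIV. W (fst p) (snd p) \<inter> K \<noteq> {} \<and> E (fst p) \<inter> K \<noteq> {}} =
        (SIGMA i:{i\<in>UNIV. E i \<inter> K \<noteq> {}}. {m\<in>UNIV. W i m \<inter> K \<noteq> {}})" by auto
    then show "finite {p \<in> UNIV. W (fst p) (snd p) \<inter> K \<noteq> {} \<and> E (fst p) \<inter> K \<noteq> {}}" using fE fW by simp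
  next
    fix p :: "nat \<times> nat"
    \<comment> \<open>The functional of \<open>f p\<close> sees only the term at
      \<open>d i m\<close> and takes the value 1. That of \<open>g i\<close> vanishes at x and is
      nonnegative at \<open>d i m\<close>, so its value is at least 1/(m + 1), even when
      \<open>d i m\<close> falls into \<open>E i\<close>.\<close>
    have Wn: "x \<notin> W (fst p) (snd p)" "d0 (fst p) \<notin> W (fst p) (snd p)" using dW by blast+
    then have "f p x = 0" "f p (d0 (fst p)) = 0" using f(3)[of _ p] x d0X by auto
    then show "pairing (f p) (v p) \<noteq> 0" using pair_v[OF f(1)] f(2) by simp
    have "g (fst p) x = 0" using g(4)[of x "fst p"] E(4)[of "fst p"] x by auto
    moreover have "0 \<le> g (fst p) (d (fst p) (snd p))" using g(3) dX by simp
    ultimately have "0 < pairing (g (fst p)) (v p)"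
      using pair_v[OF g(1)] g(2) by (auto intro: add_nonneg_pos)
    then show "pairing (g (fst p)) (v p) \<noteq> 0" by simp
  next
    fix V assume V: "openin L V" "0 \<in> V"
    obtain U where U: "openin L U" "0 \<in> U" "\<And>u v. u \<in> U \<Longrightarrow> v \<in> U \<Longrightarrow> u + v \<in> V"
      using lts_halve[OF lts V] by blast
    have "continuous_map X L (\<lambda>y. \<delta> y - \<delta> x)"
      using continuous_delta delta_in[OF x] by (intro continuous_map_lts_diff lts) auto
    then have "openin X {y \<in> topspace X. \<delta> y - \<delta> x \<in> U}" using U(1) by (rule openin_continuous_map_preimage)
    moreover have "x \<in> {y \<in> topspace X. \<delta> y - \<delta> x \<in> U}" using x U(2) by simp
    ultimately obtain i where i: "M i \<subseteq> {y \<in> topspace X. \<delta> y - \<delta> x \<in> U}" using net by blast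
    obtain N where N: "\<forall>n\<ge>N. inverse (real (Suc n)) *\<^sub>R \<delta> (d0 i) \<in> U"
      using lts_small_multiple[OF lts U(1,2) delta_in[OF d0X[of i]]] by blast
    have "Pair i ` {N..} \<subseteq> {p \<in> UNIV. v p \<in> V}"
    proof (rule image_subsetI)
      fix n assume "n \<in> {N..}"
      then have "inverse (real (Suc n)) *\<^sub>R \<delta> (d0 i) \<in> U" using N by simp
      moreover have "\<delta> (d i n) - \<delta> x \<in> U" using i dW by blast
      ultimately have "v (i, n) \<in> V" unfolding v_def fst_conv snd_conv by (intro U(3))
      then show "(i, n) \<in> {p \<in> UNIV. v p \<in> V}" by simp
    qed
    moreover have "infinite (Pair i ` {N..})"
      by (simp add: finite_image_iff inj_on_def infinite_Ici)
    ultimately show "infinite {p \<in> UNIV. v p \<in> V}" using finite_subset by blast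
  qed (use f g vL in auto)
  then show ?thesis by blast
qed

subsection \<open>Spaces whose free linear topological space has no fans\<close>

text \<open>The common core of the implications from absence of fans: \<open>closed_or_weak\<close>
  covers closed networks without strong fans and general networks without any fans. The two cases
  differ only in how uncountably many classes are excluded.\<close>

lemma cosmic_k_omega_of_no_fans:
  assumes mu: "mu_complete_space X" and kR: "k_R_space X"
    and N: "k_network_of X \<N>" "compact_countable_in X \<N>"
    and strong: "\<nexists>F. strong_fin_omega1_fan L F"
    and closed_or_weak: "(\<forall>N\<in>\<N>. closedin X N) \<or> (\<nexists>F. fin_omega1_fan L F)"
  shows "cosmic_space X \<and> k_omega_space X"
proof -
  have Hd: "Hausdorff_space X" using tychonoff by (rule tychonoff_space_imp_Hausdorff)
  have reg: "regular_space X" and t1: "t1_space X"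
    using tychonoff by (auto simp: tychonoff_space_def completely_regular_imp_regular_space)
  have Nsub: "N \<subseteq> topspace X" if "N \<in> \<N>" for N using N(1) that unfolding k_network_of_def by blast
  \<comment> \<open>Only countably many members meet \<open>K\<close>. If every neighborhood of x
    contained an unbounded one of them, these would be the sets of
    \<open>unbounded_sets_fan\<close>.\<close>
  have local_bd: "\<exists>V. openin X V \<and> x \<in> V \<and> (\<forall>N\<in>\<N>. N \<inter> K \<noteq> {} \<and> N \<subseteq> V \<longrightarrow> bounded_in X N)"
    if K: "compactin X K" and x: "x \<in> topspace X" for K x
  proof (rule ccontr)
    assume a: "\<not> ?thesis"
    define \<M> where "\<M> = {N\<in>\<N>. N \<inter> K \<noteq> {} \<and> \<not> bounded_in X N}"
    have "countable {N\<in>\<N>. N \<inter> K \<noteq> {}}" using N(2) K by (simp add: compact_countable_in_def)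
    then have cM: "countable \<M>" by (rule countable_subset[rotated]) (auto simp: \<M>_def)
    have net: "\<exists>M\<in>\<M>. M \<subseteq> V" if "openin X V" "x \<in> V" for V
      using a that unfolding \<M>_def by (metis (mono_tags, lifting) mem_Collect_eq)
    then have ne: "\<M> \<noteq> {}" using x by blast
    have r: "range (from_nat_into \<M>) = \<M>" using ne cM by (rule range_from_nat_into)
    have m: "from_nat_into \<M> i \<in> \<M>" for i using ne by (rule from_nat_into)
    have "\<exists>F. strong_fin_omega1_fan L F"
    proof (rule unbounded_sets_fan[OF mu x])
      show "from_nat_into \<M> i \<subseteq> topspace X" "\<not> bounded_in X (from_nat_into \<M> i)" for i
        using m[of i] Nsub by (auto simp: \<M>_def)
      show "\<exists>i. from_nat_into \<M> i \<subseteq> V" if V: "openin X V" "x \<in> V" for V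
      proof -
        obtain M where "M \<in> \<M>" "M \<subseteq> V" using net[OF V] by blast
        then show ?thesis using r by (metis rangeE)
      qed
    qed
    then show False using strong by simp
  qed
  \<comment> \<open>Nonempty members only, so that every class later contributes a point.\<close>
  define \<B> where "\<B> = {N\<in>\<N>. N \<noteq> {} \<and> bounded_in X N}"
  have B: "\<exists>\<F>. finite \<F> \<and> \<F> \<subseteq> \<B> \<and> K \<subseteq> \<Union>\<F> \<and> \<Union>\<F> \<subseteq> U" if U: "openin X U" and K: "compactin X K" "K \<subseteq> U" for U K
  proof -
    have Ks: "K \<subseteq> topspace X" using K(1) by (rule compactin_subset_topspace)
    define P where "P = (\<lambda>x (G, C, V). openin X G \<and> x \<in> G \<and> closedin X C \<and> G \<subseteq> C \<and>
      openin X V \<and> C \<subseteq> V \<and> V \<subseteq> U \<and> (\<forall>N\<in>\<N>. N \<inter> K \<noteq> {} \<and> N \<subseteq> V \<longrightarrow> bounded_in X N))"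
    have "\<forall>x\<in>K. \<exists>p. P x p"
    proof
      fix x assume x: "x \<in> K"
      then obtain V where V: "openin X V" "x \<in> V" "\<forall>N\<in>\<N>. N \<inter> K \<noteq> {} \<and> N \<subseteq> V \<longrightarrow> bounded_in X N"
        using local_bd[OF K(1)] Ks by blast
      have "openin X (V \<inter> U)" "x \<in> V \<inter> U" using V U x K(2) by auto
      then obtain G C where "openin X G" "closedin X C" "x \<in> G" "G \<subseteq> C" "C \<subseteq> V \<inter> U"
        by (rule regular_space_closed_neighbourhood[OF reg])
      then have "P x (G, C, V \<inter> U)" using V U by (simp add: P_def openin_Int)
      then show "\<exists>p. P x p" by (rule exI[of _ "(G, C, V \<inter> U)"])
    qed
    then obtain p where p: "\<forall>x\<in>K. P x (p x)" by (rule bchoice[THEN exE])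
    define G where "G = (\<lambda>x. fst (p x))"
    define C where "C = (\<lambda>x. fst (snd (p x)))"
    define V where "V = (\<lambda>x. snd (snd (p x)))"
    have GC: "openin X (G x)" "x \<in> G x" "closedin X (C x)" "G x \<subseteq> C x" and V: "openin X (V x)" "C x \<subseteq> V x" "V x \<subseteq> U"
      "\<And>N. N \<in> \<N> \<Longrightarrow> N \<inter> K \<noteq> {} \<Longrightarrow> N \<subseteq> V x \<Longrightarrow> bounded_in X N" if "x \<in> K" for x
      using p that by (auto simp: P_def G_def C_def V_def split_def)
    have "K \<subseteq> \<Union>(G ` K)" using GC(2) by blast
    then obtain J where J: "finite J" "J \<subseteq> K" "K \<subseteq> \<Union>(G ` J)"
      by (rule compactin_finite_subcover[OF K(1), rotated]) (use GC(1) in auto)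
    have "\<forall>j\<in>J. \<exists>\<F>. finite \<F> \<and> \<F> \<subseteq> \<N> \<and> K \<inter> C j \<subseteq> \<Union>\<F> \<and> \<Union>\<F> \<subseteq> V j"
    proof
      fix j assume "j \<in> J"
      then have j: "j \<in> K" using J(2) by blast
      have "compactin X (K \<inter> C j)" using K(1) GC(3)[OF j] by (rule compact_Int_closedin)
      moreover have "K \<inter> C j \<subseteq> V j" using V(2)[OF j] by blast
      ultimately show "\<exists>\<F>. finite \<F> \<and> \<F> \<subseteq> \<N> \<and> K \<inter> C j \<subseteq> \<Union>\<F> \<and> \<Union>\<F> \<subseteq> V j"
        using N(1) V(1)[OF j] unfolding k_network_of_def by simp
    qed
    then obtain F where F: "\<forall>j\<in>J. finite (F j) \<and> F j \<subseteq> \<N> \<and> K \<inter> C j \<subseteq> \<Union>(F j) \<and> \<Union>(F j) \<subseteq> V j"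
      by (rule bchoice[THEN exE])
    define F' where "F' = (\<Union>j\<in>J. {N\<in>F j. N \<inter> K \<noteq> {}})"
    have "finite F'" unfolding F'_def using J(1) F by simp
    moreover have "F' \<subseteq> \<B>"
    proof
      fix N assume "N \<in> F'"
      then obtain j where j: "j \<in> J" "N \<in> F j" "N \<inter> K \<noteq> {}" by (auto simp: F'_def)
      then have "N \<in> \<N>" "N \<subseteq> V j" using F by blast+
      then show "N \<in> \<B>" using V(4)[of j N] j J(2) by (auto simp: \<B>_def)
    qed
    moreover have "K \<subseteq> \<Union>F'"
    proof
      fix y assume y: "y \<in> K"
      then obtain j where j: "j \<in> J" "y \<in> G j" using J(3) by blast
      then have "y \<in> K \<inter> C j" using GC(4)[of j] J(2) y by blast
      then obtain N where "N \<in> F j" "y \<in> N" using F j by blast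
      then show "y \<in> \<Union>F'" using j(1) y by (auto simp: F'_def)
    qed
    moreover have "\<Union>F' \<subseteq> U"
    proof
      fix y assume "y \<in> \<Union>F'"
      then obtain j N where "j \<in> J" "N \<in> F j" "y \<in> N" by (auto simp: F'_def)
      then show "y \<in> U" using F V(3)[of j] J(2) by blast
    qed
    ultimately show ?thesis by blast
  qed
  have B_sub: "N \<subseteq> topspace X" "N \<noteq> {}" "compactin X (X closure_of N)" if "N \<in> \<B>" for N
    using that Nsub mu_complete_compactin_closure[OF mu] by (auto simp: \<B>_def)
  have cover: "\<exists>\<F>. finite \<F> \<and> \<F> \<subseteq> \<B> \<and> K \<subseteq> \<Union>\<F>" if "compactin X K" for K
    using B[OF openin_topspace that compactin_subset_topspace[OF that]] by (elim exE conjE) (intro exI conjI)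
  define R where "R = {(N, M). N \<in> \<B> \<and> M \<in> \<B> \<and> N \<inter> M \<noteq> {}}"
  \<comment> \<open>A member that intersects \<open>M\<close> meets the closure of \<open>M\<close>,
    which is compact by \<mu>-completeness; compact-countability bounds the number of
    neighbors.\<close>
  have cR: "countable (R `` {M})" for M
  proof (cases "M \<in> \<B>")
    case True
    then have "countable {N\<in>\<N>. N \<inter> (X closure_of M) \<noteq> {}}"
      using N(2) B_sub(3)[of M] unfolding compact_countable_in_def by simp
    moreover have "R `` {M} \<subseteq> {N\<in>\<N>. N \<inter> (X closure_of M) \<noteq> {}}"
      using closure_of_subset[OF B_sub(1)[OF True]] by (auto simp: R_def \<B>_def)
    ultimately show ?thesis by (rule countable_subset[rotated])
  qed (auto simp: R_def)
  have "countable (R `` Y)" if "countable Y" for Y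
    unfolding Image_eq_UN[of R Y] using that cR by (rule countable_UN)
  then have ccls: "countable (R\<^sup>* `` {M})" for M by (rule countable_rtrancl) simp_all
  define cls where "cls = (\<lambda>N. R\<^sup>* `` {N})"
  have symR: "sym (R\<^sup>*)" by (rule sym_rtrancl) (auto simp: sym_def R_def)
  have cls_eq: "cls M = cls N" if "M \<in> cls N" for M N
    using that symR unfolding cls_def by (auto dest: symD intro: rtrancl_trans)
  have cls_B: "cls N \<subseteq> \<B>" if "N \<in> \<B>" for N
  proof
    fix M assume "M \<in> cls N"
    then have "(N, M) \<in> R\<^sup>*" by (simp add: cls_def)
    then show "M \<in> \<B>" by (cases rule: rtranclE) (use that in \<open>auto simp: R_def\<close>)
  qed
  have self: "N \<in> cls N" for N by (simp add: cls_def)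
  have meets: "N \<in> cls N0" if "N0 \<in> \<B>" "M \<in> cls N0" "N \<in> \<B>" "z \<in> M" "z \<in> N" for N N0 M z
  proof -
    have "(M, N) \<in> R" using that cls_B by (auto simp: R_def)
    then show ?thesis using that(2) by (auto simp: cls_def)
  qed
  \<comment> \<open>A class whose union meets \<open>K\<close> shares a point with one of the
    finitely many members covering \<open>K\<close>, and therefore is the class of that
    member.\<close>
  have fin: "finite {q\<in>cls ` \<B>. \<Union>q \<inter> K \<noteq> {}}" if K: "compactin X K" for K
  proof -
    obtain \<F> where F: "finite \<F>" "\<F> \<subseteq> \<B>" "K \<subseteq> \<Union>\<F>" using cover[OF K] by blast
    have "{q\<in>cls ` \<B>. \<Union>q \<inter> K \<noteq> {}} \<subseteq> cls ` \<F>"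
    proof
      fix q assume q: "q \<in> {q\<in>cls ` \<B>. \<Union>q \<inter> K \<noteq> {}}"
      then obtain N0 where N0: "N0 \<in> \<B>" "q = cls N0" by blast
      from q obtain z where z: "z \<in> \<Union>q" "z \<in> K" by blast
      then obtain M where M: "M \<in> q" "z \<in> M" by blast
      obtain N where "N \<in> \<F>" "z \<in> N" using z F(3) by blast
      then have "N \<in> cls N0" using meets[OF N0(1)] M N0(2) F(2) by blast
      then show "q \<in> cls ` \<F>" using cls_eq N0(2) \<open>N \<in> \<F>\<close> by blast
    qed
    then show ?thesis by (rule finite_subset) (use F(1) in simp)
  qed
  have q_open: "openin X (\<Union>(cls N0))" if cl: "\<forall>N\<in>\<N>. closedin X N" and N0: "N0 \<in> \<B>" for N0
  proof -
    define f where "f = (\<lambda>y. if y \<in> \<Union>(cls N0) then 1 else (0::real))"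
    have "continuous_map (subtopology X K) euclideanreal f" if K: "compactin X K" for K
    proof -
      obtain \<F> where F: "finite \<F>" "\<F> \<subseteq> \<B>" "K \<subseteq> \<Union>\<F>" using cover[OF K] by blast
      \<comment> \<open>The finitely many closed members covering \<open>K\<close> split into those
        inside and those outside the class. This gives two disjoint relatively closed sets covering
        \<open>K\<close>, on each of which the indicator function \<open>f\<close> is
        constant.\<close>
      define T where "T = (\<lambda>b. K \<inter> \<Union>{N\<in>\<F>. (N \<in> cls N0) = b})"
      have fT: "f y = (if b then 1 else 0)" if y: "y \<in> T b" for y b
      proof -
        obtain N where N: "N \<in> \<F>" "(N \<in> cls N0) = b" "y \<in> N" using y by (auto simp: T_def)
        have "y \<in> \<Union>(cls N0) \<longleftrightarrow> b"
        proof
          assume "y \<in> \<Union>(cls N0)"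
          then obtain M where "M \<in> cls N0" "y \<in> M" by blast
          then show b using meets[OF N0, of M N y] N F(2) by blast
        qed (use N in blast)
        then show ?thesis by (simp add: f_def)
      qed
      show ?thesis
      proof (rule pasting_lemma_closed[of UNIV _ T _ "\<lambda>b _. if b then 1 else 0"])
        show "closedin (subtopology X K) (T b)" for b
        proof -
          have "closedin X (\<Union>{N\<in>\<F>. (N \<in> cls N0) = b})"
            using F cl by (intro closedin_Union) (auto simp: \<B>_def)
          then show ?thesis unfolding T_def by (auto simp: closedin_subtopology)
        qed
        show "\<exists>j. j \<in> UNIV \<and> y \<in> T j \<and> f y = (if j then 1 else 0)" if "y \<in> topspace (subtopology X K)" for y
        proof -
          have "y \<in> K" using that by simp
          then obtain N where "N \<in> \<F>" "y \<in> N" using F(3) by blast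
          with \<open>y \<in> K\<close> have "y \<in> T (N \<in> cls N0)" by (auto simp: T_def)
          then show ?thesis using fT by blast
        qed
        show "(if i then 1 else 0) = (if j then 1 else (0::real))" if "y \<in> topspace (subtopology X K) \<inter> T i \<inter> T j" for i j y
          using fT[of y i] fT[of y j] that by simp
      qed auto
    qed
    then have "continuous_map X euclideanreal f" using kR unfolding k_R_space_def by blast
    then have "openin X {y \<in> topspace X. f y \<in> {0<..}}" by (rule openin_continuous_map_preimage) simp
    moreover have "\<Union>(cls N0) \<subseteq> topspace X" using cls_B[OF N0] B_sub(1) by blast
    then have "{y \<in> topspace X. f y \<in> {0<..}} = \<Union>(cls N0)" by (auto simp: f_def)
    ultimately show ?thesis by simp
  qed
  have "countable (cls ` \<B>)"
  proof (rule ccontr)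
    assume "uncountable (cls ` \<B>)"
    then obtain e where e: "inj_on e omega1" "e ` omega1 \<subseteq> cls ` \<B>" by (rule uncountable_omega1_embedding)
    have "\<forall>\<alpha>\<in>omega1. \<exists>x. x \<in> topspace X \<inter> \<Union>(e \<alpha>)"
    proof
      fix \<alpha> assume "\<alpha> \<in> omega1"
      then obtain N where N: "N \<in> \<B>" "e \<alpha> = cls N" using e(2) by blast
      obtain y where "y \<in> N" using B_sub(2)[OF N(1)] by blast
      then show "\<exists>x. x \<in> topspace X \<inter> \<Union>(e \<alpha>)"
        using N B_sub(1) self[of N] by (intro exI[of _ y]) blast
    qed
    then obtain x where x: "\<forall>\<alpha>\<in>omega1. x \<alpha> \<in> topspace X \<inter> \<Union>(e \<alpha>)" by (rule bchoice[THEN exE])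
    have G: "omega1_compact_finite X (\<lambda>\<alpha>. \<Union>(e \<alpha>))"
      unfolding omega1_compact_finite_def
    proof (intro allI impI)
      fix K assume K: "compactin X K"
      have "e ` {\<alpha>\<in>omega1. \<Union>(e \<alpha>) \<inter> K \<noteq> {}} \<subseteq> {q\<in>cls ` \<B>. \<Union>q \<inter> K \<noteq> {}}" using e(2) by blast
      then have "finite (e ` {\<alpha>\<in>omega1. \<Union>(e \<alpha>) \<inter> K \<noteq> {}})" using fin[OF K] by (rule finite_subset)
      moreover have "inj_on e {\<alpha>\<in>omega1. \<Union>(e \<alpha>) \<inter> K \<noteq> {}}" using e(1) by (rule inj_on_subset) auto
      ultimately show "finite {\<alpha>\<in>omega1. \<Union>(e \<alpha>) \<inter> K \<noteq> {}}" by (simp add: finite_image_iff)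
    qed
    show False
    proof (cases "\<forall>N\<in>\<N>. closedin X N")
      case True
      have "\<exists>F. strong_fin_omega1_fan L F"
      proof (rule uncountable_compact_finite_fan(2)[OF mu _ G])
        show "x \<alpha> \<in> topspace X \<inter> \<Union>(e \<alpha>)" if "\<alpha> \<in> omega1" for \<alpha> using x that by simp
        show "openin X (\<Union>(e \<alpha>))" if a: "\<alpha> \<in> omega1" for \<alpha>
        proof -
          obtain N0 where "N0 \<in> \<B>" "e \<alpha> = cls N0" using e(2) a by blast
          then show ?thesis using q_open[OF True] by simp
        qed
      qed
      then show False using strong by simp
    next
      case False
      have "\<exists>F. fin_omega1_fan L F"
        by (rule uncountable_compact_finite_fan(1)[OF mu _ G, of x]) (use x in simp)
      then show False using False closed_or_weak by simp
    qed
  qed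
  then have "countable (\<Union>q\<in>cls ` \<B>. q)" by (rule countable_UN) (use ccls in \<open>auto simp: cls_def\<close>)
  moreover have "\<B> \<subseteq> (\<Union>q\<in>cls ` \<B>. q)" using self by blast
  ultimately have cB: "countable \<B>" by (rule countable_subset[rotated])
  have "network_of X \<B>" unfolding network_of_def
  proof (intro conjI allI impI)
    show "\<B> \<subseteq> Pow (topspace X)" using B_sub(1) by blast
    fix y U assume U: "openin X U \<and> y \<in> U"
    then have "compactin X {y}" using openin_subset by fastforce
    then have "\<exists>\<F>. finite \<F> \<and> \<F> \<subseteq> \<B> \<and> {y} \<subseteq> \<Union>\<F> \<and> \<Union>\<F> \<subseteq> U" using U by (intro B) auto
    then obtain \<F> where F: "\<F> \<subseteq> \<B>" "{y} \<subseteq> \<Union>\<F>" "\<Union>\<F> \<subseteq> U" by (elim exE conjE)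
    then obtain N where "N \<in> \<F>" "y \<in> N" by blast
    then show "\<exists>N\<in>\<B>. y \<in> N \<and> N \<subseteq> U" using F by blast
  qed
  then have cosmic: "cosmic_space X" using cB reg t1 unfolding cosmic_space_def by blast
  define g where "g = from_nat_into (insert {} \<B>)"
  have g: "range g = insert {} \<B>" unfolding g_def by (rule range_from_nat_into) (use cB in auto)
  \<comment> \<open>Each compact set is covered by finitely many members of \<B>, so these finite
    unions of compact closures witness hemicompactness.\<close>
  define K where "K = (\<lambda>n. \<Union>i\<le>n. X closure_of (g i))"
  have "compactin X (X closure_of (g i))" for i
  proof -
    have "g i \<in> insert {} \<B>" using g by blast
    then show ?thesis using B_sub(3) by auto
  qed
  then have Kc: "compactin X (K n)" for n unfolding K_def by (intro compactin_Union) auto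
  have Kinc: "incseq K" unfolding K_def by (intro monoI UN_mono) auto
  have "\<exists>n. C \<subseteq> K n" if C: "compactin X C" for C
  proof -
    obtain \<F> where F: "finite \<F>" "\<F> \<subseteq> \<B>" "C \<subseteq> \<Union>\<F>" using cover[OF C] by blast
    then have "\<F> \<subseteq> range g" using g by blast
    then obtain I where I: "finite I" "\<F> = g ` I" using F(1) by (meson finite_subset_image)
    define b where "b = Max (insert 0 I)"
    have b: "i \<le> b" if "i \<in> I" for i using I(1) that by (simp add: b_def)
    have "C \<subseteq> K b"
    proof
      fix y assume "y \<in> C"
      then obtain i where i: "i \<in> I" "y \<in> g i" using F(3) I(2) by blast
      then have "g i \<in> \<B>" using I(2) F(2) by blast
      then have "y \<in> X closure_of (g i)" using i(2) closure_of_subset[OF B_sub(1)] by blast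
      then show "y \<in> K b" using b[OF i(1)] by (auto simp: K_def)
    qed
    then show ?thesis ..
  qed
  then have "k_omega_sequence X K" by (rule hemicompact_k_R_imp_k_omega[OF tychonoff kR Kc Kinc])
  then show ?thesis using cosmic k_omega_space_iff_sequence by blast
qed

section \<open>The closed embedding of \<open>X\<close> into \<open>L\<close>\<close>

lemma delta_open_trace:
  assumes "openin X U" "x \<in> U"
  obtains V where "openin L V" "\<delta> x \<in> V" "\<And>y. y \<in> topspace X \<Longrightarrow> \<delta> y \<in> V \<Longrightarrow> y \<in> U"
proof -
  obtain f where f: "continuous_map X euclideanreal f" "f x = 1" "\<And>y. y \<in> topspace X - U \<Longrightarrow> f y = 0"
    using tychonoff_bump[OF tychonoff assms] by metis
  have xX: "x \<in> topspace X" using assms openin_subset by blast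
  have "openin L {w \<in> topspace L. pairing f w \<in> - {0}}"
    using continuous_pairing[OF f(1)] by (rule openin_continuous_map_preimage) auto
  then show thesis
  proof (rule that)
    show "\<delta> x \<in> {w \<in> topspace L. pairing f w \<in> - {0}}"
      using f xX by (simp add: delta_in pairing_operator(2))
    show "y \<in> U" if "y \<in> topspace X" "\<delta> y \<in> {w \<in> topspace L. pairing f w \<in> - {0}}" for y
      using that f(3)[of y] pairing_operator(2)[OF f(1)] by auto
  qed
qed

text \<open>If the support of w has two points, bumps with disjoint carriers give two functionals
  whose product vanishes on \<delta>(X) but not at w. Otherwise w is a multiple of some \<delta>(x)
  or 0, and the functional of the constant function 1, which equals 1 on \<delta>(X), has a
  different value at w.\<close>

lemma closed_delta_image: "closedin L (\<delta> ` topspace X)"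
proof -
  have Hd: "Hausdorff_space X" using tychonoff by (rule tychonoff_space_imp_Hausdorff)
  have "\<exists>T. openin L T \<and> w \<in> T \<and> T \<subseteq> topspace L - \<delta> ` topspace X" if w: "w \<in> topspace L - \<delta> ` topspace X" for w
  proof (cases "\<exists>x y. x \<in> supp w \<and> y \<in> supp w \<and> x \<noteq> y")
    case True
    then obtain x y where xy: "x \<in> supp w" "y \<in> supp w" "x \<noteq> y" by blast
    then obtain U V where UV: "openin X U" "openin X V" "x \<in> U" "y \<in> V" "disjnt U V"
      using Hd supp_subset unfolding Hausdorff_space_def by (metis subsetD)
    have bump: "\<exists>f. continuous_map X euclideanreal f \<and> pairing f w \<noteq> 0 \<and> (\<forall>z\<in>topspace X - U. f z = 0)"
      if U: "openin X U" and x: "x \<in> U" "x \<in> supp w" for U x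
    proof -
      have "closedin X (supp w - {x})"
        using finite_supp supp_subset Hd by (intro closedin_Hausdorff_finite) auto
      then have "openin X (U - (supp w - {x}))" using U by blast
      moreover have "x \<in> U - (supp w - {x})" using x by auto
      ultimately obtain f where f: "continuous_map X euclideanreal f" "f x = 1"
        "\<And>z. z \<in> topspace X - (U - (supp w - {x})) \<Longrightarrow> f z = 0"
        using tychonoff_bump[OF tychonoff] by metis
      have "pairing f w = (\<Sum>z\<in>{x}. coef w z * f z)"
        unfolding pairing_def using finite_supp x f(3) supp_subset by (intro sum.mono_neutral_right) auto
      also have "\<dots> \<noteq> 0" using f(2) x(2) by (simp add: supp_def)
      finally show ?thesis using f(1,3) by (intro exI[of _ f]) simp
    qed
    obtain f where f: "continuous_map X euclideanreal f" "pairing f w \<noteq> 0" "\<And>z. z \<in> topspace X - U \<Longrightarrow> f z = 0"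
      using bump[OF UV(1,3) xy(1)] by blast
    obtain g where g: "continuous_map X euclideanreal g" "pairing g w \<noteq> 0" "\<And>z. z \<in> topspace X - V \<Longrightarrow> g z = 0"
      using bump[OF UV(2,4) xy(2)] by blast
    have "continuous_map L euclideanreal (\<lambda>w. pairing f w * pairing g w)"
      using f g by (intro continuous_map_real_mult continuous_pairing)
    then have "openin L {w \<in> topspace L. pairing f w * pairing g w \<in> - {0}}"
      by (rule openin_continuous_map_preimage) auto
    moreover have "pairing f (\<delta> z) * pairing g (\<delta> z) = 0" if z: "z \<in> topspace X" for z
    proof -
      have "z \<notin> U \<or> z \<notin> V" using UV(5) by (auto simp: disjnt_iff)
      then show ?thesis using f(1,3) g(1,3) z by (auto simp: pairing_operator(2))
    qed
    ultimately show ?thesis using f g w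
      by (intro exI[of _ "{w \<in> topspace L. pairing f w * pairing g w \<in> - {0}}"]) auto
  next
    case False
    have "pairing (\<lambda>_. 1) w \<noteq> 1"
    proof
      assume p: "pairing (\<lambda>_. 1) w = 1"
      then obtain x where x: "x \<in> supp w" using pairing_nonzero[of "\<lambda>_. 1" w] by auto
      then have "supp w = {x}" using False by blast
      then have "coef w x = 1" using p by (simp add: pairing_def)
      then have "w = \<delta> x" using expansion[of w] w \<open>supp w = {x}\<close> by simp
      then show False using w x supp_subset by blast
    qed
    moreover have "openin L {w \<in> topspace L. pairing (\<lambda>_. 1) w \<in> - {1}}"
      by (rule openin_continuous_map_preimage[OF continuous_pairing]) auto
    moreover have "pairing (\<lambda>_. 1) (\<delta> z) = 1" if "z \<in> topspace X" for z
      using that by (simp add: pairing_operator(2))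
    ultimately show ?thesis using w
      by (intro exI[of _ "{w \<in> topspace L. pairing (\<lambda>_. 1) w \<in> - {1}}"]) auto
  qed
  then have "openin L (topspace L - \<delta> ` topspace X)" by (subst openin_subopen) blast
  moreover have "\<delta> ` topspace X \<subseteq> topspace L" using delta_in by blast
  ultimately show ?thesis by (simp add: closedin_def)
qed

lemma compactin_delta_preimage:
  assumes C: "compactin L C" shows "compactin X {x \<in> topspace X. \<delta> x \<in> C}"
  unfolding compactin_def
proof (intro conjI allI impI)
  let ?P = "{x \<in> topspace X. \<delta> x \<in> C}"
  fix \<U> assume U: "(\<forall>U\<in>\<U>. openin X U) \<and> ?P \<subseteq> \<Union>\<U>"
  have "\<forall>x\<in>?P. \<exists>U V. U \<in> \<U> \<and> openin L V \<and> \<delta> x \<in> V \<and> (\<forall>y\<in>topspace X. \<delta> y \<in> V \<longrightarrow> y \<in> U)"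
  proof
    fix x assume "x \<in> ?P"
    then obtain U' where U': "U' \<in> \<U>" "x \<in> U'" using U by blast
    then have "openin X U'" using U by simp
    then obtain V where "openin L V" "\<delta> x \<in> V" "\<And>y. y \<in> topspace X \<Longrightarrow> \<delta> y \<in> V \<Longrightarrow> y \<in> U'"
      using delta_open_trace U'(2) by metis
    then show "\<exists>U V. U \<in> \<U> \<and> openin L V \<and> \<delta> x \<in> V \<and> (\<forall>y\<in>topspace X. \<delta> y \<in> V \<longrightarrow> y \<in> U)"
      using U'(1) by (intro exI[of _ U'] exI[of _ V]) simp
  qed
  then obtain W V where WV: "\<forall>x\<in>?P. W x \<in> \<U> \<and> openin L (V x) \<and> \<delta> x \<in> V x \<and> (\<forall>y\<in>topspace X. \<delta> y \<in> V x \<longrightarrow> y \<in> W x)"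
    by metis
  have D: "compactin L (C \<inter> \<delta> ` topspace X)" using C closed_delta_image by (rule compact_Int_closedin)
  have "C \<inter> \<delta> ` topspace X \<subseteq> \<Union>(V ` ?P)" using WV by auto
  then obtain J where J: "finite J" "J \<subseteq> ?P" "C \<inter> \<delta> ` topspace X \<subseteq> \<Union>(V ` J)"
    by (rule compactin_finite_subcover[OF D, rotated]) (use WV in auto)
  have "?P \<subseteq> \<Union>(W ` J)"
  proof
    fix z assume z: "z \<in> ?P"
    then have "\<delta> z \<in> C \<inter> \<delta> ` topspace X" by blast
    then obtain j where "j \<in> J" "\<delta> z \<in> V j" using J(3) by blast
    moreover have "j \<in> ?P" using J(2) \<open>j \<in> J\<close> by blast
    ultimately have "z \<in> W j" using WV z by blast
    then show "z \<in> \<Union>(W ` J)" using \<open>j \<in> J\<close> by blast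
  qed
  moreover have "W ` J \<subseteq> \<U>" using WV J(2) by blast
  ultimately show "\<exists>\<F>. finite \<F> \<and> \<F> \<subseteq> \<U> \<and> ?P \<subseteq> \<Union>\<F>" using J(1) by (intro exI[of _ "W ` J"]) simp
qed auto

lemma cosmic_k_omega_from_free:
  assumes c: "cosmic_space L" and k: "k_omega_space L"
  shows "cosmic_space X \<and> k_omega_space X"
proof
  have HL: "Hausdorff_space L" using lts by (simp add: lin_top_space_def)
  have inj: "inj_on \<delta> (topspace X)" by (rule free_lin_top_space_independent(1)[OF tychonoff free])
  obtain N where N: "countable N" "network_of L N" using c by (auto simp: cosmic_space_def)
  have "network_of X ((\<lambda>M. {x \<in> topspace X. \<delta> x \<in> M}) ` N)"
    unfolding network_of_def
  proof (intro conjI allI impI)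
    fix y U assume U: "openin X U \<and> y \<in> U"
    then obtain V where V: "openin L V" "\<delta> y \<in> V" "\<And>y. y \<in> topspace X \<Longrightarrow> \<delta> y \<in> V \<Longrightarrow> y \<in> U"
      using delta_open_trace by metis
    then obtain M where M: "M \<in> N" "\<delta> y \<in> M" "M \<subseteq> V" using N(2) unfolding network_of_def by metis
    have "y \<in> topspace X" using U openin_subset by blast
    then have "y \<in> {x \<in> topspace X. \<delta> x \<in> M}" "{x \<in> topspace X. \<delta> x \<in> M} \<subseteq> U" using M V by auto
    then show "\<exists>N\<in>(\<lambda>M. {x \<in> topspace X. \<delta> x \<in> M}) ` N. y \<in> N \<and> N \<subseteq> U" using M(1) by blast
  qed auto
  then show "cosmic_space X"
    using N(1) tychonoff unfolding cosmic_space_def tychonoff_space_def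
    by (meson completely_regular_imp_regular_space countable_image)
  obtain C where C: "k_omega_sequence L C" using k k_omega_space_iff_sequence by blast
  define K where "K = (\<lambda>n. {x \<in> topspace X. \<delta> x \<in> C n})"
  have Kc: "compactin X (K n)" for n
    unfolding K_def using C by (intro compactin_delta_preimage) (simp add: k_omega_sequence_def)
  have "k_omega_sequence X K" unfolding k_omega_sequence_def
  proof (intro conjI allI impI Kc)
    show "incseq K" using C unfolding k_omega_sequence_def K_def incseq_def by blast
    have "topspace X \<subseteq> \<Union>(range K)"
    proof
      fix x assume x: "x \<in> topspace X"
      then have "\<delta> x \<in> \<Union>(range C)" using C delta_in by (simp add: k_omega_sequence_def)
      then show "x \<in> \<Union>(range K)" using x by (auto simp: K_def)
    qed
    then show "\<Union>(range K) = topspace X" by (auto simp: K_def)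
    fix F assume F: "F \<subseteq> topspace X" "\<forall>n. closedin (subtopology X (K n)) (F \<inter> K n)"
    \<comment> \<open>A closed trace of F on the compact set \<open>K n\<close> is compact; so is
      its image, which is therefore closed in the Hausdorff space \<open>L\<close>.\<close>
    have "closedin (subtopology L (C n)) (\<delta> ` F \<inter> C n)" for n
    proof -
      have "compactin (subtopology X (K n)) (F \<inter> K n)"
        using F(2) Kc by (intro closedin_compact_space) (auto simp: compactin_subspace)
      then have "compactin X (F \<inter> K n)" by (simp add: compactin_subtopology)
      then have "compactin L (\<delta> ` (F \<inter> K n))" using continuous_delta by (rule image_compactin)
      moreover have "\<delta> ` (F \<inter> K n) = \<delta> ` F \<inter> C n" using F(1) by (auto simp: K_def)
      ultimately have "closedin L (\<delta> ` F \<inter> C n)" using HL compactin_imp_closedin by metis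
      then show ?thesis by (intro closedin_subset_topspace) auto
    qed
    moreover have "\<delta> ` F \<subseteq> topspace L" using F(1) delta_in by blast
    ultimately have "closedin L (\<delta> ` F)" using C unfolding k_omega_sequence_def by simp
    then have "closedin X {x \<in> topspace X. \<delta> x \<in> \<delta> ` F}"
      using continuous_delta by (intro closedin_continuous_map_preimage)
    moreover have "{x \<in> topspace X. \<delta> x \<in> \<delta> ` F} = F"
      using F(1) inj by (auto simp: inj_on_def)
    ultimately show "closedin X F" by simp
  qed
  then show "k_omega_space X" using k_omega_space_iff_sequence by blast
qed

end

section \<open>The free linear topological space of a cosmic \<open>k\<^sub>\<omega>\<close>-space\<close>

text \<open>\<open>U\<close> is not assumed open in \<open>Y\<close>: since f maps \<open>B\<close>
  into \<open>C\<close>, only the trace on \<open>C\<close> matters. This serves for sets open in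
  the inductive limit topology before it is known to be the topology of \<open>L\<close>.\<close>

lemma openin_preimage_from_trace:
  assumes U: "openin (subtopology Y C) (U \<inter> C)" and f: "continuous_map (subtopology Z B) Y f"
    and B: "f ` B \<subseteq> C" "B \<subseteq> topspace Z"
  shows "openin (subtopology Z B) {z \<in> B. f z \<in> U}"
proof -
  obtain O' where O': "openin Y O'" "U \<inter> C = O' \<inter> C" using U by (metis openin_subtopology)
  have "openin (subtopology Z B) {z \<in> topspace (subtopology Z B). f z \<in> O'}"
    using f O'(1) by (rule openin_continuous_map_preimage)
  moreover have "{z \<in> topspace (subtopology Z B). f z \<in> O'} = {z \<in> B. f z \<in> U}"
  proof -
    have "f z \<in> O' \<longleftrightarrow> f z \<in> U" if "z \<in> B" for z
    proof -
      have "f z \<in> C" using B that by blast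
      then show ?thesis using O'(2) by blast
    qed
    then show ?thesis using B(2) by auto
  qed
  ultimately show ?thesis by simp
qed

text \<open>The n-fold sum A + ... + A, increasing in n when 0 lies in A. As an iterated image under
  addition it inherits compactness and countable networks by induction.\<close>

primrec partial_sums :: "'a::real_vector set \<Rightarrow> nat \<Rightarrow> 'a set" where
  "partial_sums A 0 = {0}"
| "partial_sums A (Suc n) = (\<lambda>(u, v). u + v) ` (partial_sums A n \<times> A)"

lemma partial_sums_mono: "A \<subseteq> B \<Longrightarrow> partial_sums A n \<subseteq> partial_sums B n"
proof (induction n)
  case (Suc n)
  then have "partial_sums A n \<times> A \<subseteq> partial_sums B n \<times> B" by blast
  then show ?case by (simp add: image_mono)
qed simp

lemma partial_sums_Suc_subset: "0 \<in> A \<Longrightarrow> partial_sums A n \<subseteq> partial_sums A (Suc n)"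
  by force

lemma partial_sums_add:
  "u \<in> partial_sums A m \<Longrightarrow> v \<in> partial_sums A n \<Longrightarrow> u + v \<in> partial_sums A (m + n)"
proof (induction n arbitrary: v)
  case (Suc n)
  then obtain w a where w: "v = w + a" "w \<in> partial_sums A n" "a \<in> A" by auto
  then have "u + w \<in> partial_sums A (m + n)" using Suc by blast
  then have "(u + w) + a \<in> partial_sums A (m + Suc n)" using w(3) by force
  then show ?case using w(1) by (simp add: add.assoc)
qed simp

lemma partial_sums_scale:
  "u \<in> partial_sums A n \<Longrightarrow> (\<And>a. a \<in> A \<Longrightarrow> r *\<^sub>R a \<in> B) \<Longrightarrow> r *\<^sub>R u \<in> partial_sums B n"
proof (induction n arbitrary: u)
  case (Suc n)
  then obtain w a where w: "u = w + a" "w \<in> partial_sums A n" "a \<in> A" by auto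
  then have "r *\<^sub>R w \<in> partial_sums B n" "r *\<^sub>R a \<in> B" using Suc by blast+
  then show ?case using w(1) by (force simp: scaleR_add_right)
qed simp

context free_lts
begin

lemma continuous_map_add_L: "continuous_map (prod_topology L L) L (\<lambda>(u, v). u + v)"
  using lts by (simp add: lin_top_space_def)

lemma continuous_scaled_delta:
  "continuous_map (prod_topology euclideanreal X) L (\<lambda>(t, x). t *\<^sub>R \<delta> x)"
proof -
  have "continuous_map (prod_topology euclideanreal X) L (\<lambda>p. fst p *\<^sub>R \<delta> (snd p))"
    by (intro continuous_map_lts_scaleR lts continuous_map_fst)
       (use continuous_map_compose[OF continuous_map_snd continuous_delta] in \<open>simp add: o_def\<close>)
  then show ?thesis by (simp add: split_def)
qed

lemma partial_sums_subset: "A \<subseteq> topspace L \<Longrightarrow> partial_sums A n \<subseteq> topspace L"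
  by (induction n) (use subspace_L in \<open>auto simp: subspace_def\<close>)

lemma compactin_partial_sums: "compactin L A \<Longrightarrow> compactin L (partial_sums A n)"
proof (induction n)
  case (Suc n)
  then have "compactin (prod_topology L L) (partial_sums A n \<times> A)" by (simp add: compactin_Times)
  then show ?case using continuous_map_add_L by (simp add: image_compactin)
qed (simp add: subspace_0[OF subspace_L])

lemma has_countable_network_partial_sums:
  "has_countable_network L A \<Longrightarrow> A \<subseteq> topspace L \<Longrightarrow> has_countable_network L (partial_sums A n)"
proof (induction n)
  case 0
  show ?case unfolding has_countable_network_def by (intro exI[of _ "{{0}}"]) auto
next
  case (Suc n)
  then show ?case
    using has_countable_network_image_prod[OF continuous_map_add_L, of "partial_sums A n" A] partial_sums_subset by simp
qed

lemma in_partial_sums: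
  assumes "w \<in> topspace L" "\<And>x. x \<in> supp w \<Longrightarrow> coef w x *\<^sub>R \<delta> x \<in> A"
  shows "w \<in> partial_sums A (card (supp w))"
proof -
  have "(\<Sum>x\<in>S. coef w x *\<^sub>R \<delta> x) \<in> partial_sums A (card S)" if "finite S" "S \<subseteq> supp w" for S
    using that
  proof (induction S)
    case (insert x S)
    then have "(\<Sum>x\<in>S. coef w x *\<^sub>R \<delta> x) \<in> partial_sums A (card S)" "coef w x *\<^sub>R \<delta> x \<in> A"
      using assms(2) by auto
    then have "(\<Sum>x\<in>S. coef w x *\<^sub>R \<delta> x) + coef w x *\<^sub>R \<delta> x \<in> partial_sums A (Suc (card S))" by force
    then show ?case using insert by (simp add: add.commute)
  qed simp
  then show ?thesis using finite_supp expansion[OF assms(1)] by (metis order_refl)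
qed

text \<open>\<open>L\<close> is the countable union of the n-fold sums of the set of all t
  \<delta>(x), which is a continuous image of \<real> \<times> X and so has a countable
  network.\<close>

lemma cosmic_free:
  assumes c: "cosmic_space X" shows "cosmic_space L"
proof -
  let ?f = "\<lambda>(t, x). t *\<^sub>R \<delta> x"
  define A where "A = ?f ` (UNIV \<times> topspace X)"
  have "has_countable_network X (topspace X)"
    using c has_countable_network_topspace unfolding cosmic_space_def by blast
  then have "has_countable_network L A"
    unfolding A_def by (intro has_countable_network_image_prod[OF continuous_scaled_delta] has_countable_network_euclidean) auto
  moreover have "A \<subseteq> topspace L" using subspace_L delta_in by (auto simp: A_def subspace_def)
  ultimately have "has_countable_network L (partial_sums A n)" for n by (rule has_countable_network_partial_sums)
  then have "has_countable_network L (\<Union>n. partial_sums A n)" by (intro has_countable_network_UN) auto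
  moreover have "(\<Union>n. partial_sums A n) = topspace L"
  proof
    show "(\<Union>n. partial_sums A n) \<subseteq> topspace L" using partial_sums_subset[OF \<open>A \<subseteq> topspace L\<close>] by blast
    have "coef w x *\<^sub>R \<delta> x \<in> A" if "x \<in> supp w" for w x
      using that supp_subset by (force simp: A_def)
    then have "w \<in> partial_sums A (card (supp w))" if "w \<in> topspace L" for w
      using that by (intro in_partial_sums)
    then show "topspace L \<subseteq> (\<Union>n. partial_sums A n)" by auto
  qed
  ultimately have "\<exists>\<N>. countable \<N> \<and> network_of L \<N>" using has_countable_network_topspace by metis
  then show ?thesis
    using lts lin_top_space_regular unfolding cosmic_space_def lin_top_space_def
    by (meson Hausdorff_imp_t1_space)
qed

text \<open>The inductive limit topology on \<open>L\<close> of the compact sets \<open>C n\<close> of sums of at most \<open>n\<close> terms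
  \<open>t \<delta> x\<close> with \<open>\<bar>t\<bar> \<le> n\<close> and \<open>x \<in> K n\<close> is linear and makes \<open>\<delta>\<close> continuous, so by the universal
  property it is the topology of \<open>L\<close>.\<close>

lemma k_omega_free:
  assumes K: "k_omega_sequence X K" shows "k_omega_space L"
proof -
  let ?f = "\<lambda>(t, x). t *\<^sub>R \<delta> x"
  \<comment> \<open>The inserted 0 makes the sums increase with the number of terms, also when
    \<open>K n\<close> is empty.\<close>
  define A where "A = (\<lambda>n. insert 0 (?f ` ({- real n..real n} \<times> K n)))"
  define C where "C = (\<lambda>n. partial_sums (A n) n)"
  have HL: "Hausdorff_space L" using lts by (simp add: lin_top_space_def)
  have Kc: "compactin X (K n)" for n using K by (simp add: k_omega_sequence_def)
  have Kmono: "K m \<subseteq> K n" if "m \<le> n" for m n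
    using K that by (simp add: k_omega_sequence_def incseq_def)
  have Kun: "\<Union>(range K) = topspace X" using K by (simp add: k_omega_sequence_def)
  have Acomp: "compactin L (A n)" for n
  proof -
    have "compactin (prod_topology euclideanreal X) ({- real n..real n} \<times> K n)"
      using Kc by (simp add: compactin_Times)
    then have "compactin L (?f ` ({- real n..real n} \<times> K n))" using continuous_scaled_delta by (rule image_compactin)
    then have "compactin L ({0} \<union> ?f ` ({- real n..real n} \<times> K n))"
      by (intro compactin_Un) (simp_all add: subspace_0[OF subspace_L])
    then show ?thesis by (simp add: A_def)
  qed
  have Amono: "A m \<subseteq> A n" if "m \<le> n" for m n
  proof -
    have "{- real m..real m} \<times> K m \<subseteq> {- real n..real n} \<times> K n" using Kmono[OF that] that by auto
    then show ?thesis unfolding A_def by blast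
  qed
  have A0: "0 \<in> A n" for n by (simp add: A_def)
  have A_I: "t *\<^sub>R \<delta> x \<in> A n" if "\<bar>t\<bar> \<le> real n" "x \<in> K n" for t x n
  proof -
    have "(t, x) \<in> {- real n..real n} \<times> K n" using that by auto
    then have "?f (t, x) \<in> A n" unfolding A_def by blast
    then show ?thesis by simp
  qed
  have Ccomp: "compactin L (C n)" for n unfolding C_def using Acomp by (rule compactin_partial_sums)
  have Cs: "C n \<subseteq> topspace L" for n using Ccomp by (rule compactin_subset_topspace)
  have ps_mono: "partial_sums (A n) i \<subseteq> partial_sums (A n) j" if "i \<le> j" for i j n
    by (rule lift_Suc_mono_le[OF _ that]) (rule partial_sums_Suc_subset[OF A0])
  have sub_C: "partial_sums (A m) i \<subseteq> C n" if "m \<le> n" "i \<le> n" for m i n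
    using partial_sums_mono[OF Amono[OF that(1)], of i] ps_mono[OF that(2), of n] by (auto simp: C_def)
  have Cmono: "C m \<subseteq> C n" if "m \<le> n" for m n
    using sub_C[OF that that] by (simp add: C_def)
  then have Cinc: "incseq C" by (simp add: incseq_def)
  have C_add: "u + v \<in> C (m + n)" if "u \<in> C m" "v \<in> C n" for u v m n
  proof -
    have "u \<in> partial_sums (A (m + n)) m" "v \<in> partial_sums (A (m + n)) n"
      using that partial_sums_mono[OF Amono[of m "m + n"], of m] partial_sums_mono[OF Amono[of n "m + n"], of n]
      by (auto simp: C_def)
    then show ?thesis unfolding C_def by (rule partial_sums_add)
  qed
  \<comment> \<open>The product m n bounds the new coefficients; n itself is needed for the number
    of terms and for the index of \<open>K\<close>, since m may be 0.\<close>
  have C_scale: "r *\<^sub>R u \<in> C (max n (m * n))" if "u \<in> C n" "r \<in> {- real m..real m}" for r u m n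
  proof -
    have "r *\<^sub>R a \<in> A (max n (m * n))" if aA: "a \<in> A n" for a
    proof (cases "a = 0")
      case False
      then obtain t x where a: "a = t *\<^sub>R \<delta> x" "\<bar>t\<bar> \<le> real n" "x \<in> K n" using aA by (auto simp: A_def)
      have "\<bar>r * t\<bar> \<le> real m * real n"
        unfolding abs_mult using \<open>r \<in> _\<close> a(2) by (intro mult_mono) auto
      also have "\<dots> \<le> real (max n (m * n))" by (simp flip: of_nat_mult)
      finally have "\<bar>r * t\<bar> \<le> real (max n (m * n))" .
      moreover have "x \<in> K (max n (m * n))" using a(3) Kmono[of n "max n (m * n)"] by auto
      ultimately have "(r * t) *\<^sub>R \<delta> x \<in> A (max n (m * n))" by (rule A_I)
      then show ?thesis using a(1) by simp
    qed (use A0 in simp)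
    with that(1) have "r *\<^sub>R u \<in> partial_sums (A (max n (m * n))) n"
      unfolding C_def by (rule partial_sums_scale)
    then show ?thesis using sub_C[of "max n (m * n)" "max n (m * n)" n] by auto
  qed
  have C_Un: "\<Union>(range C) = topspace L"
  proof
    show "\<Union>(range C) \<subseteq> topspace L" using Cs by blast
    show "topspace L \<subseteq> \<Union>(range C)"
    proof
      fix w assume w: "w \<in> topspace L"
      have "\<forall>x\<in>supp w. \<exists>n. x \<in> K n" using supp_subset Kun by blast
      then obtain k where k: "\<forall>x\<in>supp w. x \<in> K (k x)" by (rule bchoice[THEN exE])
      \<comment> \<open>One bound for the number of terms, the indices \<open>k x\<close> and the
        absolute values of the coefficients.\<close>
      define b where "b = card (supp w) + (\<Sum>x\<in>supp w. k x + nat \<lceil>\<bar>coef w x\<bar>\<rceil>)"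
      have b: "k x + nat \<lceil>\<bar>coef w x\<bar>\<rceil> \<le> b" if "x \<in> supp w" for x
        using member_le_sum[of x "supp w" "\<lambda>x. k x + nat \<lceil>\<bar>coef w x\<bar>\<rceil>"] that finite_supp by (simp add: b_def)
      have "coef w x *\<^sub>R \<delta> x \<in> A b" if x: "x \<in> supp w" for x
      proof -
        have "x \<in> K b" using k x b[OF x] Kmono[of "k x" b] by auto
        moreover have "\<bar>coef w x\<bar> \<le> real b" using b[OF x] by linarith
        ultimately show ?thesis using A_I by blast
      qed
      then have "w \<in> partial_sums (A b) (card (supp w))" using w by (intro in_partial_sums) auto
      then have "w \<in> C b" using sub_C[of b b "card (supp w)"] by (auto simp: b_def)
      then show "w \<in> \<Union>(range C)" by blast
    qed
  qed
  define T where "T = topology (\<lambda>U. U \<subseteq> topspace L \<and> (\<forall>n. openin (subtopology L (C n)) (U \<inter> C n)))"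
  have "istopology (\<lambda>U. U \<subseteq> topspace L \<and> (\<forall>n. openin (subtopology L (C n)) (U \<inter> C n)))"
    unfolding istopology_def
  proof (intro conjI allI impI)
    fix U V n
    assume "U \<subseteq> topspace L \<and> (\<forall>n. openin (subtopology L (C n)) (U \<inter> C n))"
      "V \<subseteq> topspace L \<and> (\<forall>n. openin (subtopology L (C n)) (V \<inter> C n))"
    then have "openin (subtopology L (C n)) ((U \<inter> C n) \<inter> (V \<inter> C n))" by (metis openin_Int)
    moreover have "(U \<inter> C n) \<inter> (V \<inter> C n) = U \<inter> V \<inter> C n" by blast
    ultimately show "openin (subtopology L (C n)) (U \<inter> V \<inter> C n)" by simp
  next
    fix \<U> n
    assume U: "\<forall>U\<in>\<U>. U \<subseteq> topspace L \<and> (\<forall>n. openin (subtopology L (C n)) (U \<inter> C n))"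
    then have "\<And>S. S \<in> (\<lambda>U. U \<inter> C n) ` \<U> \<Longrightarrow> openin (subtopology L (C n)) S" by auto
    then have "openin (subtopology L (C n)) (\<Union>U\<in>\<U>. U \<inter> C n)" by (rule openin_Union)
    then show "openin (subtopology L (C n)) (\<Union>\<U> \<inter> C n)" by (simp only: Int_Union2)
  qed auto
  then have openT: "openin T U \<longleftrightarrow> U \<subseteq> topspace L \<and> (\<forall>n. openin (subtopology L (C n)) (U \<inter> C n))" for U
    unfolding T_def by (simp add: topology_inverse')
  have LT: "openin T U" if "openin L U" for U
    using that openin_subset by (auto simp: openT openin_subtopology)
  have topT: "topspace T = topspace L"
  proof
    show "topspace T \<subseteq> topspace L" unfolding topspace_def[of T] using openT by blast
    show "topspace L \<subseteq> topspace T" using LT[OF openin_topspace] openin_subset by blast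
  qed
  have HT: "Hausdorff_space T"
    using HL LT unfolding Hausdorff_space_def topT by (metis (no_types))
  have UT: "openin (subtopology L (C n)) (U \<inter> C n)" if "openin T U" for U n
    using that openT by blast
  have deltaT: "continuous_map X T \<delta>"
    unfolding continuous_map_def topT
  proof (intro conjI allI impI)
    fix U assume U: "openin T U"
    show "openin X {x \<in> topspace X. \<delta> x \<in> U}"
    proof (rule k_omega_sequence_openin[OF K])
      fix n
      have Ks: "K n \<subseteq> topspace X" using Kc by (rule compactin_subset_topspace)
      \<comment> \<open>The coefficient 1 and one summand require index at least 1, and
        \<open>C 0\<close> is only {0}.\<close>
      have "\<delta> ` K n \<subseteq> C (Suc n)"
      proof (rule image_subsetI)
        fix x assume "x \<in> K n"
        then have "\<delta> x \<in> A (Suc n)" using A_I[of 1 "Suc n" x] Kmono[of n "Suc n"] by auto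
        then have "0 + \<delta> x \<in> partial_sums (A (Suc n)) (Suc 0)" by force
        then show "\<delta> x \<in> C (Suc n)" using sub_C[of "Suc n" "Suc n" "Suc 0"] by auto
      qed
      moreover have "continuous_map (subtopology X (K n)) L \<delta>" using continuous_delta by (rule continuous_map_from_subtopology)
      ultimately have "openin (subtopology X (K n)) {x \<in> K n. \<delta> x \<in> U}"
        using Ks by (intro openin_preimage_from_trace[OF UT[OF U]])
      moreover have "{x \<in> topspace X. \<delta> x \<in> U} \<inter> K n = {x \<in> K n. \<delta> x \<in> U}" using Ks by blast
      ultimately show "openin (subtopology X (K n)) ({x \<in> topspace X. \<delta> x \<in> U} \<inter> K n)" by simp
    qed auto
  qed (use delta_in in auto)
  have "lin_top_space T"
    unfolding lin_top_space_def topT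
  proof (intro conjI subspace_L HT)
    show "continuous_map (prod_topology T T) T (\<lambda>(u, v). u + v)"
      unfolding continuous_map_def
    proof (intro conjI allI impI)
      show "(\<lambda>(u, v). u + v) \<in> topspace (prod_topology T T) \<rightarrow> topspace T"
        using subspace_L by (auto simp: topT subspace_def)
      fix U assume U: "openin T U"
      let ?W = "{p \<in> topspace (prod_topology T T). (\<lambda>(u, v). u + v) p \<in> U}"
      show "openin (prod_topology T T) ?W"
        unfolding openin_prod_topology_alt
      proof (intro allI impI)
        fix u v assume uv: "(u, v) \<in> ?W"
        have W: "openin (subtopology (prod_topology L L) (C n \<times> C n)) (?W \<inter> C n \<times> C n)" for n
        proof -
          have "openin (subtopology (prod_topology L L) (C n \<times> C n)) {p \<in> C n \<times> C n. (\<lambda>(u, v). u + v) p \<in> U}"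
          proof (rule openin_preimage_from_trace[OF UT[OF U]])
            show "continuous_map (subtopology (prod_topology L L) (C n \<times> C n)) L (\<lambda>(u, v). u + v)"
              using continuous_map_add_L by (rule continuous_map_from_subtopology)
            show "(\<lambda>(u, v). u + v) ` (C n \<times> C n) \<subseteq> C (n + n)"
              using C_add by auto
            show "C n \<times> C n \<subseteq> topspace (prod_topology L L)" using Cs by auto
          qed
          moreover have "?W \<inter> C n \<times> C n = {p \<in> C n \<times> C n. (\<lambda>(u, v). u + v) p \<in> U}" using Cs by (auto simp: topT)
          ultimately show ?thesis by simp
        qed
        have "u \<in> \<Union>(range C)" "v \<in> \<Union>(range C)" using uv C_Un by (auto simp: topT)
        then obtain G H where GH: "\<And>n. openin (subtopology L (C n)) (G \<inter> C n)" "G \<subseteq> \<Union>(range C)" "u \<in> G"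
          "\<And>n. openin (subtopology L (C n)) (H \<inter> C n)" "H \<subseteq> \<Union>(range C)" "v \<in> H" "G \<times> H \<subseteq> ?W"
          by (rule k_omega_box[OF HL Ccomp Cinc HL Ccomp Cinc W _ _ uv]) (rule that)
        then have "openin T G" "openin T H" by (simp_all add: openT C_Un)
        then show "\<exists>G H. openin T G \<and> openin T H \<and> u \<in> G \<and> v \<in> H \<and> G \<times> H \<subseteq> ?W"
          using GH(3,6,7) by (intro exI[of _ G] exI[of _ H]) simp
      qed
    qed
    show "continuous_map (prod_topology euclideanreal T) T (\<lambda>(r, v). r *\<^sub>R v)"
      unfolding continuous_map_def
    proof (intro conjI allI impI)
      show "(\<lambda>(r, v). r *\<^sub>R v) \<in> topspace (prod_topology euclideanreal T) \<rightarrow> topspace T"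
        using subspace_L by (auto simp: topT subspace_def)
      fix U assume U: "openin T U"
      let ?W = "{p \<in> topspace (prod_topology euclideanreal T). (\<lambda>(r, v). r *\<^sub>R v) p \<in> U}"
      define I where "I = (\<lambda>n. {- real n..real n})"
      have I: "compactin euclideanreal (I n)" "incseq I" for n
        by (auto simp: I_def incseq_def)
      show "openin (prod_topology euclideanreal T) ?W"
        unfolding openin_prod_topology_alt
      proof (intro allI impI)
        fix r v assume rv: "(r, v) \<in> ?W"
        have W: "openin (subtopology (prod_topology euclideanreal L) (I n \<times> C n)) (?W \<inter> I n \<times> C n)" for n
        proof -
          have "openin (subtopology (prod_topology euclideanreal L) (I n \<times> C n)) {p \<in> I n \<times> C n. (\<lambda>(r, v). r *\<^sub>R v) p \<in> U}"
          proof (rule openin_preimage_from_trace[OF UT[OF U]])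
            show "continuous_map (subtopology (prod_topology euclideanreal L) (I n \<times> C n)) L (\<lambda>(r, v). r *\<^sub>R v)"
              using lts by (intro continuous_map_from_subtopology) (simp add: lin_top_space_def)
            show "(\<lambda>(r, v). r *\<^sub>R v) ` (I n \<times> C n) \<subseteq> C (max n (n * n))"
              using C_scale[of _ n _ n] by (auto simp: I_def)
            show "I n \<times> C n \<subseteq> topspace (prod_topology euclideanreal L)" using Cs by auto
          qed
          moreover have "?W \<inter> I n \<times> C n = {p \<in> I n \<times> C n. (\<lambda>(r, v). r *\<^sub>R v) p \<in> U}" using Cs by (auto simp: topT)
          ultimately show ?thesis by simp
        qed
        obtain n where n: "\<bar>r\<bar> < real n" using reals_Archimedean2 by blast
        then have "r \<in> I n" by (auto simp: I_def)
        then have "r \<in> \<Union>(range I)" by blast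
        moreover have "v \<in> \<Union>(range C)" using rv C_Un by (auto simp: topT)
        ultimately obtain G H where GH: "\<And>n. openin (subtopology euclideanreal (I n)) (G \<inter> I n)" "G \<subseteq> \<Union>(range I)" "r \<in> G"
          "\<And>n. openin (subtopology L (C n)) (H \<inter> C n)" "H \<subseteq> \<Union>(range C)" "v \<in> H" "G \<times> H \<subseteq> ?W"
          by (rule k_omega_box[OF Hausdorff_space_euclidean I HL Ccomp Cinc W _ _ rv]) (rule that)
        then have "openin T H" by (simp add: openT C_Un)
        obtain O' where O': "open O'" "G \<inter> I n = O' \<inter> I n"
          using GH(1)[of n] by (auto simp: openin_subtopology)
        \<comment> \<open>\<open>G\<close> is known to be open only relative to the compact
          intervals; cutting with an open interval around r gives a set open in the real
          line.\<close>
        define G' where "G' = O' \<inter> {- real n<..<real n}"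
        have nI: "{- real n<..<real n} \<subseteq> I n" and rI: "r \<in> {- real n<..<real n}"
          using n by (auto simp: I_def)
        have G'G: "G' \<subseteq> G" using O'(2) nI unfolding G'_def by blast
        moreover have "r \<in> G'" using O'(2) GH(3) nI rI unfolding G'_def by blast
        moreover have "open G'" unfolding G'_def using O'(1) by (intro open_Int) simp_all
        moreover have "G' \<times> H \<subseteq> ?W" using G'G GH(7) by (meson Sigma_mono order_refl order_trans)
        ultimately show "\<exists>G H. openin euclideanreal G \<and> openin T H \<and> r \<in> G \<and> v \<in> H \<and> G \<times> H \<subseteq> ?W"
          using GH(6) \<open>openin T H\<close> by (intro exI[of _ G'] exI[of _ H] conjI) simp_all
      qed
    qed
  qed
  have "free_lin_top_space_wrt TYPE('l) X L \<delta>" by (rule free_lin_top_space_universal[OF tychonoff free])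
  then have univ: "\<exists>!g. g \<in> extensional (topspace L) \<and> continuous_linear_operator L Y g \<and> (\<forall>x\<in>topspace X. g (\<delta> x) = f x)"
    if "lin_top_space Y" "continuous_map X Y f" for Y :: "'l topology" and f
    using that unfolding free_lin_top_space_wrt_def by blast
  \<comment> \<open>\<open>T\<close> is finer than the topology of \<open>L\<close>, so
    \<open>g\<close> is also continuous from \<open>L\<close> to \<open>L\<close>. By uniqueness it
    is the identity, which makes the identity continuous from \<open>L\<close> to \<open>T\<close>
    and the two topologies equal.\<close>
  obtain g where g: "g \<in> extensional (topspace L)" "continuous_linear_operator L T g" "\<And>x. x \<in> topspace X \<Longrightarrow> g (\<delta> x) = \<delta> x"
    using univ[OF \<open>lin_top_space T\<close> deltaT] by blast
  have "continuous_map T L (\<lambda>w. w)" by (simp add: continuous_map_def topT) (use LT openin_subset in \<open>auto simp: Collect_conj_eq Int_absorb1\<close>)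
  then have "continuous_map L L g"
    using g(2) continuous_map_compose[of L T g L "\<lambda>w. w"] by (auto simp: continuous_linear_operator_def o_def)
  then have "continuous_linear_operator L L g" using g(2) by (simp add: continuous_linear_operator_def)
  moreover have "continuous_linear_operator L L (restrict (\<lambda>w. w) (topspace L))"
    by (rule continuous_linear_operator_restrict[OF subspace_L]) (simp add: continuous_linear_operator_def)
  ultimately have "g = restrict (\<lambda>w. w) (topspace L)"
    using univ[OF lts continuous_delta] g(1,3) delta_in by (metis (no_types, lifting) restrict_apply' restrict_extensional)
  then have "continuous_map L T (\<lambda>w. w)"
    using g(2) continuous_map_eq[of L T g "\<lambda>w. w"] by (simp add: continuous_linear_operator_def)
  then have TL: "openin L U" if "openin T U" for U
  proof -
    have "openin L {w \<in> topspace L. w \<in> U}"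
      using \<open>continuous_map L T (\<lambda>w. w)\<close> that by (rule openin_continuous_map_preimage)
    moreover have "{w \<in> topspace L. w \<in> U} = U" using that openT by blast
    ultimately show ?thesis by simp
  qed
  have "k_omega_sequence L C" unfolding k_omega_sequence_def
  proof (intro conjI allI impI Cinc Ccomp C_Un)
    fix F assume F: "F \<subseteq> topspace L" "\<forall>n. closedin (subtopology L (C n)) (F \<inter> C n)"
    have "openin (subtopology L (C n)) ((topspace L - F) \<inter> C n)" for n
      using openin_subtopology_iff_complement[OF Cs, of "topspace L - F" n] F by (simp add: double_diff)
    then have "openin L (topspace L - F)" by (intro TL) (simp add: openT)
    then show "closedin L F" using F(1) by (simp add: closedin_def)
  qed
  then show ?thesis using k_omega_space_iff_sequence by blast
qed

text \<open>A \<open>k_omega_space\<close> is \<sigma>-compact, hence Lindelof, and regular Lindelof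
  spaces are normal. Complete regularity is required for the Ascoli property.\<close>

lemma tychonoff_free:
  assumes "k_omega_space L" shows "tychonoff_space L"
proof -
  obtain C where C: "k_omega_sequence L C" using assms k_omega_space_iff_sequence by blast
  have "Lindelof_space (subtopology L (\<Union>(range C)))"
  proof (rule Lindelof_space_Union)
    show "Lindelof_space (subtopology L K)" if "K \<in> range C" for K
      using that C by (intro compact_imp_Lindelof_space) (auto simp: k_omega_sequence_def compactin_subspace)
  qed simp
  then have "Lindelof_space L" using C by (simp add: k_omega_sequence_def)
  then have "normal_space L" using lin_top_space_regular[OF lts] by (simp add: regular_Lindelof_imp_normal_space)
  then show ?thesis
    using lts normal_imp_completely_regular_space Hausdorff_imp_t1_space
    unfolding tychonoff_space_def lin_top_space_def by blast
qed

end

theorem theorem1p23: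
  fixes X :: "'x topology" and L :: "'l::real_vector topology" and \<delta> :: "'x \<Rightarrow> 'l"
  assumes "tychonoff_space X" and "mu_complete_space X" and "k_R_space X"
    and "free_lin_top_space X L \<delta>"
  shows "((cosmic_space X \<and> k_omega_space X) \<longleftrightarrow> (cosmic_space L \<and> k_omega_space L)) \<and>
         ((cosmic_space X \<and> k_omega_space X) \<longleftrightarrow> (aleph_k_space X \<and> k_space L)) \<and>
         ((cosmic_space X \<and> k_omega_space X) \<longleftrightarrow> (bar_aleph_k_space X \<and> ascoli_space L)) \<and>
         ((cosmic_space X \<and> k_omega_space X) \<longleftrightarrow>
            (bar_aleph_k_space X \<and> (\<nexists>F. strong_fin_omega1_fan L F))) \<and>
         ((cosmic_space X \<and> k_omega_space X) \<longleftrightarrow>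
            (aleph_k_space X \<and> (\<nexists>F. fin_omega1_fan L F)))"
proof -
  interpret free_lts X L \<delta> using assms(1,4) by unfold_locales
  have HL: "Hausdorff_space L" using lts by (simp add: lin_top_space_def)
  let ?c1 = "cosmic_space X \<and> k_omega_space X"
  have c12: "cosmic_space L \<and> k_omega_space L" if ?c1
    using that cosmic_free k_omega_free k_omega_space_iff_sequence by blast
  have c21: ?c1 if "cosmic_space L \<and> k_omega_space L"
    using that cosmic_k_omega_from_free by blast
  have bar: "bar_aleph_k_space X" "aleph_k_space X" if ?c1
    using that cosmic_k_omega_imp_bar_aleph_k bar_aleph_k_imp_aleph_k by blast+
  have k: "k_space L" "ascoli_space L" if ?c1
    using c12[OF that] k_omega_space_imp_k_space tychonoff_free k_space_imp_ascoli by blast+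
  have weak_from_k: "\<nexists>F. fin_omega1_fan L F" if "k_space L"
    using k_space_no_fin_fan[OF that HL] by blast
  have strong_from_ascoli: "\<nexists>F. strong_fin_omega1_fan L F" if "ascoli_space L"
    using ascoli_no_strong_fin_fan[OF that] by blast
  have c51: ?c1 if "bar_aleph_k_space X" "\<nexists>F. strong_fin_omega1_fan L F"
    using that cosmic_k_omega_of_no_fans[OF assms(2,3)] unfolding bar_aleph_k_space_def by metis
  \<comment> \<open>Every strong fan is a fan, so both fan hypotheses of the core lemma are
    met.\<close>
  have c61: ?c1 if "aleph_k_space X" "\<nexists>F. fin_omega1_fan L F"
    using that cosmic_k_omega_of_no_fans[OF assms(2,3)] unfolding aleph_k_space_def strong_fin_omega1_fan_def by metis
  show ?thesis
    using c12 c21 bar k weak_from_k strong_from_ascoli c51 c61 by metis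
qed

end
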